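(* Let $n\ge2$ be an integer. The bilinear dyadic spherical maximal operator $A^d$ is bounded from $L^{p_1}(\mathbb R^n)\times L^{p_2}(\mathbb R^n)$ to $L^p(\mathbb R^n)$ whenever $2\le p_1,p_2\le\infty$, $1\le p\le2$ and $1/p=1/p_1+1/p_2$; that is, for such indices there is a finite constant $C$ such that $\|A^d(f,g)\|_{L^p}\le C\|f\|_{L^{p_1}}\|g\|_{L^{p_2}}$ for all $f\in L^{p_1}(\mathbb R^n)$ and $g\in L^{p_2}(\mathbb R^n)$.
   Context: Let $d\sigma$ be the surface measure on the unit sphere $\mathbb S^{2n-1}$ of $\mathbb R^{2n}=\mathbb R^n\times\mathbb R^n$. For $t>0$ set $$A_t(f,g)(x)=\int_{\mathbb S^{2n-1}}f(x-ty)\,g(x-tz)\,d\sigma(y,z),\qquad x\in\mathbb R^n,$$ and define the bilinear dyadic spherical maximal operator by $$A^d(f,g)(x)=\sup_{k\in\mathbb Z}|A_{2^k}(f,g)(x)|.$$ *)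

theory Defs
  imports "HOL-Probability.Essential_Supremum"
begin

text \<open>
  Surface measure on the unit sphere of a Euclidean space, in its polar-coordinate (cone) form
  \<open>\<sigma>(E) = d \<cdot> \<lambda>{r\<theta> | 0 < r < 1, \<theta> \<in> E}\<close>, where \<open>d\<close> is the dimension; it is not normalized
  to a probability measure.  The push-forward is taken along \<open>sgn v = v / \<bar>v\<bar>\<close>.
  Completing it makes sections of Lebesgue (not only Borel) measurable functions available.
\<close>
definition sphere_measure :: "'a::euclidean_space measure" where
  "sphere_measure = completion (scale_measure (of_nat DIM('a))
     (distr (restrict_space lborel (ball 0 1 - {0})) (restrict_space borel (sphere 0 1)) sgn))"

lemma measurable_sgn_sphere:
  "(sgn :: 'a::euclidean_space \<Rightarrow> 'a) \<in>
     restrict_space lborel (ball 0 1 - {0}) \<rightarrow>\<^sub>M restrict_space borel (sphere 0 1)"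
proof (rule measurable_restrict_space2)
  have "(\<lambda>v::'a. inverse (norm v) *\<^sub>R v) \<in> borel_measurable borel"
    by measurable
  then show "(sgn :: 'a \<Rightarrow> 'a) \<in> restrict_space lborel (ball 0 1 - {0}) \<rightarrow>\<^sub>M borel"
    by (intro measurable_restrict_space1) (simp add: sgn_div_norm[abs_def] inverse_eq_divide)
qed (auto simp: space_restrict_space norm_sgn)

lemma space_sphere_measure: "space (sphere_measure :: 'a::euclidean_space measure) = sphere 0 1"
  by (simp add: sphere_measure_def space_scale_measure space_restrict_space)

lemma emeasure_sphere_measure:
  fixes E :: "'a::euclidean_space set"
  assumes "E \<in> sets borel" "E \<subseteq> sphere 0 1"
  shows "emeasure sphere_measure E = of_nat DIM('a) * emeasure lborel {r *\<^sub>R v | r v. 0 < r \<and> r < 1 \<and> v \<in> E}"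
proof -
  have eq: "sgn -` E \<inter> (ball 0 1 - {0}) = {r *\<^sub>R v | r v. 0 < r \<and> r < 1 \<and> v \<in> E}" (is "?L = ?R")
  proof
    show "?L \<subseteq> ?R"
    proof
      fix x assume "x \<in> ?L"
      then have "x = norm x *\<^sub>R sgn x" "0 < norm x" "norm x < 1" "sgn x \<in> E"
        by (auto simp: sgn_div_norm)
      then show "x \<in> ?R" by blast
    qed
    show "?R \<subseteq> ?L"
    proof
      fix x assume "x \<in> ?R"
      then obtain r v where x: "x = r *\<^sub>R v" "0 < r" "r < 1" "v \<in> E" by blast
      then have "norm v = 1" using assms(2) by auto
      with x show "x \<in> ?L" by (auto simp: sgn_div_norm)
    qed
  qed
  have E: "E \<in> sets (restrict_space borel (sphere 0 1))"
    using assms by (auto simp: sets_restrict_space_iff)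
  have sub: "{r *\<^sub>R v | r v. 0 < r \<and> r < 1 \<and> v \<in> E} \<subseteq> ball 0 1 - {0}"
    using eq by blast
  have "emeasure (restrict_space lborel (ball 0 1 - {0})) {r *\<^sub>R v | r v. 0 < r \<and> r < 1 \<and> v \<in> E} =
      emeasure lborel {r *\<^sub>R v | r v. 0 < r \<and> r < 1 \<and> v \<in> E}"
    by (rule emeasure_restrict_space[OF _ sub]) auto
  then show ?thesis
    using E eq unfolding sphere_measure_def
    by (subst emeasure_completion)
      (auto simp: sets_scale_measure emeasure_scale_measure emeasure_distr[OF measurable_sgn_sphere E]
        space_restrict_space)
qed

text \<open>Powers of extended nonnegative reals, for positive real exponents.\<close>
definition ennreal_powr :: "ennreal \<Rightarrow> real \<Rightarrow> ennreal" where
  "ennreal_powr x a = (if x = \<infinity> then \<infinity> else ennreal (enn2real x powr a))"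

text \<open>
  The norm is defined for functions with values in \<open>[0, \<infinity>]\<close>, because a supremum of averages may be
  infinite at some points.
\<close>
definition Lp_norm :: "ennreal \<Rightarrow> ('a::euclidean_space \<Rightarrow> ennreal) \<Rightarrow> ennreal" where
  "Lp_norm p h = (if p = \<infinity> then esssup lebesgue h
     else ennreal_powr (\<integral>\<^sup>+ x. ennreal_powr (h x) (enn2real p) \<partial>lebesgue) (1 / enn2real p))"

definition Lp_functions :: "ennreal \<Rightarrow> ('a::euclidean_space \<Rightarrow> complex) set" where
  "Lp_functions p = {f \<in> borel_measurable lebesgue. Lp_norm p (\<lambda>x. ennreal (norm (f x))) < \<infinity>}"

definition sph_integrand ::
    "real \<Rightarrow> ('a::euclidean_space \<Rightarrow> complex) \<Rightarrow> ('a \<Rightarrow> complex) \<Rightarrow> 'a \<Rightarrow> 'a \<times> 'a \<Rightarrow> complex" where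
  "sph_integrand t f g x = (\<lambda>(y, z). f (x - t *\<^sub>R y) * g (x - t *\<^sub>R z))"

definition sph_avg ::
    "real \<Rightarrow> ('a::euclidean_space \<Rightarrow> complex) \<Rightarrow> ('a \<Rightarrow> complex) \<Rightarrow> 'a \<Rightarrow> complex" where
  "sph_avg t f g x = integral\<^sup>L sphere_measure (sph_integrand t f g x)"

definition dyadic_sph_max ::
    "('a::euclidean_space \<Rightarrow> complex) \<Rightarrow> ('a \<Rightarrow> complex) \<Rightarrow> 'a \<Rightarrow> ennreal" where
  "dyadic_sph_max f g x = (SUP k::int. ennreal (norm (sph_avg (2 powi k) f g x)))"

end

theory Submission
  imports Defs
    "HOL-Probability.Probability_Measure"
begin

text \<open>
  The marginals of the sphere of \<open>\<real>\<^sup>n \<times> \<real>\<^sup>n\<close> on either factor have bounded density on the unit ball, because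
  \<open>n \<ge> 2\<close>.  For \<open>p > 1\<close>, Young's inequality therefore dominates the normalised maximal function by the
  Hardy--Littlewood maximal functions of powers of \<open>\<bar>f\<bar>\<close> and \<open>\<bar>g\<bar>\<close>.

  The endpoint \<open>p = 1\<close>, \<open>p\<^sub>1 = p\<^sub>2 = 2\<close> uses the averages \<open>E\<^sub>k\<close> over dyadic cubes of side \<open>2\<^sup>k\<close> as a
  substitute for frequency localisation.  If one of the functions is replaced by \<open>E\<^sub>k f\<close>, the average at
  scale \<open>2\<^sup>k\<close> is bounded by a product of maximal functions.  For the remaining pair
  \<open>f - E\<^sub>k f\<close>, \<open>g - E\<^sub>k g\<close> the invariance of the sphere under rotations of the two factors expresses the bilinear
  average through the spherical means of each function separately, so that its \<open>L\<^sup>1\<close> norm is controlled by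
  square functions of spherical means averaged over the radius.  These gain a power of \<open>2\<^sup>i / 2\<^sup>k\<close> on functions with
  vanishing \<open>E\<^sub>i\<close>: the square function integrates the autocorrelation over balls, where the
  cancellation leaves only a thin annulus.  Decomposing \<open>f - E\<^sub>k f\<close> into
  martingale differences, the sum over all \<open>k\<close> is bounded by the \<open>L\<^sup>2\<close> norm.
\<close>

section \<open>Uniform measure on the sphere\<close>

text \<open>At \<open>p = 1\<close> the supremum over the scales cannot be left to a
  Hardy--Littlewood bound, which fails on L^1. A product \<open>hl_max F * hl_max G\<close> with
  both factors in L^2 is harmless; everything else is summed over all scales, so its bounds must be
  summable in the scale and not only uniform. Two facts supply this. Averages over nested cubes are
  exact orthogonal projections, so the energies of the pieces telescope without any Fourier
  analysis. And the gain for mean-zero functions comes from averaging over the radius: in the square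
  function the radius of the sphere and the length of a chord enter only through their product and
  may be exchanged, which replaces an integral over a sphere by one over a solid ball, whose
  indicator is constant on every cube that misses its boundary. The endpoint estimate is proved with
  the sum of two squared norms on the right; normalising the functions turns it into a product. No
  interpolation between triples of exponents is used.\<close>

lemma sets_borel_ball [measurable]:
  "ball x r \<in> sets borel" "cball x r \<in> sets borel" for x :: "'a::euclidean_space"
  by simp_all

section \<open>Affine and orthogonal changes of variables\<close>

lemma nn_integral_lborel_affine:
  fixes f :: "'a::euclidean_space \<Rightarrow> ennreal"
  assumes [measurable]: "f \<in> borel_measurable borel" and c: "c \<noteq> 0"
  shows "(\<integral>\<^sup>+x. f x \<partial>lborel) = ennreal (\<bar>c\<bar> ^ DIM('a)) * (\<integral>\<^sup>+x. f (t + c *\<^sub>R x) \<partial>lborel)"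
  by (subst lborel_affine[OF c, of t])
     (simp add: nn_integral_density nn_integral_distr nn_integral_cmult)

lemma nn_integral_lborel_shift:
  fixes f :: "'a::euclidean_space \<Rightarrow> ennreal"
  assumes "f \<in> borel_measurable borel"
  shows "(\<integral>\<^sup>+x. f (t + x) \<partial>lborel) = (\<integral>\<^sup>+x. f x \<partial>lborel)"
  using nn_integral_lborel_affine[OF assms, of 1 t] by simp

lemma nn_integral_lborel_reflect:
  fixes f :: "'a::euclidean_space \<Rightarrow> ennreal"
  assumes "f \<in> borel_measurable borel"
  shows "(\<integral>\<^sup>+x. f (t - x) \<partial>lborel) = (\<integral>\<^sup>+x. f x \<partial>lborel)"
  using nn_integral_lborel_affine[OF assms, of "-1" t] by simp

lemma orthogonal_transformation_borel:
  fixes R :: "'a::euclidean_space \<Rightarrow> 'a"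
  assumes "orthogonal_transformation R"
  shows "R \<in> borel_measurable borel"
  using orthogonal_transformation_linear[OF assms]
  by (intro borel_measurable_continuous_onI linear_continuous_on) (simp add: linear_conv_bounded_linear)

text \<open>The integral \<open>?I\<close>, over all \<open>x\<close> and over \<open>y\<close> in
  the unit ball, is evaluated twice. With \<open>x\<close> integrated first, the shift by
  \<open>R' y\<close> disappears, and the volume of the ball times the image measure of
  \<open>A\<close> remains. With \<open>y\<close> integrated first and shifted by
  \<open>- R x\<close>, the rotation meets only the ball, which it preserves, and the volume of the
  ball times the Lebesgue measure of \<open>A\<close> remains. Translations and reflections suffice;
  no determinant is computed.\<close>

lemma orthogonal_transformation_distr_lborel:
  fixes R :: "'a::euclidean_space \<Rightarrow> 'a"
  assumes R: "orthogonal_transformation R"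
  shows "distr lborel borel R = lborel"
proof (rule measure_eqI)
  note [measurable] = orthogonal_transformation_borel[OF R]
  let ?B = "ball (0::'a) 1"
  obtain R' where R': "orthogonal_transformation R'" "R' \<circ> R = id" "R \<circ> R' = id"
    using R orthogonal_transformation_inv[OF R] orthogonal_transformation_bij[OF R]
    by (metis bij_is_inj bij_is_surj inv_o_cancel surj_iff)
  note [measurable] = orthogonal_transformation_borel[OF R'(1)]
  have RR': "R (R' x) = x" for x using R'(3) by (metis comp_apply id_apply)
  fix A assume "A \<in> sets (distr lborel borel R)"
  then have [measurable]: "A \<in> sets borel" by simp
  have lin: "R (x + y) = R x + R y" for x y
    using orthogonal_transformation_linear[OF R] by (rule linear_add)
  have nrm: "norm (R' x) = norm x" for x
    using orthogonal_transformation_norm[OF R'(1)] .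
  let ?I = "\<integral>\<^sup>+y. \<integral>\<^sup>+x. indicator A (R x + y) * indicator ?B y \<partial>lborel \<partial>lborel :: ennreal"
  have "?I = (\<integral>\<^sup>+y. \<integral>\<^sup>+x. indicator A (R (R' y + x)) * indicator ?B y \<partial>lborel \<partial>lborel)"
    by (intro nn_integral_cong) (simp add: lin RR' add.commute)
  also have "\<dots> = (\<integral>\<^sup>+y. \<integral>\<^sup>+x. indicator A (R x) * indicator ?B y \<partial>lborel \<partial>lborel)"
    by (intro nn_integral_cong nn_integral_lborel_shift) measurable
  also have "\<dots> = (\<integral>\<^sup>+x. indicator A (R x) \<partial>lborel) * emeasure lborel ?B"
    by (simp add: nn_integral_multc nn_integral_cmult_indicator)
  also have "\<dots> = emeasure lborel ?B * emeasure (distr lborel borel R) A"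
    using nn_integral_distr[of R lborel borel "indicator A"] by (simp add: mult.commute)
  finally have 1: "?I = emeasure lborel ?B * emeasure (distr lborel borel R) A" .
  have "?I = (\<integral>\<^sup>+x. \<integral>\<^sup>+y. indicator A (R x + y) * indicator ?B y \<partial>lborel \<partial>lborel)"
    by (rule lborel_pair.Fubini') measurable
  also have "\<dots> = (\<integral>\<^sup>+x. \<integral>\<^sup>+y. indicator A (R x + (- R x + y)) * indicator ?B (- R x + y) \<partial>lborel \<partial>lborel)"
    by (intro nn_integral_cong nn_integral_lborel_shift[symmetric]) measurable
  also have "\<dots> = (\<integral>\<^sup>+y. \<integral>\<^sup>+x. indicator A y * indicator ?B (- R x + y) \<partial>lborel \<partial>lborel)"
    by (subst lborel_pair.Fubini') auto
  also have "\<dots> = (\<integral>\<^sup>+y. \<integral>\<^sup>+x. indicator A y * indicator ?B (R' y - x) \<partial>lborel \<partial>lborel)"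
  proof (intro nn_integral_cong)
    fix x y :: 'a
    have "norm (- R x + y) = norm (R' y - x)"
      using orthogonal_transformation_norm[OF R, of "R' y - x"]
        linear_diff[OF orthogonal_transformation_linear[OF R], of "R' y" x] RR'
      by simp
    then show "(indicator A y * indicator ?B (- R x + y) :: ennreal) = indicator A y * indicator ?B (R' y - x)"
      by (simp add: indicator_def)
  qed
  also have "\<dots> = (\<integral>\<^sup>+y. \<integral>\<^sup>+x. indicator A y * indicator ?B x \<partial>lborel \<partial>lborel)"
    by (intro nn_integral_cong nn_integral_lborel_reflect) measurable
  also have "\<dots> = emeasure lborel ?B * emeasure lborel A"
    by (simp add: nn_integral_cmult nn_integral_multc mult.commute)
  finally have "emeasure lborel ?B * emeasure (distr lborel borel R) A = emeasure lborel ?B * emeasure lborel A"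
    using 1 by simp
  moreover have "emeasure lborel ?B \<noteq> 0" "emeasure lborel ?B \<noteq> top"
    by (simp_all add: emeasure_ball ennreal_eq_0_iff not_le)
  ultimately show "emeasure (distr lborel borel R) A = emeasure lborel A"
    by (simp add: ennreal_mult_cancel_left)
qed simp

text \<open>The reflection in the hyperplane orthogonal to \<open>w = a - b\<close>: equality of the
  norms gives \<open>2 * (a \<bullet> w) = w \<bullet> w\<close>, so \<open>a\<close> is moved by
  exactly \<open>w\<close>. Transitivity on spheres is used below whenever a point may be assumed to
  lie in a convenient direction.\<close>

lemma orthogonal_transformation_reflection:
  fixes a b :: "'a::euclidean_space"
  assumes "norm a = norm b"
  obtains R where "orthogonal_transformation R" "R a = b"
proof (cases "a = b")
  case True
  then show ?thesis using that[of "\<lambda>x. x"] by simp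
next
  case False
  define w where "w = a - b"
  define R where "R x = x - (2 * (x \<bullet> w) / (w \<bullet> w)) *\<^sub>R w" for x
  have ww: "w \<bullet> w \<noteq> 0" using False by (simp add: w_def)
  have "linear R"
    unfolding R_def by (intro linearI) (auto simp: algebra_simps add_divide_distrib)
  moreover have "R x \<bullet> R y = x \<bullet> y" for x y
    unfolding R_def using ww by (simp add: inner_diff_left inner_diff_right inner_commute field_simps)
  ultimately have "orthogonal_transformation R"
    unfolding orthogonal_transformation_def by simp
  moreover have "a \<bullet> a = b \<bullet> b" using assms by (simp add: norm_eq)
  then have "2 * (a \<bullet> w) = w \<bullet> w"
    by (simp add: w_def inner_diff_left inner_diff_right inner_commute)
  then have "R a = b" unfolding R_def using ww by (simp add: w_def)
  ultimately show ?thesis using that by blast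
qed

text \<open>Normalised and defined on the Borel sets of the whole space, so that measurability can
  be handled without subspaces and completions; it differs from the surface measure by a constant
  factor. The value \<open>sgn 0 = 0\<close> is taken on a null set only.\<close>

definition usph :: "'a::euclidean_space measure" where
  "usph = distr (uniform_measure lborel (ball 0 1)) borel sgn"

lemma borel_measurable_sgn_euclidean [measurable]:
  "(sgn :: 'a::euclidean_space \<Rightarrow> 'a) \<in> borel_measurable borel"
proof -
  have "(\<lambda>v::'a. inverse (norm v) *\<^sub>R v) \<in> borel_measurable borel"
    by measurable
  then show ?thesis by (simp add: sgn_div_norm[abs_def] inverse_eq_divide)
qed

lemma sets_borel_sgn_vimage:
  "E \<in> sets borel \<Longrightarrow> sgn -` E \<in> sets (borel :: 'a::euclidean_space measure)"
  by (rule measurable_sets_borel[OF borel_measurable_sgn_euclidean])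

lemma sets_borel_norm_vimage:
  "E \<in> sets borel \<Longrightarrow> norm -` E \<in> sets (borel :: 'a::euclidean_space measure)"
  by (rule measurable_sets_borel) simp_all

lemma scaleR_norm_sgn [simp]: "norm x *\<^sub>R sgn x = (x :: 'a::real_normed_vector)"
  by (cases "x = 0") (simp_all add: sgn_div_norm)

lemma emeasure_unit_ball_pos [simp]:
  "emeasure lborel (ball (0::'a::euclidean_space) 1) \<noteq> 0"
  "emeasure lborel (ball (0::'a::euclidean_space) 1) \<noteq> top"
  by (simp_all add: emeasure_ball ennreal_eq_0_iff not_le)

lemma sets_usph [simp, measurable_cong]: "sets usph = sets borel"
  and space_usph [simp]: "space usph = UNIV"
  by (simp_all add: usph_def)

lemma prob_space_usph: "prob_space (usph :: 'a::euclidean_space measure)"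
  unfolding usph_def by (intro prob_space.prob_space_distr prob_space_uniform_measure) auto

interpretation usph: prob_space usph
  by (rule prob_space_usph)

lemma nn_integral_usph:
  fixes F :: "'a::euclidean_space \<Rightarrow> ennreal"
  assumes [measurable]: "F \<in> borel_measurable borel"
  shows "(\<integral>\<^sup>+x. F x \<partial>usph) =
    (\<integral>\<^sup>+x. indicator (ball 0 1) x * F (sgn x) \<partial>lborel) / emeasure lborel (ball (0::'a) 1)"
  unfolding usph_def
  by (simp add: nn_integral_distr nn_integral_uniform_measure mult.commute)

lemma emeasure_usph:
  fixes E :: "'a::euclidean_space set"
  assumes [measurable]: "E \<in> sets borel"
  shows "emeasure usph E = emeasure lborel (ball 0 1 \<inter> sgn -` E) / emeasure lborel (ball (0::'a) 1)"
  unfolding usph_def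
  by (simp add: emeasure_distr sets_borel_sgn_vimage)

lemma AE_usph_norm: "AE x in (usph :: 'a::euclidean_space measure). norm x = 1"
proof -
  have "AE x in lborel. x \<noteq> (0::'a)"
    using AE_lborel_singleton by blast
  then have "AE x::'a in uniform_measure lborel (ball 0 1). norm (sgn x) = 1"
    by (intro AE_uniform_measureI) (auto simp: norm_sgn)
  then show ?thesis unfolding usph_def
    by (subst AE_distr_iff) auto
qed

lemma orthogonal_transformation_distr_usph:
  fixes R :: "'a::euclidean_space \<Rightarrow> 'a"
  assumes R: "orthogonal_transformation R"
  shows "distr usph borel R = usph"
proof (rule measure_eqI)
  note [measurable] = orthogonal_transformation_borel[OF R]
  have [measurable]: "ball (0::'a) 1 \<in> sets borel" by simp
  fix A assume "A \<in> sets (distr usph borel R)"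
  then have [measurable]: "A \<in> sets borel" by simp
  have nrm: "norm (R x) = norm x" for x
    using orthogonal_transformation_norm[OF R] .
  have "emeasure (distr usph borel R) A = (\<integral>\<^sup>+x. indicator A (R x) \<partial>usph)"
    using nn_integral_distr[of R usph borel "indicator A"] by simp
  also have "\<dots> = (\<integral>\<^sup>+x. indicator (ball 0 1) x * indicator A (R (sgn x)) \<partial>lborel) / emeasure lborel (ball (0::'a) 1)"
    by (subst nn_integral_usph) simp_all
  also have "(\<integral>\<^sup>+x. indicator (ball 0 1) x * indicator A (R (sgn x)) \<partial>lborel) =
     (\<integral>\<^sup>+x. indicator (ball 0 1) (R x) * indicator A (sgn (R x)) \<partial>lborel)"
    by (intro nn_integral_cong)
       (auto simp: sgn_div_norm nrm indicator_def linear_scale[OF orthogonal_transformation_linear[OF R]])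
  also have "\<dots> = (\<integral>\<^sup>+x. indicator (ball 0 1) x * indicator A (sgn x) \<partial>distr lborel borel R)"
    by (subst nn_integral_distr) measurable
  also have "\<dots> = (\<integral>\<^sup>+x. indicator (ball 0 1) x * indicator A (sgn x) \<partial>lborel)"
    by (simp add: orthogonal_transformation_distr_lborel[OF R])
  also have "\<dots> / emeasure lborel (ball (0::'a) 1) = (\<integral>\<^sup>+x. indicator A x \<partial>usph)"
    by (subst nn_integral_usph) simp_all
  also have "\<dots> = emeasure usph A" by simp
  finally show "emeasure (distr usph borel R) A = emeasure usph A" .
qed simp

section \<open>Polar coordinates\<close>

lemma emeasure_lborel_cone:
  fixes E :: "'a::euclidean_space set"
  assumes [measurable]: "E \<in> sets borel" and r: "r > 0"
  shows "emeasure lborel (ball 0 r \<inter> sgn -` E) = emeasure lborel (ball (0::'a) r) * emeasure usph E"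
proof -
  have [measurable]: "ball (0::'a) r \<in> sets borel" by simp
  have *: "emeasure lborel (ball 0 s \<inter> sgn -` E) = (\<integral>\<^sup>+x. indicator (ball 0 s) x * indicator E (sgn x) \<partial>lborel)" for s :: real
    using nn_integral_indicator[of "ball 0 s \<inter> sgn -` E" "lborel :: 'a measure"]
      sets.Int[OF _ sets_borel_sgn_vimage[OF assms(1)], of "ball 0 s"]
    by (simp add: sets_borel_sgn_vimage indicator_inter_arith indicator_def[of "sgn -` E"] indicator_def[of E])
  have "emeasure lborel (ball 0 r \<inter> sgn -` E) = (\<integral>\<^sup>+x. indicator (ball 0 r) x * indicator E (sgn x) \<partial>lborel)"
    by (rule *)
  also have "\<dots> = ennreal (\<bar>r\<bar> ^ DIM('a)) *
      (\<integral>\<^sup>+x. indicator (ball 0 r) (0 + r *\<^sub>R x) * indicator E (sgn (0 + r *\<^sub>R x)) \<partial>lborel)"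
    by (rule nn_integral_lborel_affine) (use r in auto)
  also have "(\<integral>\<^sup>+x. indicator (ball 0 r) (0 + r *\<^sub>R x) * indicator E (sgn (0 + r *\<^sub>R x)) \<partial>lborel) =
      (\<integral>\<^sup>+x. indicator (ball (0::'a) 1) x * indicator E (sgn x) \<partial>lborel)"
    using r by (intro nn_integral_cong) (auto simp: indicator_def sgn_scaleR)
  also have "\<dots> = emeasure lborel (ball 0 1 \<inter> sgn -` E)"
    by (rule *[symmetric])
  also have "\<dots> = emeasure lborel (ball (0::'a) 1) * emeasure usph E"
    by (simp add: emeasure_usph ennreal_times_divide ennreal_mult_divide_eq mult.commute[of "emeasure lborel (ball 0 1)"])
  also have "ennreal (\<bar>r\<bar> ^ DIM('a)) * \<dots> = emeasure lborel (ball (0::'a) r) * emeasure usph E"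
    using r by (simp add: emeasure_ball ennreal_mult' mult_ac)
  finally show ?thesis .
qed

text \<open>Independence of norm and direction is scale invariance: with directions restricted to
  \<open>E\<close>, the radial measures \<open>M1\<close> and \<open>M2\<close> agree on every
  half-line by the volume of cones, and half-lines generate the Borel sets. The law of the radius
  stays an image measure of Lebesgue measure; its density matters only for the marginals of the
  sphere.\<close>

lemma polar_product:
  "distr lborel (borel \<Otimes>\<^sub>M borel) (\<lambda>u::'a::euclidean_space. (norm u, sgn u)) =
    distr lborel borel (norm :: 'a \<Rightarrow> real) \<Otimes>\<^sub>M usph"
proof (rule pair_measure_eqI[symmetric])
  have nb: "norm -` {..<r} = ball (0::'a) r" for r :: real by auto
  have UN: "(\<Union>i::nat. {..<real i}) = UNIV"
    using reals_Archimedean2 by blast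
  show "sigma_finite_measure (distr lborel borel (norm :: 'a \<Rightarrow> real))"
    unfolding sigma_finite_measure_def
    by (intro exI[of _ "range (\<lambda>i::nat. {..<real i})"])
       (simp add: emeasure_distr nb emeasure_ball UN image_subset_iff)
  show "sigma_finite_measure (usph :: 'a measure)" by unfold_locales
  show "sets (distr lborel borel (norm :: 'a \<Rightarrow> real) \<Otimes>\<^sub>M usph) = sets (distr lborel (borel \<Otimes>\<^sub>M borel) (\<lambda>u::'a. (norm u, sgn u)))"
    unfolding sets_distr by (rule sets_pair_measure_cong) simp_all
  fix A :: "real set" and E :: "'a set"
  assume "A \<in> sets (distr lborel borel (norm :: 'a \<Rightarrow> real))" "E \<in> sets usph"
  then have [measurable]: "A \<in> sets borel" "E \<in> sets borel" by auto
  define M1 where "M1 = distr (density lborel (indicator (sgn -` E))) borel (norm :: 'a \<Rightarrow> real)"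
  define M2 where "M2 = scale_measure (emeasure usph E) (distr lborel borel (norm :: 'a \<Rightarrow> real))"
  have m1: "emeasure M1 B = emeasure lborel (norm -` B \<inter> sgn -` E)" if [measurable]: "B \<in> sets borel" for B
    unfolding M1_def
    by (simp add: emeasure_distr emeasure_restricted sets_borel_norm_vimage sets_borel_sgn_vimage Int_commute[of "norm -` B"])
  have m2: "emeasure M2 B = emeasure usph E * emeasure lborel ((norm :: 'a \<Rightarrow> real) -` B)" if [measurable]: "B \<in> sets borel" for B
    unfolding M2_def by (simp add: emeasure_distr)
  have eq: "emeasure M1 {..<r} = emeasure M2 {..<r}" for r
  proof -
    have *: "norm -` {..<r} = ball (0::'a) r" by auto
    show ?thesis
    proof (cases "r > 0")
      case True
      then show ?thesis
        using True by (simp add: m1 m2 * emeasure_lborel_cone mult.commute sets_borel_sgn_vimage)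
    next
      case False
      then show ?thesis by (simp add: m1 m2 * ball_empty)
    qed
  qed
  have "M1 = M2"
  proof (rule measure_eqI_generator_eq[where E="range lessThan" and \<Omega>=UNIV and A="\<lambda>i. {..<real i}"])
    show "Int_stable (range (lessThan :: real \<Rightarrow> _))"
    proof (rule Int_stableI)
      fix a b :: "real set" assume "a \<in> range lessThan" "b \<in> range lessThan"
      then obtain x y where "a = {..<x}" "b = {..<y}" by auto
      then have "a \<inter> b = {..<min x y}" by auto
      then show "a \<inter> b \<in> range lessThan" by blast
    qed
    show "sets M1 = sigma_sets UNIV (range lessThan)" "sets M2 = sigma_sets UNIV (range lessThan)"
      unfolding M1_def M2_def by (simp_all add: borel_Iio)
    show "(\<Union>i. {..<real i}) = UNIV" by (rule UN)
    fix i
    have "norm -` {..<real i} = ball (0::'a) (real i)" by auto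
    then show "emeasure M1 {..<real i} \<noteq> \<infinity>"
      unfolding eq by (simp add: m2 emeasure_ball ennreal_mult_eq_top_iff)
  qed (auto simp: eq)
  then have "emeasure M1 A = emeasure M2 A" by simp
  moreover have "(\<lambda>u::'a. (norm u, sgn u)) -` (A \<times> E) = norm -` A \<inter> sgn -` E" by auto
  ultimately show "emeasure (distr lborel borel (norm :: 'a \<Rightarrow> real)) A * emeasure usph E =
      emeasure (distr lborel (borel \<Otimes>\<^sub>M borel) (\<lambda>u::'a. (norm u, sgn u))) (A \<times> E)"
    by (simp add: m1 m2 emeasure_distr mult.commute)
qed

text \<open>The radius is the norm of a second Lebesgue point \<open>u\<close> instead of a variable
  with density, so that polar coordinates can be introduced and removed without leaving integrals
  over the space itself.\<close>

lemma nn_integral_polar: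
  fixes H :: "'a::euclidean_space \<Rightarrow> ennreal"
  assumes [measurable]: "H \<in> borel_measurable borel"
  shows "(\<integral>\<^sup>+u. H u \<partial>lborel) = (\<integral>\<^sup>+u. \<integral>\<^sup>+\<theta>. H (norm u *\<^sub>R \<theta>) \<partial>usph \<partial>(lborel :: 'a measure))"
proof -
  have "(\<integral>\<^sup>+u. H u \<partial>lborel) = (\<integral>\<^sup>+u. H (norm u *\<^sub>R sgn u) \<partial>lborel)"
    by simp
  also have "\<dots> = (\<integral>\<^sup>+(r, \<theta>). H (r *\<^sub>R \<theta>) \<partial>distr lborel (borel \<Otimes>\<^sub>M borel) (\<lambda>u::'a. (norm u, sgn u)))"
    by (subst nn_integral_distr) simp_all
  also have "\<dots> = (\<integral>\<^sup>+(r, \<theta>). H (r *\<^sub>R \<theta>) \<partial>(distr lborel borel (norm :: 'a \<Rightarrow> real) \<Otimes>\<^sub>M usph))"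
    by (simp add: polar_product)
  also have "\<dots> = (\<integral>\<^sup>+r. \<integral>\<^sup>+\<theta>. H (r *\<^sub>R \<theta>) \<partial>usph \<partial>distr lborel borel (norm :: 'a \<Rightarrow> real))"
    by (subst usph.nn_integral_fst[symmetric]) (simp_all)
  also have "\<dots> = (\<integral>\<^sup>+u. \<integral>\<^sup>+\<theta>. H (norm u *\<^sub>R \<theta>) \<partial>usph \<partial>(lborel :: 'a measure))"
    by (subst nn_integral_distr) simp_all
  finally show ?thesis .
qed

text \<open>
  Balls are not closed under intersection, so instead of a generator argument the mass of an open set is
  approximated by averaging the masses of the small balls contained in it.
\<close>

lemma measure_eqI_balls:
  fixes M N :: "'a::euclidean_space measure"
  assumes M: "finite_measure M" "sets M = sets borel" and N: "finite_measure N" "sets N = sets borel"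
    and eq: "\<And>v r. 0 < r \<Longrightarrow> emeasure M (ball v r) = emeasure N (ball v r)"
  shows "M = N"
proof -
  have le: "emeasure N U \<le> emeasure M U"
    if "open U" and M: "finite_measure M" "sets M = sets borel" and N: "finite_measure N" "sets N = sets borel"
      and eq: "\<And>v r. 0 < r \<Longrightarrow> emeasure M (ball v r) = emeasure N (ball v r)"
    for U and M N :: "'a measure"
  proof -
    interpret M: finite_measure M by fact
    interpret N: finite_measure N by fact
    note [measurable_cong] = M(2) N(2)
    have [measurable]: "U \<in> sets borel" using \<open>open U\<close> by simp
    \<comment> \<open>Centres of the balls of radius \<open>r\<close> contained in \<open>U\<close>.
      The set is closed because its complement is a union of balls, and these sets exhaust
      \<open>U\<close> as \<open>r\<close> decreases to 0.\<close>
    define W where "W r = {x. ball x r \<subseteq> U}" for r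
    have clW: "closed (W r)" for r
    proof -
      have "- W r = (\<Union>y\<in>-U. ball y r)"
        by (auto simp: W_def dist_commute)
      then show ?thesis by (metis closed_def open_UN open_ball)
    qed
    then have [measurable]: "W r \<in> sets borel" for r by simp
    \<comment> \<open>The factor 2 leaves room for a whole ball of centres: for \<open>u\<close> in
      \<open>W (2 * r)\<close> every \<open>v\<close> within \<open>r\<close> of \<open>u\<close>
      lies in \<open>W r\<close>, so the full volume \<open>?c\<close> is counted, while no centre
      in \<open>W r\<close> is within \<open>r\<close> of a point outside \<open>U\<close>.\<close>
    have *: "emeasure N (W (2 * r)) \<le> emeasure M U" if r: "r > 0" for r
    proof -
      let ?c = "emeasure lborel (ball (0::'a) r)"
      have bc: "emeasure lborel (ball u r) = ?c" for u :: 'a using r by (simp add: emeasure_ball)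
      have c: "?c \<noteq> 0" "?c \<noteq> top"
        using r by (simp_all add: emeasure_ball ennreal_eq_0_iff not_le)
      have fub: "(\<integral>\<^sup>+v. indicator (W r) v * emeasure L (ball v r) \<partial>lborel) =
          (\<integral>\<^sup>+u. (\<integral>\<^sup>+v. indicator (W r) v * indicator (ball u r) v \<partial>lborel) \<partial>L)"
        if L: "finite_measure L" and [measurable_cong]: "sets L = sets borel" for L :: "'a measure"
      proof -
        interpret L: finite_measure L by fact
        interpret P: pair_sigma_finite "lborel :: 'a measure" L ..
        have "(\<integral>\<^sup>+v. indicator (W r) v * emeasure L (ball v r) \<partial>lborel) =
          (\<integral>\<^sup>+v. (\<integral>\<^sup>+u. indicator (W r) v * indicator (ball v r) u \<partial>L) \<partial>lborel)"
          by (intro nn_integral_cong) (simp add: nn_integral_cmult_indicator that)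
        also have "\<dots> = (\<integral>\<^sup>+v. (\<integral>\<^sup>+u. indicator (W r) v * (if dist v u < r then 1 else 0) \<partial>L) \<partial>lborel)"
          by (intro nn_integral_cong) (simp add: indicator_def)
        also have "\<dots> = (\<integral>\<^sup>+u. (\<integral>\<^sup>+v. indicator (W r) v * (if dist v u < r then 1 else 0) \<partial>lborel) \<partial>L)"
          by (rule P.Fubini'[symmetric]) measurable
        also have "\<dots> = (\<integral>\<^sup>+u. (\<integral>\<^sup>+v. indicator (W r) v * indicator (ball u r) v \<partial>lborel) \<partial>L)"
          by (intro nn_integral_cong) (simp add: indicator_def dist_commute)
        finally show ?thesis .
      qed
      have "emeasure N (W (2 * r)) * ?c = (\<integral>\<^sup>+u. ?c * indicator (W (2 * r)) u \<partial>N)"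
        by (subst nn_integral_cmult_indicator) (simp_all add: N mult.commute)
      also have "\<dots> \<le> (\<integral>\<^sup>+u. (\<integral>\<^sup>+v. indicator (W r) v * indicator (ball u r) v \<partial>lborel) \<partial>N)"
      proof (intro nn_integral_mono)
        fix u
        show "?c * indicator (W (2 * r)) u \<le> (\<integral>\<^sup>+v. indicator (W r) v * indicator (ball u r) v \<partial>lborel)"
        proof (cases "u \<in> W (2 * r)")
          case True
          have "v \<in> W r" if "v \<in> ball u r" for v
          proof -
            have "ball v r \<subseteq> ball u (2 * r)"
            proof
              fix x assume "x \<in> ball v r"
              then show "x \<in> ball u (2 * r)"
                using that dist_triangle[of u x v] by (simp add: dist_commute)
            qed
            then show ?thesis using True by (auto simp: W_def)
          qed
          then have "(\<integral>\<^sup>+v. indicator (W r) v * indicator (ball u r) v \<partial>lborel) = (\<integral>\<^sup>+v. indicator (ball u r) v \<partial>lborel)"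
            by (intro nn_integral_cong) (auto simp: indicator_def)
          then show ?thesis using bc[of u] by (simp add: True)
        qed simp
      qed
      also have "\<dots> = (\<integral>\<^sup>+v. indicator (W r) v * emeasure N (ball v r) \<partial>lborel)"
        by (rule fub[symmetric]) fact+
      also have "\<dots> = (\<integral>\<^sup>+v. indicator (W r) v * emeasure M (ball v r) \<partial>lborel)"
        by (simp add: eq r)
      also have "\<dots> = (\<integral>\<^sup>+u. (\<integral>\<^sup>+v. indicator (W r) v * indicator (ball u r) v \<partial>lborel) \<partial>M)"
        by (rule fub) fact+
      also have "\<dots> \<le> (\<integral>\<^sup>+u. ?c * indicator U u \<partial>M)"
      proof (intro nn_integral_mono)
        fix u
        show "(\<integral>\<^sup>+v. indicator (W r) v * indicator (ball u r) v \<partial>lborel) \<le> ?c * indicator U u"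
        proof (cases "u \<in> U")
          case True
          have "(\<integral>\<^sup>+v. indicator (W r) v * indicator (ball u r) v \<partial>lborel) \<le> (\<integral>\<^sup>+v. indicator (ball u r) v \<partial>lborel)"
            by (intro nn_integral_mono) (auto simp: indicator_def)
          then show ?thesis using bc[of u] by (simp add: True)
        next
          case False
          then have z: "indicator (W r) v * indicator (ball u r) v = (0::ennreal)" for v
            by (auto simp: indicator_def W_def) (metis dist_commute mem_ball subsetD)
          show ?thesis unfolding z by simp
        qed
      qed
      also have "\<dots> = emeasure M U * ?c"
        by (subst nn_integral_cmult_indicator) (simp_all add: M mult.commute)
      finally show ?thesis
        using c by (simp add: ennreal_mult_le_mult_iff mult.commute[of _ ?c])
    qed
    have "U = (\<Union>i::nat. W (2 * (1 / real (Suc i))))"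
    proof
      show "U \<subseteq> (\<Union>i::nat. W (2 * (1 / real (Suc i))))"
      proof
        fix x assume "x \<in> U"
        then obtain e where e: "e > 0" "ball x e \<subseteq> U" using \<open>open U\<close> openE by blast
        obtain n where "1 / real (Suc n) < e / 2"
          using e reals_Archimedean[of "e/2"] by (auto simp: inverse_eq_divide)
        then have "ball x (2 * (1 / real (Suc n))) \<subseteq> ball x e" by (intro subset_ball) simp
        then show "x \<in> (\<Union>i::nat. W (2 * (1 / real (Suc i))))" using e by (auto simp: W_def)
      qed
      show "(\<Union>i::nat. W (2 * (1 / real (Suc i)))) \<subseteq> U"
        by (auto simp: W_def subset_iff)
    qed
    moreover have "incseq (\<lambda>i::nat. W (2 * (1 / real (Suc i))))"
    proof (intro monoI)
      fix i j :: nat assume "i \<le> j"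
      then have "2 * (1 / real (Suc j)) \<le> 2 * (1 / real (Suc i))" by (simp add: frac_le)
      then show "W (2 * (1 / real (Suc i))) \<subseteq> W (2 * (1 / real (Suc j)))"
        using subset_ball unfolding W_def by blast
    qed
    moreover have "range (\<lambda>i::nat. W (2 * (1 / real (Suc i)))) \<subseteq> sets N" by (auto simp: N)
    ultimately have "emeasure N U = (SUP i. emeasure N (W (2 * (1 / real (Suc i)))))"
      by (metis SUP_emeasure_incseq)
    also have "\<dots> \<le> emeasure M U" by (intro SUP_least *) simp
    finally show ?thesis .
  qed
  interpret M: finite_measure M by fact
  interpret N: finite_measure N by fact
  show ?thesis
  proof (rule measure_eqI_generator_eq[where E="{S. open S}" and \<Omega>=UNIV and A="\<lambda>_. UNIV"])
    show "Int_stable {S::'a set. open S}" by (auto simp: Int_stable_def)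
    show "emeasure M X = emeasure N X" if "X \<in> {S. open S}" for X
      using le[of X M N] le[of X N M] that M N eq by (intro antisym) auto
    show "sets M = sigma_sets UNIV {S. open S}" "sets N = sigma_sets UNIV {S. open S}"
      using M N by (simp_all add: borel_def)
    show "emeasure M UNIV \<noteq> \<infinity>" using M.emeasure_finite by simp
  qed auto
qed

section \<open>Orthogonally invariant laws and the chords of the sphere\<close>

lemma nn_integral_orthogonal_usph:
  fixes F :: "'a::euclidean_space \<Rightarrow> ennreal" and R :: "'a \<Rightarrow> 'a"
  assumes "orthogonal_transformation R" and [measurable]: "F \<in> borel_measurable borel"
  shows "(\<integral>\<^sup>+x. F (R x) \<partial>usph) = (\<integral>\<^sup>+x. F x \<partial>usph)"
proof -
  note [measurable] = orthogonal_transformation_borel[OF assms(1)]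
  have "(\<integral>\<^sup>+x. F (R x) \<partial>usph) = (\<integral>\<^sup>+x. F x \<partial>distr usph borel R)"
    by (simp add: nn_integral_distr)
  then show ?thesis by (simp add: orthogonal_transformation_distr_usph[OF assms(1)])
qed

lemma norm_scaleR_diff_swap:
  fixes a b :: "'a::real_inner"
  assumes "norm a = 1" "norm b = 1"
  shows "norm (r *\<^sub>R a - s *\<^sub>R b) = norm (r *\<^sub>R b - s *\<^sub>R a)"
proof -
  have "a \<bullet> a = 1" "b \<bullet> b = 1" using assms by (simp_all add: norm_eq_1)
  then show ?thesis
    by (simp add: norm_eq_sqrt_inner inner_diff_left inner_diff_right inner_commute algebra_simps)
qed

text \<open>
  By invariance, the mass of a ball depends only on the norm of its center and on its radius, and reflections
  exchange the roles of \<open>u\<close> and \<open>v\<close> in the mass that the rotated point \<open>u\<close> gives to \<open>ball v r\<close>.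
\<close>

lemma orthogonally_invariant_polar:
  fixes M :: "'a::euclidean_space measure"
  assumes "prob_space M" and sM [measurable_cong]: "sets M = sets borel"
    and inv: "\<And>R. orthogonal_transformation R \<Longrightarrow> distr M borel R = M"
  shows "distr (M \<Otimes>\<^sub>M usph) borel (\<lambda>(v, \<theta>). norm v *\<^sub>R \<theta>) = M"
proof (rule measure_eqI_balls)
  interpret M: prob_space M by fact
  interpret P: pair_prob_space M "usph :: 'a measure" ..
  show "finite_measure (distr (M \<Otimes>\<^sub>M usph) borel (\<lambda>(v, \<theta>::'a). norm v *\<^sub>R \<theta>))"
    by (intro P.finite_measure_distr) measurable
  show "finite_measure M" by unfold_locales
  show "sets M = sets borel" by fact
  fix v :: 'a and r :: real assume r: "0 < r"
  let ?f = "\<lambda>x. indicator {..<r} x :: ennreal"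
  have inv': "(\<integral>\<^sup>+u. ?f (norm (u - R v)) \<partial>M) = (\<integral>\<^sup>+u. ?f (norm (u - v)) \<partial>M)"
    if R: "orthogonal_transformation R" for R
  proof -
    note [measurable] = orthogonal_transformation_borel[OF R]
    have "(\<integral>\<^sup>+u. ?f (norm (u - R v)) \<partial>M) = (\<integral>\<^sup>+u. ?f (norm (u - R v)) \<partial>distr M borel R)"
      by (simp add: inv[OF R])
    also have "\<dots> = (\<integral>\<^sup>+u. ?f (norm (R u - R v)) \<partial>M)"
      by (subst nn_integral_distr) auto
    also have "\<dots> = (\<integral>\<^sup>+u. ?f (norm (u - v)) \<partial>M)"
      by (simp flip: linear_diff[OF orthogonal_transformation_linear[OF R]]
          add: orthogonal_transformation_norm[OF R])
    finally show ?thesis .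
  qed
  have ball: "indicator (ball v r) x = ?f (norm (x - v))" for x
    by (simp add: indicator_def dist_norm norm_minus_commute)
  have swap: "(\<integral>\<^sup>+\<theta>. ?f (norm (norm u *\<^sub>R \<theta> - v)) \<partial>usph) = (\<integral>\<^sup>+\<theta>. ?f (norm (u - norm v *\<^sub>R \<theta>)) \<partial>usph)" for u :: 'a
  proof -
    obtain e :: 'a where e: "norm e = 1"
      using norm_Basis SOME_Basis by blast
    \<comment> \<open>An arbitrary unit vector serves as the direction of the zero vector, so the
      decompositions in \<open>o\<close> need no case distinction.\<close>
    define ou where "ou = (if u = 0 then e else sgn u)"
    define ov where "ov = (if v = 0 then e else sgn v)"
    have o: "norm ou = 1" "norm ov = 1" "u = norm u *\<^sub>R ou" "v = norm v *\<^sub>R ov"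
      by (simp_all add: ou_def ov_def e norm_sgn)
    obtain R where R: "orthogonal_transformation R" "R ou = ov"
      using orthogonal_transformation_reflection[of ou ov] o by auto
    note [measurable] = orthogonal_transformation_borel[OF R(1)]
    note lin = orthogonal_transformation_linear[OF R(1)]
    have "(\<integral>\<^sup>+\<theta>. ?f (norm (norm u *\<^sub>R \<theta> - v)) \<partial>usph) = (\<integral>\<^sup>+\<theta>. ?f (norm (norm u *\<^sub>R R \<theta> - v)) \<partial>usph)"
      by (rule nn_integral_orthogonal_usph[OF R(1), symmetric]) measurable
    also have "\<dots> = (\<integral>\<^sup>+\<theta>. ?f (norm (u - norm v *\<^sub>R \<theta>)) \<partial>usph)"
    proof (rule nn_integral_cong_AE)
      have *: "norm (norm u *\<^sub>R R \<theta> - v) = norm (u - norm v *\<^sub>R \<theta>)" if "norm \<theta> = 1" for \<theta>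
      proof -
        have "norm u *\<^sub>R R \<theta> - v = R (norm u *\<^sub>R \<theta> - norm v *\<^sub>R ou)"
          by (subst o(4)) (simp add: linear_diff[OF lin] linear_scale[OF lin] R(2))
        then have "norm (norm u *\<^sub>R R \<theta> - v) = norm (norm u *\<^sub>R \<theta> - norm v *\<^sub>R ou)"
          by (simp add: orthogonal_transformation_norm[OF R(1)])
        also have "\<dots> = norm (norm u *\<^sub>R ou - norm v *\<^sub>R \<theta>)"
          by (rule norm_scaleR_diff_swap) (use that o in auto)
        finally show ?thesis using o(3) by simp
      qed
      show "AE \<theta> in usph. ?f (norm (norm u *\<^sub>R R \<theta> - v)) = ?f (norm (u - norm v *\<^sub>R \<theta>))"
        using AE_usph_norm by eventually_elim (simp add: *)
    qed
    finally show ?thesis .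
  qed
  have "emeasure (distr (M \<Otimes>\<^sub>M usph) borel (\<lambda>(v, \<theta>). norm v *\<^sub>R \<theta>)) (ball v r) =
      (\<integral>\<^sup>+x. indicator (ball v r) x \<partial>distr (M \<Otimes>\<^sub>M usph) borel (\<lambda>(v, \<theta>). norm v *\<^sub>R \<theta>))"
    by simp
  also have "\<dots> = (\<integral>\<^sup>+x. indicator (ball v r) (case x of (v, \<theta>) \<Rightarrow> norm v *\<^sub>R \<theta>) \<partial>(M \<Otimes>\<^sub>M usph))"
    by (rule nn_integral_distr) measurable
  also have "\<dots> = (\<integral>\<^sup>+u. \<integral>\<^sup>+\<theta>. ?f (norm (norm u *\<^sub>R \<theta> - v)) \<partial>usph \<partial>M)"
    by (subst usph.nn_integral_fst[symmetric]) (simp_all add: ball)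
  also have "\<dots> = (\<integral>\<^sup>+u. \<integral>\<^sup>+\<theta>. ?f (norm (u - norm v *\<^sub>R \<theta>)) \<partial>usph \<partial>M)"
    by (simp add: swap)
  also have "\<dots> = (\<integral>\<^sup>+\<theta>. \<integral>\<^sup>+u. ?f (norm (u - norm v *\<^sub>R \<theta>)) \<partial>M \<partial>usph)"
    by (rule P.Fubini'[symmetric]) measurable
  \<comment> \<open>For fixed \<open>\<theta>\<close> the point
    \<open>norm v *\<^sub>R \<theta>\<close> is a rotated copy of \<open>v\<close>; invariance of
    \<open>M\<close> removes \<open>\<theta>\<close> from the inner integral.\<close>
  also have "\<dots> = (\<integral>\<^sup>+\<theta>. (\<integral>\<^sup>+u. ?f (norm (u - v)) \<partial>M) \<partial>(usph :: 'a measure))"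
  proof (rule nn_integral_cong_AE)
    show "AE \<theta> in usph. (\<integral>\<^sup>+u. ?f (norm (u - norm v *\<^sub>R \<theta>)) \<partial>M) = (\<integral>\<^sup>+u. ?f (norm (u - v)) \<partial>M)"
      using AE_usph_norm
    proof eventually_elim
      case (elim \<theta>)
      obtain R where R: "orthogonal_transformation R" "R v = norm v *\<^sub>R \<theta>"
        using orthogonal_transformation_reflection[of v "norm v *\<^sub>R \<theta>"] elim by auto
      then show ?case using inv'[OF R(1)] by simp
    qed
  qed
  also have "\<dots> = (\<integral>\<^sup>+u. ?f (norm (u - v)) \<partial>M)"
    using usph.emeasure_space_1[where 'a='a] by simp
  also have "\<dots> = (\<integral>\<^sup>+u. indicator (ball v r) u \<partial>M)" by (simp add: ball)
  also have "\<dots> = emeasure M (ball v r)" by (simp add: sM)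
  finally show "emeasure (distr (M \<Otimes>\<^sub>M usph) borel (\<lambda>(v, \<theta>). norm v *\<^sub>R \<theta>)) (ball v r) = emeasure M (ball v r)" .
qed simp

text \<open>
  The squared \<open>L\<^sup>2\<close> norm of a spherical mean is the integral of an autocorrelation against this law.
\<close>

definition chord :: "'a::euclidean_space measure" where
  "chord = distr (usph \<Otimes>\<^sub>M usph) borel (\<lambda>(w, w'). w - w')"

lemma sets_chord [simp, measurable_cong]: "sets chord = sets borel"
  by (simp add: chord_def)

lemma prob_space_chord: "prob_space (chord :: 'a::euclidean_space measure)"
proof -
  interpret P: pair_prob_space "usph :: 'a measure" "usph :: 'a measure" ..
  show ?thesis unfolding chord_def by (intro P.prob_space_distr) measurable
qed

text \<open>Applying the same \<open>R\<close> to both end points preserves the product of the two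
  uniform laws and rotates their difference. Hence \<open>chord\<close> is invariant, and given its
  length its direction is uniform.\<close>

lemma chord_polar:
  "distr (chord \<Otimes>\<^sub>M usph) borel (\<lambda>(v::'a, \<theta>::'a::euclidean_space). norm v *\<^sub>R \<theta>) = (chord :: 'a measure)"
proof (rule orthogonally_invariant_polar)
  fix R :: "'a \<Rightarrow> 'a" assume R: "orthogonal_transformation R"
  interpret P: pair_prob_space "usph :: 'a measure" "usph :: 'a measure" ..
  note [measurable] = orthogonal_transformation_borel[OF R]
  have m: "R \<in> usph \<rightarrow>\<^sub>M borel" by measurable
  have "usph \<Otimes>\<^sub>M usph = distr usph borel R \<Otimes>\<^sub>M distr usph borel R"
    by (simp add: orthogonal_transformation_distr_usph[OF R])
  also have "\<dots> = distr (usph \<Otimes>\<^sub>M usph) (borel \<Otimes>\<^sub>M borel) (\<lambda>(x, y). (R x, R y))"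
    by (rule pair_measure_distr[OF m m])
       (auto simp: orthogonal_transformation_distr_usph[OF R] intro: usph.sigma_finite_measure_axioms)
  finally have eq: "(usph \<Otimes>\<^sub>M usph) = distr (usph \<Otimes>\<^sub>M usph) (borel \<Otimes>\<^sub>M borel) (\<lambda>(x, y). (R x, R y))" .
  have "chord = distr (distr (usph \<Otimes>\<^sub>M usph) (borel \<Otimes>\<^sub>M borel) (\<lambda>(x, y). (R x, R y))) borel (\<lambda>(w, w'). w - w')"
    unfolding chord_def by (subst eq) simp
  also have "\<dots> = distr (usph \<Otimes>\<^sub>M usph) borel (\<lambda>(w, w'). R w - R w')"
    by (subst distr_distr) (auto simp: comp_def case_prod_unfold)
  also have "\<dots> = distr chord borel R"
    unfolding chord_def
    by (subst distr_distr) (auto simp: comp_def case_prod_unfold linear_diff[OF orthogonal_transformation_linear[OF R]])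
  finally show "distr chord borel R = chord" ..
qed (auto simp: prob_space_chord)

text \<open>The cone over the slab, cut at norm 1, fits into the box \<open>cbox (-l) l\<close> with
  half-width \<open>a\<close> in direction \<open>b\<close> and 1 in all other directions; its
  volume is the source of the power of 2.\<close>

lemma emeasure_usph_slab:
  fixes b :: "'a::euclidean_space"
  assumes b: "b \<in> Basis" and a: "0 \<le> a"
  shows "emeasure usph {\<theta>. \<bar>\<theta> \<bullet> b\<bar> \<le> a} \<le> ennreal (2 ^ DIM('a) / unit_ball_vol (DIM('a)) * a)"
proof -
  define l :: 'a where "l = (\<Sum>i\<in>Basis. (if i = b then a else 1) *\<^sub>R i)"
  have li: "l \<bullet> i = (if i = b then a else 1)" if "i \<in> Basis" for i
    using that by (simp add: l_def)
  have sub: "ball 0 1 \<inter> sgn -` {\<theta>. \<bar>\<theta> \<bullet> b\<bar> \<le> a} \<subseteq> cbox (-l) l"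
  proof
    fix x assume x: "x \<in> ball 0 1 \<inter> sgn -` {\<theta>. \<bar>\<theta> \<bullet> b\<bar> \<le> a}"
    have "\<bar>x \<bullet> i\<bar> \<le> l \<bullet> i" if i: "i \<in> Basis" for i
    proof (cases "i = b")
      case True
      have "\<bar>x \<bullet> b\<bar> = norm x * \<bar>sgn x \<bullet> b\<bar>"
        by (subst scaleR_norm_sgn[symmetric, of x]) (simp only: inner_scaleR_left abs_mult abs_norm_cancel)
      also have "\<dots> \<le> 1 * a" using x by (intro mult_mono) auto
      finally show ?thesis using True li b by simp
    next
      case False
      then show ?thesis using Basis_le_norm[OF i, of x] x li[OF i] by simp
    qed
    then show "x \<in> cbox (-l) l" by (auto simp: mem_box abs_le_iff) (metis minus_le_iff)
  qed
  have "emeasure lborel (ball 0 1 \<inter> sgn -` {\<theta>. \<bar>\<theta> \<bullet> b\<bar> \<le> a}) \<le> emeasure lborel (cbox (-l) l)"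
    by (intro emeasure_mono sub) auto
  also have "\<dots> = ennreal (\<Prod>i\<in>Basis. 2 * (l \<bullet> i))"
    using a by (subst emeasure_lborel_cbox) (auto simp: li inner_add_left intro!: arg_cong[where f=ennreal] prod.cong)
  also have "(\<Prod>i\<in>Basis. 2 * (l \<bullet> i)) = 2 ^ DIM('a) * (\<Prod>i\<in>(Basis::'a set). if i = b then a else 1)"
    by (simp add: prod.distrib li)
  also have "\<dots> = 2 ^ DIM('a) * a" using b by (simp add: prod.delta)
  finally have "emeasure lborel (ball 0 1 \<inter> sgn -` {\<theta>. \<bar>\<theta> \<bullet> b\<bar> \<le> a}) / emeasure lborel (ball (0::'a) 1)
      \<le> ennreal (2 ^ DIM('a) * a) / emeasure lborel (ball (0::'a) 1)"
    by (rule divide_right_mono_ennreal)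
  also have "\<dots> = ennreal (2 ^ DIM('a) / unit_ball_vol (DIM('a)) * a)"
    using a by (simp add: emeasure_ball divide_ennreal)
  finally show ?thesis by (subst emeasure_usph) simp_all
qed

text \<open>After a rotation the centre is a basis vector \<open>b1\<close>, and the cap lies in the
  slab belonging to a second basis vector \<open>b2\<close>, available because the dimension is at
  least two. The bound is linear in \<open>a\<close> although small caps have order
  \<open>a ^ (n - 1)\<close>; a linear bound is enough for the smoothing estimate.\<close>

lemma emeasure_usph_cap:
  fixes w :: "'a::euclidean_space"
  assumes w: "norm w = 1" and a: "0 \<le> a" and dim: "DIM('a) \<ge> 2"
  shows "emeasure usph {\<theta>. norm (\<theta> - w) \<le> a} \<le> ennreal (2 ^ DIM('a) / unit_ball_vol (DIM('a)) * a)"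
proof -
  obtain b1 b2 :: 'a where b: "b1 \<in> Basis" "b2 \<in> Basis" "b1 \<noteq> b2"
    using dim by (metis card_le_Suc0_iff_eq finite_Basis not_less_eq_eq numeral_2_eq_2)
  obtain R where R: "orthogonal_transformation R" "R b1 = w"
    using orthogonal_transformation_reflection[of b1 w] w b by auto
  have lin: "R \<theta> - w = R (\<theta> - b1)" for \<theta>
    by (simp add: linear_diff[OF orthogonal_transformation_linear[OF R(1)]] R(2))
  have "emeasure usph {\<theta>. norm (\<theta> - w) \<le> a} = (\<integral>\<^sup>+\<theta>. indicator {\<theta>. norm (\<theta> - w) \<le> a} \<theta> \<partial>usph)"
    by simp
  also have "\<dots> = (\<integral>\<^sup>+\<theta>. indicator {..a} (norm (\<theta> - w)) \<partial>usph)"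
    by (intro nn_integral_cong) (simp add: indicator_def)
  also have "\<dots> = (\<integral>\<^sup>+\<theta>. indicator {..a} (norm (R \<theta> - w)) \<partial>usph)"
    by (rule nn_integral_orthogonal_usph[OF R(1), symmetric]) measurable
  also have "\<dots> = (\<integral>\<^sup>+\<theta>. indicator {..a} (norm (\<theta> - b1)) \<partial>usph)"
    by (simp add: lin orthogonal_transformation_norm[OF R(1)])
  also have "\<dots> \<le> (\<integral>\<^sup>+\<theta>. indicator {\<theta>. \<bar>\<theta> \<bullet> b2\<bar> \<le> a} \<theta> \<partial>usph)"
  proof (intro nn_integral_mono)
    fix \<theta> :: 'a
    have "\<bar>\<theta> \<bullet> b2\<bar> \<le> norm (\<theta> - b1)"
      using Basis_le_norm[OF b(2), of "\<theta> - b1"] b by (simp add: inner_diff_left inner_not_same_Basis)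
    then show "(indicator {..a} (norm (\<theta> - b1)) :: ennreal) \<le> indicator {\<theta>. \<bar>\<theta> \<bullet> b2\<bar> \<le> a} \<theta>"
      by (auto simp: indicator_def)
  qed
  also have "\<dots> = emeasure usph {\<theta>. \<bar>\<theta> \<bullet> b2\<bar> \<le> a}" by simp
  also have "\<dots> \<le> ennreal (2 ^ DIM('a) / unit_ball_vol (DIM('a)) * a)"
    by (rule emeasure_usph_slab[OF b(2) a])
  finally show ?thesis .
qed

text \<open>For a fixed first end point the second one is confined to a cap around it, and the cap
  estimate does not depend on the end point.\<close>

lemma emeasure_chord_cball:
  assumes a: "0 \<le> a" and dim: "DIM('a::euclidean_space) \<ge> 2"
  shows "emeasure chord {v::'a. norm v \<le> a} \<le> ennreal (2 ^ DIM('a) / unit_ball_vol (DIM('a)) * a)"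
proof -
  interpret P: pair_prob_space "usph :: 'a measure" "usph :: 'a measure" ..
  have "emeasure chord {v::'a. norm v \<le> a} = (\<integral>\<^sup>+v. indicator {v. norm v \<le> a} v \<partial>(chord :: 'a measure))"
    by simp
  also have "\<dots> = (\<integral>\<^sup>+x. indicator {v::'a. norm v \<le> a} (case x of (w, w') \<Rightarrow> w - w') \<partial>(usph \<Otimes>\<^sub>M usph))"
    unfolding chord_def by (rule nn_integral_distr) measurable
  also have "\<dots> = (\<integral>\<^sup>+w. \<integral>\<^sup>+w'. indicator {v::'a. norm v \<le> a} (w - w') \<partial>usph \<partial>usph)"
    by (subst usph.nn_integral_fst[symmetric]) simp_all
  also have "\<dots> = (\<integral>\<^sup>+w. emeasure usph {\<theta>. norm (\<theta> - w) \<le> a} \<partial>(usph :: 'a measure))"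
  proof (intro nn_integral_cong)
    fix w :: 'a
    have "emeasure usph {\<theta>. norm (\<theta> - w) \<le> a} = (\<integral>\<^sup>+\<theta>. indicator {\<theta>. norm (\<theta> - w) \<le> a} \<theta> \<partial>usph)"
      by simp
    also have "\<dots> = (\<integral>\<^sup>+w'. indicator {v::'a. norm v \<le> a} (w - w') \<partial>usph)"
      by (intro nn_integral_cong) (simp add: indicator_def norm_minus_commute)
    finally show "(\<integral>\<^sup>+w'. indicator {v::'a. norm v \<le> a} (w - w') \<partial>usph) = emeasure usph {\<theta>. norm (\<theta> - w) \<le> a}" ..
  qed
  also have "\<dots> \<le> (\<integral>\<^sup>+w. ennreal (2 ^ DIM('a) / unit_ball_vol (DIM('a)) * a) \<partial>(usph :: 'a measure))"
    by (intro nn_integral_mono_AE) (use AE_usph_norm emeasure_usph_cap[OF _ a dim] in auto)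
  also have "\<dots> = ennreal (2 ^ DIM('a) / unit_ball_vol (DIM('a)) * a)"
    using usph.emeasure_space_1[where 'a='a] by simp
  finally show ?thesis .
qed

section \<open>The density of the radius and the marginals on the two factors\<close>

lemma distr_lborel_norm:
  "distr lborel borel (norm :: 'a::euclidean_space \<Rightarrow> real) =
    density lborel (\<lambda>a. ennreal (DIM('a) * unit_ball_vol DIM('a) * a ^ (DIM('a) - 1)) * indicator {0..} a)"
    (is "?L = ?R")
proof (rule measure_eqI_generator_eq[where E="range lessThan" and \<Omega>=UNIV and A="\<lambda>i. {..<real i}"])
  let ?n = "DIM('a)" and ?V = "unit_ball_vol DIM('a)"
  show "Int_stable (range (lessThan :: real \<Rightarrow> _))"
  proof (rule Int_stableI)
    fix a b :: "real set" assume "a \<in> range lessThan" "b \<in> range lessThan"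
    then obtain x y where "a = {..<x}" "b = {..<y}" by auto
    then have "a \<inter> b = {..<min x y}" by auto
    then show "a \<inter> b \<in> range lessThan" by blast
  qed
  show "sets ?L = sigma_sets UNIV (range lessThan)" "sets ?R = sigma_sets UNIV (range lessThan)"
    by (simp_all add: borel_Iio)
  show "(\<Union>i. {..<real i}) = UNIV" using reals_Archimedean2 by blast
  have nb: "norm -` {..<r} = ball (0::'a) r" for r :: real by auto
  have L: "emeasure ?L {..<r} = emeasure lborel (ball (0::'a) r)" for r
    by (simp add: emeasure_distr nb)
  then show "emeasure ?L {..<real i} \<noteq> \<infinity>" for i by (simp add: emeasure_ball)
  fix X :: "real set" assume "X \<in> range lessThan"
  then obtain r where X: "X = {..<r}" by auto
  show "emeasure ?L X = emeasure ?R X"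
  proof (cases "r > 0")
    case True
    have "emeasure ?R X = (\<integral>\<^sup>+a. ennreal (?n * ?V * a ^ (?n - 1)) * indicator {0..} a * indicator {..<r} a \<partial>lborel)"
      by (simp add: emeasure_density X)
    also have "\<dots> = (\<integral>\<^sup>+a. ennreal (?n * ?V * a ^ (?n - 1)) * indicator {0..r} a \<partial>lborel)"
      using AE_lborel_singleton[of r]
      by (intro nn_integral_cong_AE) (auto simp: indicator_def elim!: eventually_mono)
    also have "\<dots> = ennreal (?V * r ^ ?n - ?V * 0 ^ ?n)"
    proof (rule nn_integral_FTC_Icc)
      show "((\<lambda>a. ?V * a ^ ?n) has_real_derivative ?n * ?V * a ^ (?n - 1)) (at a)" for a
        by (auto intro!: derivative_eq_intros)
    qed (use True in auto)
    finally show ?thesis using True L by (simp add: X emeasure_ball zero_power DIM_positive)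
  next
    case False
    then have z: "c * indicator {0..} a * indicator {..<r} a = 0" for a :: real and c :: ennreal
      by (auto simp: indicator_def)
    have "emeasure ?R X = 0"
      unfolding X by (subst emeasure_density) (simp_all only: z, simp_all)
    then show ?thesis using False L by (simp add: X ball_empty)
  qed
qed auto

lemma nn_integral_norm:
  fixes G :: "real \<Rightarrow> ennreal"
  assumes [measurable]: "G \<in> borel_measurable borel"
  shows "(\<integral>\<^sup>+u. G (norm (u::'a::euclidean_space)) \<partial>lborel) =
    (\<integral>\<^sup>+a. ennreal (DIM('a) * unit_ball_vol DIM('a) * a ^ (DIM('a) - 1)) * indicator {0..} a * G a \<partial>lborel)"
proof -
  have "(\<integral>\<^sup>+u. G (norm (u::'a)) \<partial>lborel) = (\<integral>\<^sup>+a. G a \<partial>distr lborel borel (norm :: 'a \<Rightarrow> real))"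
    by (simp add: nn_integral_distr)
  then show ?thesis
    unfolding distr_lborel_norm by (simp add: nn_integral_density)
qed

text \<open>The substitution is \<open>a = b * s / sqrt (1 - s\<^sup>2)\<close>. For a point
  \<open>(u, v)\<close> with norms \<open>a\<close> and \<open>b\<close> of its components,
  \<open>s\<close> is the norm of the first component of its direction. The interval is mapped onto
  itself because \<open>(u, v)\<close> has norm 1 at the right end, where
  \<open>s = a\<close>.\<close>

lemma nn_integral_slice_substitution:
  fixes G :: "real \<Rightarrow> ennreal"
  assumes [measurable]: "G \<in> borel_measurable borel" and b: "0 < b" "b < 1" and n: "n \<ge> 1"
  shows "(\<integral>\<^sup>+a. G (a / sqrt (a\<^sup>2 + b\<^sup>2)) * ennreal (a ^ (n - 1)) * indicator {0..sqrt (1 - b\<^sup>2)} a \<partial>lborel) =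
    (\<integral>\<^sup>+s. G s * ennreal (b ^ n * s ^ (n - 1) / sqrt (1 - s\<^sup>2) ^ (n + 2)) * indicator {0..sqrt (1 - b\<^sup>2)} s \<partial>lborel)"
proof -
  define c where "c = sqrt (1 - b\<^sup>2)"
  have b2: "b\<^sup>2 < 1" using b by (simp add: power_less_one_iff abs_square_less_1)
  then have c: "0 < c" "c < 1" using b by (simp_all add: c_def)
  define g where "g s = b * s / sqrt (1 - s\<^sup>2)" for s
  define g' where "g' s = b / sqrt (1 - s\<^sup>2) ^ 3" for s
  have q: "0 < 1 - s\<^sup>2" if "s \<in> {0..c}" for s
    using that c by (simp add: abs_square_less_1)
  have "(\<integral>\<^sup>+a. (G (a / sqrt (a\<^sup>2 + b\<^sup>2)) * ennreal (a ^ (n - 1))) * indicator {g 0..g c} a \<partial>lborel) =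
    (\<integral>\<^sup>+s. (G (g s / sqrt ((g s)\<^sup>2 + b\<^sup>2)) * ennreal (g s ^ (n - 1))) * ennreal (g' s) * indicator {0..c} s \<partial>lborel)"
  proof (rule nn_integral_substitution_aux)
    show "(g has_real_derivative g' s) (at s)" if "s \<in> {0..c}" for s
    proof -
      define r where "r = sqrt (1 - s\<^sup>2)"
      have r: "r > 0" "r\<^sup>2 = 1 - s\<^sup>2" using q[OF that] by (simp_all add: r_def)
      have "((\<lambda>s. b * s / sqrt (1 - s\<^sup>2)) has_real_derivative (b * r - b * s * ((- 2 * s) * (inverse r / 2))) / (r * r)) (at s)"
        using q[OF that] unfolding r_def
        by (auto intro!: derivative_eq_intros simp: power2_eq_square)
      also have "(b * r - b * s * ((- 2 * s) * (inverse r / 2))) / (r * r) = b * (r\<^sup>2 + s\<^sup>2) / r ^ 3"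
        using r(1) by (simp add: field_simps power2_eq_square power3_eq_cube)
      also have "\<dots> = g' s" unfolding r(2) by (simp add: g'_def r_def)
      finally show ?thesis by (simp add: g_def[abs_def])
    qed
    show "continuous_on {0..c} g'"
      unfolding g'_def using q by (intro continuous_intros) (auto simp: less_le)
    show "g' s \<ge> 0" if "s \<in> {0..c}" for s
      using q[OF that] b by (simp add: g'_def)
  qed (use c in auto)
  moreover have "g 0 = 0" "g c = c"
    using b b2 by (simp_all add: g_def c_def)
  moreover have "(G (g s / sqrt ((g s)\<^sup>2 + b\<^sup>2)) * ennreal (g s ^ (n - 1))) * ennreal (g' s) * indicator {0..c} s =
     G s * ennreal (b ^ n * s ^ (n - 1) / sqrt (1 - s\<^sup>2) ^ (n + 2)) * indicator {0..c} s" for s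
  proof (cases "s \<in> {0..c}")
    case True
    define r where "r = sqrt (1 - s\<^sup>2)"
    have r: "r > 0" "r\<^sup>2 = 1 - s\<^sup>2" using q[OF True] by (simp_all add: r_def)
    have "(g s)\<^sup>2 + b\<^sup>2 = b\<^sup>2 * (s\<^sup>2 + r\<^sup>2) / r\<^sup>2"
      using r(1) unfolding g_def r_def[symmetric] by (simp add: field_simps power_divide)
    also have "\<dots> = (b / r)\<^sup>2" unfolding r(2) by (simp add: power_divide r(2))
    finally have "sqrt ((g s)\<^sup>2 + b\<^sup>2) = b / r" using b r by (simp)
    then have "g s / sqrt ((g s)\<^sup>2 + b\<^sup>2) = s"
      using b r unfolding g_def r_def[symmetric] by simp
    moreover have "g s ^ (n - 1) * g' s = b ^ n * s ^ (n - 1) / r ^ (n + 2)"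
    proof -
      obtain m where m: "n = Suc m" using n by (cases n) auto
      show ?thesis unfolding g_def g'_def r_def[symmetric] m
        by (simp add: power_divide power_mult_distrib power_add eval_nat_numeral mult_ac)
    qed
    moreover have "0 \<le> g s" "0 \<le> g' s" using True b r unfolding g_def g'_def r_def[symmetric] by auto
    ultimately show ?thesis
      by (simp add: mult.assoc r_def flip: ennreal_mult)
  qed simp
  ultimately show ?thesis by (simp add: c_def)
qed

text \<open>
  The marginal has density proportional to \<open>(1 - \<bar>y\<bar>\<^sup>2)\<close> to the power \<open>(n - 2) / 2\<close>, which is bounded because
  \<open>n \<ge> 2\<close>.
\<close>

lemma nn_integral_usph_fst_le:
  fixes F :: "'a::euclidean_space \<Rightarrow> ennreal"
  assumes [measurable]: "F \<in> borel_measurable borel" and dim: "DIM('a) \<ge> 2"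
  shows "(\<integral>\<^sup>+w. F (fst w) \<partial>(usph :: ('a \<times> 'a) measure)) \<le>
    ennreal (unit_ball_vol DIM('a) / unit_ball_vol DIM('a \<times> 'a)) * (\<integral>\<^sup>+y. indicator (ball 0 1) y * F y \<partial>lborel)"
proof -
  have mf: "(\<lambda>w::'a \<times> 'a. F (fst w)) \<in> borel_measurable borel"
    unfolding borel_prod[symmetric] by measurable
  have [measurable]: "(\<lambda>w::'a \<times> 'a. F (fst (sgn w))) \<in> borel_measurable borel"
    by (rule measurable_compose[OF borel_measurable_sgn_euclidean mf])
  let ?n = "DIM('a)" and ?V = "unit_ball_vol DIM('a)"
  define Fb where "Fb s = (\<integral>\<^sup>+\<theta>. F (s *\<^sub>R \<theta>) \<partial>usph)" for s
  have [measurable]: "Fb \<in> borel_measurable borel" unfolding Fb_def by measurable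
  \<comment> \<open>For fixed \<open>v\<close> this majorises the integrand in the norm
    \<open>s\<close> of the first component. With \<open>q = sqrt (1 - s\<^sup>2)\<close>, the
    substitution produces \<open>(norm v / q) ^ n / q\<^sup>2\<close>, whose first factor is at most
    1 on the ball \<open>norm v \<le> q\<close>. Integrating \<open>1 / q\<^sup>2\<close> over that
    ball gives \<open>q ^ (n - 2)\<close> times the volume of the unit ball, and this is bounded
    because \<open>n \<ge> 2\<close>.\<close>
  define J where "J s v = ennreal (?n * ?V * s ^ (?n - 1)) * indicator {0..<1} s * Fb s *
      (indicator (cball 0 (sqrt (1 - s\<^sup>2))) v * ennreal (1 / (sqrt (1 - s\<^sup>2))\<^sup>2))" for s and v :: 'a
  have [measurable]: "case_prod J \<in> borel_measurable (borel \<Otimes>\<^sub>M borel)"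
  proof -
    have "case_prod J = (\<lambda>(s, v). ennreal (?n * ?V * s ^ (?n - 1)) * indicator {0..<1} s * Fb s *
      (indicator {..0} (norm v - sqrt (1 - s\<^sup>2)) * ennreal (1 / (sqrt (1 - s\<^sup>2))\<^sup>2)))"
      by (auto simp: J_def indicator_def fun_eq_iff)
    also have "\<dots> \<in> borel_measurable (borel \<Otimes>\<^sub>M borel)" by measurable
    finally show ?thesis .
  qed
  have inner: "(\<integral>\<^sup>+u. indicator (ball 0 1) (u, v) * F (fst (sgn (u, v))) \<partial>lborel) \<le> (\<integral>\<^sup>+s. J s v \<partial>lborel)"
    if v: "v \<noteq> 0" for v :: 'a
  proof (cases "norm v < 1")
    case False
    then have "indicator (ball 0 1) (u, v) = (0::ennreal)" for u :: 'a
      using norm_snd_le[of v u] by (simp add: indicator_def)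
    then show ?thesis by simp
  next
    case True
    let ?b = "norm v"
    have b: "0 < ?b" "?b < 1" using v True by auto
    have "(\<integral>\<^sup>+u. indicator (ball 0 1) (u, v) * F (fst (sgn (u, v))) \<partial>lborel) =
        (\<integral>\<^sup>+u. indicator {..<1} (sqrt ((norm u)\<^sup>2 + ?b\<^sup>2)) * F (inverse (sqrt ((norm u)\<^sup>2 + ?b\<^sup>2)) *\<^sub>R u) \<partial>lborel)"
      by (intro nn_integral_cong) (simp add: indicator_def norm_Pair sgn_div_norm)
    also have "\<dots> = (\<integral>\<^sup>+u. \<integral>\<^sup>+\<theta>. indicator {..<1} (sqrt ((norm (norm u *\<^sub>R \<theta>))\<^sup>2 + ?b\<^sup>2)) *
        F (inverse (sqrt ((norm (norm u *\<^sub>R \<theta>))\<^sup>2 + ?b\<^sup>2)) *\<^sub>R norm u *\<^sub>R \<theta>) \<partial>usph \<partial>(lborel :: 'a measure))"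
      by (rule nn_integral_polar) measurable
    also have "\<dots> = (\<integral>\<^sup>+u. \<integral>\<^sup>+\<theta>. indicator {..<1} (sqrt ((norm u)\<^sup>2 + ?b\<^sup>2)) *
        F ((norm u / sqrt ((norm u)\<^sup>2 + ?b\<^sup>2)) *\<^sub>R \<theta>) \<partial>usph \<partial>(lborel :: 'a measure))"
    proof (rule nn_integral_cong, rule nn_integral_cong_AE)
      fix u :: 'a
      show "AE \<theta> in usph. indicator {..<1} (sqrt ((norm (norm u *\<^sub>R \<theta>))\<^sup>2 + ?b\<^sup>2)) *
        F (inverse (sqrt ((norm (norm u *\<^sub>R \<theta>))\<^sup>2 + ?b\<^sup>2)) *\<^sub>R norm u *\<^sub>R \<theta>) =
        indicator {..<1} (sqrt ((norm u)\<^sup>2 + ?b\<^sup>2)) * F ((norm u / sqrt ((norm u)\<^sup>2 + ?b\<^sup>2)) *\<^sub>R \<theta>)"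
        using AE_usph_norm by eventually_elim (simp add: divide_inverse mult.commute)
    qed
    also have "\<dots> = (\<integral>\<^sup>+u. indicator {..<1} (sqrt ((norm u)\<^sup>2 + ?b\<^sup>2)) *
        Fb (norm u / sqrt ((norm u)\<^sup>2 + ?b\<^sup>2)) \<partial>(lborel :: 'a measure))"
      unfolding Fb_def by (intro nn_integral_cong nn_integral_cmult) measurable
    also have "\<dots> = (\<integral>\<^sup>+a. ennreal (?n * ?V * a ^ (?n - 1)) * indicator {0..} a *
        (indicator {..<1} (sqrt (a\<^sup>2 + ?b\<^sup>2)) * Fb (a / sqrt (a\<^sup>2 + ?b\<^sup>2))) \<partial>lborel)"
      by (rule nn_integral_norm) measurable
    also have "\<dots> \<le> (\<integral>\<^sup>+a. ennreal (?n * ?V) * (Fb (a / sqrt (a\<^sup>2 + ?b\<^sup>2)) * ennreal (a ^ (?n - 1)) * indicator {0..sqrt (1 - ?b\<^sup>2)} a) \<partial>lborel)"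
    proof (intro nn_integral_mono)
      fix a :: real
      show "ennreal (?n * ?V * a ^ (?n - 1)) * indicator {0..} a *
        (indicator {..<1} (sqrt (a\<^sup>2 + ?b\<^sup>2)) * Fb (a / sqrt (a\<^sup>2 + ?b\<^sup>2)))
        \<le> ennreal (?n * ?V) * (Fb (a / sqrt (a\<^sup>2 + ?b\<^sup>2)) * ennreal (a ^ (?n - 1)) * indicator {0..sqrt (1 - ?b\<^sup>2)} a)"
      proof (cases "0 \<le> a \<and> sqrt (a\<^sup>2 + ?b\<^sup>2) < 1")
        case True
        then have "a\<^sup>2 + ?b\<^sup>2 < 1" by simp
        then have "a \<le> sqrt (1 - ?b\<^sup>2)" by (intro real_le_rsqrt) simp
        then show ?thesis using True by (simp add: ennreal_mult mult_ac)
      qed (auto simp: indicator_def)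
    qed
    also have "\<dots> = ennreal (?n * ?V) * (\<integral>\<^sup>+a. Fb (a / sqrt (a\<^sup>2 + ?b\<^sup>2)) * ennreal (a ^ (?n - 1)) * indicator {0..sqrt (1 - ?b\<^sup>2)} a \<partial>lborel)"
      by (rule nn_integral_cmult) measurable
    also have "\<dots> = ennreal (?n * ?V) * (\<integral>\<^sup>+s. Fb s * ennreal (?b ^ ?n * s ^ (?n - 1) / sqrt (1 - s\<^sup>2) ^ (?n + 2)) * indicator {0..sqrt (1 - ?b\<^sup>2)} s \<partial>lborel)"
      using dim by (subst nn_integral_slice_substitution) (use b in auto)
    also have "\<dots> = (\<integral>\<^sup>+s. ennreal (?n * ?V) * (Fb s * ennreal (?b ^ ?n * s ^ (?n - 1) / sqrt (1 - s\<^sup>2) ^ (?n + 2)) * indicator {0..sqrt (1 - ?b\<^sup>2)} s) \<partial>lborel)"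
      by (rule nn_integral_cmult[symmetric]) measurable
    also have "\<dots> \<le> (\<integral>\<^sup>+s. J s v \<partial>lborel)"
    proof (intro nn_integral_mono)
      fix s :: real
      show "ennreal (?n * ?V) * (Fb s * ennreal (?b ^ ?n * s ^ (?n - 1) / sqrt (1 - s\<^sup>2) ^ (?n + 2)) * indicator {0..sqrt (1 - ?b\<^sup>2)} s) \<le> J s v"
      proof (cases "s \<in> {0..sqrt (1 - ?b\<^sup>2)}")
        case True
        then have s: "0 \<le> s" "s \<le> sqrt (1 - ?b\<^sup>2)" by auto
        have b2: "0 < ?b\<^sup>2" "?b\<^sup>2 < 1" using b by (simp_all add: abs_square_less_1)
        have "s\<^sup>2 \<le> (sqrt (1 - ?b\<^sup>2))\<^sup>2" using s by (intro power_mono)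
        then have s2: "s\<^sup>2 \<le> 1 - ?b\<^sup>2" using b2 by simp
        then have "s\<^sup>2 < 1" using b2 by linarith
        then have s1: "s < 1" using s by (simp add: abs_square_less_1)
        define q where "q = sqrt (1 - s\<^sup>2)"
        have q: "?b \<le> q" unfolding q_def using s2 by (intro real_le_rsqrt) simp
        have q0: "0 < q" using q b by linarith
        have bq: "0 \<le> ?b / q" "?b / q \<le> 1" using q by (auto intro!: divide_nonneg_pos q0 simp: divide_le_eq_1_pos[OF q0])
        have "?b ^ ?n * s ^ (?n - 1) / q ^ (?n + 2) = s ^ (?n - 1) * ((?b / q) ^ ?n * (1 / q\<^sup>2))"
          using q0 by (simp add: power_add power_divide power2_eq_square mult_ac)
        also have "\<dots> \<le> s ^ (?n - 1) * (1 * (1 / q\<^sup>2))"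
          using bq s by (intro mult_left_mono mult_right_mono power_le_one) simp_all
        finally have le: "?b ^ ?n * s ^ (?n - 1) / q ^ (?n + 2) \<le> s ^ (?n - 1) * (1 / q\<^sup>2)" by simp
        have "ennreal (?n * ?V) * (Fb s * ennreal (?b ^ ?n * s ^ (?n - 1) / q ^ (?n + 2)))
           \<le> ennreal (?n * ?V) * (Fb s * ennreal (s ^ (?n - 1) * (1 / q\<^sup>2)))"
          by (intro mult_left_mono ennreal_leI le) auto
        also have "ennreal (s ^ (?n - 1) * (1 / q\<^sup>2)) = ennreal (s ^ (?n - 1)) * ennreal (1 / q\<^sup>2)"
          using s by (intro ennreal_mult) auto
        also have "ennreal (?n * ?V) * (Fb s * (ennreal (s ^ (?n - 1)) * ennreal (1 / q\<^sup>2))) =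
            ennreal (?n * ?V) * ennreal (s ^ (?n - 1)) * Fb s * ennreal (1 / q\<^sup>2)"
          by (simp only: mult_ac)
        also have "ennreal (?n * ?V) * ennreal (s ^ (?n - 1)) = ennreal (?n * ?V * s ^ (?n - 1))"
          using s by (intro ennreal_mult[symmetric]) auto
        also have "ennreal (?n * ?V * s ^ (?n - 1)) * Fb s * ennreal (1 / q\<^sup>2) = J s v"
          using s s1 q unfolding J_def q_def[symmetric] by simp
        finally show ?thesis using True by (simp add: q_def)
      qed simp
    qed
    finally show ?thesis .
  qed
  have "(\<integral>\<^sup>+w. indicator (ball 0 1) w * F (fst (sgn w)) \<partial>(lborel :: ('a \<times> 'a) measure)) =
      (\<integral>\<^sup>+u. \<integral>\<^sup>+v. indicator (ball 0 1) (u, v) * F (fst (sgn (u, v))) \<partial>(lborel :: 'a measure) \<partial>lborel)"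
  proof -
    have m: "(\<lambda>w::'a \<times> 'a. indicator (ball 0 1) w * F (fst (sgn w))) \<in> borel_measurable (lborel \<Otimes>\<^sub>M lborel)"
      unfolding lborel_prod by measurable
    show ?thesis
      using lborel.nn_integral_fst[OF m] by (simp add: lborel_prod)
  qed
  also have "\<dots> = (\<integral>\<^sup>+v. \<integral>\<^sup>+u. indicator (ball 0 1) (u, v) * F (fst (sgn (u, v))) \<partial>lborel \<partial>(lborel :: 'a measure))"
  proof (rule lborel_pair.Fubini'[symmetric])
    have "(\<lambda>w::'a \<times> 'a. indicator (ball 0 1) w * F (fst (sgn w))) \<in> borel_measurable (lborel \<Otimes>\<^sub>M lborel)"
      unfolding lborel_prod by measurable
    then show "(\<lambda>(u::'a, v::'a). indicator (ball 0 1) (u, v) * F (fst (sgn (u, v)))) \<in> borel_measurable (lborel \<Otimes>\<^sub>M lborel)"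
      by (simp add: case_prod_unfold)
  qed
  also have "\<dots> \<le> (\<integral>\<^sup>+v. \<integral>\<^sup>+s. J s v \<partial>lborel \<partial>lborel)"
    using AE_lborel_singleton[of "0::'a"] by (intro nn_integral_mono_AE) (auto elim!: eventually_mono intro: inner)
  also have "\<dots> = (\<integral>\<^sup>+s. \<integral>\<^sup>+v. J s v \<partial>lborel \<partial>lborel)"
    by (rule lborel_pair.Fubini') measurable
  also have "\<dots> \<le> (\<integral>\<^sup>+s. ennreal ?V * (ennreal (?n * ?V * s ^ (?n - 1)) * indicator {0..} s * (indicator {..<1} s * Fb s)) \<partial>lborel)"
  proof (intro nn_integral_mono)
    fix s :: real
    show "(\<integral>\<^sup>+v. J s v \<partial>lborel) \<le> ennreal ?V * (ennreal (?n * ?V * s ^ (?n - 1)) * indicator {0..} s * (indicator {..<1} s * Fb s))"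
    proof (cases "0 \<le> s \<and> s < 1")
      case True
      define q where "q = sqrt (1 - s\<^sup>2)"
      have "s\<^sup>2 < 1" using True by (simp add: abs_square_less_1)
      then have q: "0 < q" "q \<le> 1" by (simp_all add: q_def)
      have "(\<integral>\<^sup>+v. J s v \<partial>lborel) = (\<integral>\<^sup>+v. (ennreal (?n * ?V * s ^ (?n - 1)) * Fb s * ennreal (1 / q\<^sup>2)) * indicator (cball (0::'a) q) v \<partial>lborel)"
        unfolding J_def q_def[symmetric] using True by (intro nn_integral_cong) (simp add: mult_ac)
      also have "\<dots> = ennreal (?n * ?V * s ^ (?n - 1)) * Fb s * (ennreal (1 / q\<^sup>2) * ennreal (?V * q ^ ?n))"
        using q by (subst nn_integral_cmult_indicator) (simp_all add: emeasure_cball mult_ac)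
      also have "ennreal (1 / q\<^sup>2) * ennreal (?V * q ^ ?n) = ennreal (?V * (q ^ ?n / q\<^sup>2))"
        by (subst ennreal_mult[symmetric]) (use q in auto)
      also have "ennreal (?n * ?V * s ^ (?n - 1)) * Fb s * ennreal (?V * (q ^ ?n / q\<^sup>2)) \<le>
          ennreal (?n * ?V * s ^ (?n - 1)) * Fb s * ennreal ?V"
      proof (intro mult_left_mono ennreal_leI mult_left_le)
        show "q ^ ?n / q\<^sup>2 \<le> 1" using q dim by (simp add: power_decreasing)
      qed auto
      finally show ?thesis using True by (simp add: mult_ac)
    qed (auto simp: J_def indicator_def)
  qed
  also have "\<dots> = ennreal ?V * (\<integral>\<^sup>+s. ennreal (?n * ?V * s ^ (?n - 1)) * indicator {0..} s * (indicator {..<1} s * Fb s) \<partial>lborel)"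
    by (rule nn_integral_cmult) measurable
  also have "\<dots> = ennreal ?V * (\<integral>\<^sup>+u. indicator {..<1} (norm u) * Fb (norm u) \<partial>(lborel :: 'a measure))"
    by (subst nn_integral_norm) simp_all
  also have "\<dots> = ennreal ?V * (\<integral>\<^sup>+u. \<integral>\<^sup>+\<theta>. indicator (ball 0 1) (norm u *\<^sub>R \<theta>) * F (norm u *\<^sub>R \<theta>) \<partial>usph \<partial>(lborel :: 'a measure))"
  proof (intro arg_cong[where f="\<lambda>x. ennreal ?V * x"] nn_integral_cong)
    fix u :: 'a
    have "indicator {..<1} (norm u) * Fb (norm u) = (\<integral>\<^sup>+\<theta>. indicator {..<1} (norm u) * F (norm u *\<^sub>R \<theta>) \<partial>usph)"
      unfolding Fb_def by (rule nn_integral_cmult[symmetric]) measurable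
    also have "\<dots> = (\<integral>\<^sup>+\<theta>. indicator (ball 0 1) (norm u *\<^sub>R \<theta>) * F (norm u *\<^sub>R \<theta>) \<partial>usph)"
      by (intro nn_integral_cong_AE) (use AE_usph_norm in \<open>auto simp: indicator_def elim!: eventually_mono\<close>)
    finally show "indicator {..<1} (norm u) * Fb (norm u) = \<dots>" .
  qed
  also have "\<dots> = ennreal ?V * (\<integral>\<^sup>+y. indicator (ball 0 1) y * F y \<partial>lborel)"
    by (subst nn_integral_polar[of "\<lambda>y. indicator (ball 0 1) y * F y"]) simp_all
  finally have main: "(\<integral>\<^sup>+w. indicator (ball 0 1) w * F (fst (sgn w)) \<partial>(lborel :: ('a \<times> 'a) measure)) \<le> \<dots>" .
  have "(\<integral>\<^sup>+w. F (fst w) \<partial>(usph :: ('a \<times> 'a) measure)) \<le>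
      (ennreal ?V * (\<integral>\<^sup>+y. indicator (ball 0 1) y * F y \<partial>lborel)) / emeasure lborel (ball (0::'a \<times> 'a) 1)"
    by (subst nn_integral_usph[OF mf]) (intro divide_right_mono_ennreal main)
  also have "\<dots> = (ennreal ?V / emeasure lborel (ball (0::'a \<times> 'a) 1)) * (\<integral>\<^sup>+y. indicator (ball 0 1) y * F y \<partial>lborel)"
    by (simp add: divide_ennreal_def mult_ac)
  also have "ennreal ?V / emeasure lborel (ball (0::'a \<times> 'a) 1) = ennreal (?V / unit_ball_vol DIM('a \<times> 'a))"
    by (simp add: emeasure_ball divide_ennreal)
  finally show ?thesis .
qed

lemma nn_integral_usph_snd_le:
  fixes F :: "'a::euclidean_space \<Rightarrow> ennreal"
  assumes [measurable]: "F \<in> borel_measurable borel" and dim: "DIM('a) \<ge> 2"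
  shows "(\<integral>\<^sup>+w. F (snd w) \<partial>(usph :: ('a \<times> 'a) measure)) \<le>
    ennreal (unit_ball_vol DIM('a) / unit_ball_vol DIM('a \<times> 'a)) * (\<integral>\<^sup>+y. indicator (ball 0 1) y * F y \<partial>lborel)"
proof -
  let ?R = "\<lambda>w::'a \<times> 'a. (snd w, fst w)"
  have R: "orthogonal_transformation ?R"
    unfolding orthogonal_transformation_def by (auto intro!: linearI simp: inner_prod_def)
  have mf: "(\<lambda>w::'a \<times> 'a. F (fst w)) \<in> borel_measurable borel"
    unfolding borel_prod[symmetric] by measurable
  have "(\<integral>\<^sup>+w. F (snd w) \<partial>(usph :: ('a \<times> 'a) measure)) = (\<integral>\<^sup>+w. F (fst w) \<partial>(usph :: ('a \<times> 'a) measure))"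
    using nn_integral_orthogonal_usph[OF R mf] by simp
  then show ?thesis using nn_integral_usph_fst_le[OF assms] by simp
qed

text \<open>The components of a uniform point may be rotated independently. This is visible in the
  unit ball of the product space, where Lebesgue measure splits and polar coordinates apply to each
  factor; both the indicator of the ball and the normalisation by \<open>sgn\<close> depend on the
  directions only through the two norms, which the rotations keep.\<close>

lemma nn_integral_usph_prod_polar:
  fixes F :: "'a::euclidean_space \<times> 'a \<Rightarrow> ennreal"
  assumes F: "F \<in> borel_measurable borel"
  shows "(\<integral>\<^sup>+w. F w \<partial>usph) =
    (\<integral>\<^sup>+w. \<integral>\<^sup>+\<theta>. \<integral>\<^sup>+\<theta>'. F (norm (fst w) *\<^sub>R \<theta>, norm (snd w) *\<^sub>R \<theta>') \<partial>usph \<partial>usph \<partial>(usph :: ('a \<times> 'a) measure))"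
proof -
  have [measurable]: "F \<in> borel_measurable (borel \<Otimes>\<^sub>M borel)" using F by (simp add: borel_prod)
  define H where "H w = indicator (ball 0 1) w * F (sgn w)" for w
  have "H \<in> borel_measurable borel"
    unfolding H_def using measurable_compose[OF borel_measurable_sgn_euclidean F] by measurable
  then have H [measurable]: "H \<in> borel_measurable (borel \<Otimes>\<^sub>M borel)" by (simp add: borel_prod)
  have H': "H \<in> borel_measurable (lborel \<Otimes>\<^sub>M lborel)" using H by simp
  have "(\<integral>\<^sup>+w. H w \<partial>lborel) = (\<integral>\<^sup>+u. \<integral>\<^sup>+v. H (u, v) \<partial>lborel \<partial>lborel)"
    using lborel.nn_integral_fst[OF H'] by (simp add: lborel_prod)
  also have "\<dots> = (\<integral>\<^sup>+u. \<integral>\<^sup>+v. \<integral>\<^sup>+\<theta>'. H (u, norm v *\<^sub>R \<theta>') \<partial>usph \<partial>(lborel :: 'a measure) \<partial>lborel)"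
    by (intro nn_integral_cong nn_integral_polar) measurable
  also have "\<dots> = (\<integral>\<^sup>+v. \<integral>\<^sup>+u. \<integral>\<^sup>+\<theta>'. H (u, norm v *\<^sub>R \<theta>') \<partial>usph \<partial>lborel \<partial>(lborel :: 'a measure))"
    by (rule lborel_pair.Fubini'[symmetric]) measurable
  also have "\<dots> = (\<integral>\<^sup>+v. \<integral>\<^sup>+u. \<integral>\<^sup>+\<theta>. \<integral>\<^sup>+\<theta>'. H (norm u *\<^sub>R \<theta>, norm v *\<^sub>R \<theta>') \<partial>usph \<partial>usph \<partial>(lborel :: 'a measure) \<partial>(lborel :: 'a measure))"
    by (rule nn_integral_cong, rule nn_integral_polar) measurable
  also have "\<dots> = (\<integral>\<^sup>+u. \<integral>\<^sup>+v. \<integral>\<^sup>+\<theta>. \<integral>\<^sup>+\<theta>'. H (norm u *\<^sub>R \<theta>, norm v *\<^sub>R \<theta>') \<partial>usph \<partial>usph \<partial>(lborel :: 'a measure) \<partial>(lborel :: 'a measure))"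
    by (rule lborel_pair.Fubini') measurable
  also have "\<dots> = (\<integral>\<^sup>+u. \<integral>\<^sup>+v. indicator (ball 0 1) (u, v) * (\<integral>\<^sup>+\<theta>. \<integral>\<^sup>+\<theta>'. F (norm (fst (sgn (u, v))) *\<^sub>R \<theta>, norm (snd (sgn (u, v))) *\<^sub>R \<theta>') \<partial>usph \<partial>usph) \<partial>(lborel :: 'a measure) \<partial>(lborel :: 'a measure))"
  proof (rule nn_integral_cong, rule nn_integral_cong)
    fix u v :: 'a
    have eq: "H (norm u *\<^sub>R \<theta>, norm v *\<^sub>R \<theta>') = indicator (ball 0 1) (u, v) *
        F (norm (fst (sgn (u, v))) *\<^sub>R \<theta>, norm (snd (sgn (u, v))) *\<^sub>R \<theta>')"
      if "norm \<theta> = 1" "norm \<theta>' = 1" for \<theta> \<theta>' :: 'a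
    proof -
      have n: "norm (norm u *\<^sub>R \<theta>, norm v *\<^sub>R \<theta>') = norm (u, v)" using that by (simp add: norm_Pair)
      have "sgn (norm u *\<^sub>R \<theta>, norm v *\<^sub>R \<theta>') = (norm (fst (sgn (u, v))) *\<^sub>R \<theta>, norm (snd (sgn (u, v))) *\<^sub>R \<theta>')"
        unfolding sgn_div_norm n by (simp add: mult.commute)
      then show ?thesis unfolding H_def using n by (simp add: indicator_def)
    qed
    have inner: "(\<integral>\<^sup>+\<theta>'. H (norm u *\<^sub>R \<theta>, norm v *\<^sub>R \<theta>') \<partial>usph) = (\<integral>\<^sup>+\<theta>'. indicator (ball 0 1) (u, v) * F (norm (fst (sgn (u, v))) *\<^sub>R \<theta>, norm (snd (sgn (u, v))) *\<^sub>R \<theta>') \<partial>usph)" if \<theta>: "norm \<theta> = 1" for \<theta> :: 'a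
    proof (rule nn_integral_cong_AE)
      show "AE \<theta>' in usph. H (norm u *\<^sub>R \<theta>, norm v *\<^sub>R \<theta>') = indicator (ball 0 1) (u, v) * F (norm (fst (sgn (u, v))) *\<^sub>R \<theta>, norm (snd (sgn (u, v))) *\<^sub>R \<theta>')"
        using AE_usph_norm by eventually_elim (rule eq[OF \<theta>])
    qed
    have "(\<integral>\<^sup>+\<theta>. \<integral>\<^sup>+\<theta>'. H (norm u *\<^sub>R \<theta>, norm v *\<^sub>R \<theta>') \<partial>usph \<partial>usph) = (\<integral>\<^sup>+\<theta>. \<integral>\<^sup>+\<theta>'. indicator (ball 0 1) (u, v) * F (norm (fst (sgn (u, v))) *\<^sub>R \<theta>, norm (snd (sgn (u, v))) *\<^sub>R \<theta>') \<partial>usph \<partial>usph)"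
    proof (rule nn_integral_cong_AE)
      show "AE \<theta> in usph. (\<integral>\<^sup>+\<theta>'. H (norm u *\<^sub>R \<theta>, norm v *\<^sub>R \<theta>') \<partial>usph) = (\<integral>\<^sup>+\<theta>'. indicator (ball 0 1) (u, v) * F (norm (fst (sgn (u, v))) *\<^sub>R \<theta>, norm (snd (sgn (u, v))) *\<^sub>R \<theta>') \<partial>usph)"
        using AE_usph_norm by eventually_elim (rule inner)
    qed
    also have "\<dots> = indicator (ball 0 1) (u, v) * (\<integral>\<^sup>+\<theta>. \<integral>\<^sup>+\<theta>'. F (norm (fst (sgn (u, v))) *\<^sub>R \<theta>, norm (snd (sgn (u, v))) *\<^sub>R \<theta>') \<partial>usph \<partial>usph)"
      by (simp add: nn_integral_cmult)
    finally show "(\<integral>\<^sup>+\<theta>. \<integral>\<^sup>+\<theta>'. H (norm u *\<^sub>R \<theta>, norm v *\<^sub>R \<theta>') \<partial>usph \<partial>usph) = \<dots>" .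
  qed
  also have "\<dots> = (\<integral>\<^sup>+w. indicator (ball 0 1) w * (\<integral>\<^sup>+\<theta>. \<integral>\<^sup>+\<theta>'. F (norm (fst (sgn w)) *\<^sub>R \<theta>, norm (snd (sgn w)) *\<^sub>R \<theta>') \<partial>usph \<partial>usph) \<partial>(lborel :: ('a \<times> 'a) measure))"
  proof -
    let ?G = "\<lambda>w::'a \<times> 'a. \<integral>\<^sup>+\<theta>. \<integral>\<^sup>+\<theta>'. F (norm (fst w) *\<^sub>R \<theta>, norm (snd w) *\<^sub>R \<theta>') \<partial>usph \<partial>usph"
    have "?G \<in> borel_measurable (borel \<Otimes>\<^sub>M borel)" by measurable
    then have "?G \<in> borel_measurable borel" by (simp add: borel_prod)
    from measurable_compose[OF borel_measurable_sgn_euclidean this]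
    have "(\<lambda>w. indicator (ball 0 1) w * ?G (sgn w)) \<in> borel_measurable borel" by measurable
    then have "(\<lambda>w. indicator (ball 0 1) w * ?G (sgn w)) \<in> borel_measurable (lborel \<Otimes>\<^sub>M lborel)"
      by (simp add: lborel_prod)
    from lborel.nn_integral_fst[OF this] show ?thesis by (simp add: lborel_prod)
  qed
  finally have main: "(\<integral>\<^sup>+w. H w \<partial>lborel) = \<dots>" .
  have G: "(\<lambda>w::'a \<times> 'a. \<integral>\<^sup>+\<theta>. \<integral>\<^sup>+\<theta>'. F (norm (fst w) *\<^sub>R \<theta>, norm (snd w) *\<^sub>R \<theta>') \<partial>usph \<partial>usph) \<in> borel_measurable borel"
    unfolding borel_prod[symmetric] by measurable
  show ?thesis
    unfolding nn_integral_usph[OF F] nn_integral_usph[OF G] using main by (simp add: H_def)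
qed

text \<open>The same invariance as an identity of measures, the form needed for Bochner integrals of
  functions of variable sign.\<close>

lemma distr_usph_prod:
  "distr ((usph :: ('a \<times> 'a) measure) \<Otimes>\<^sub>M ((usph :: 'a measure) \<Otimes>\<^sub>M (usph :: 'a measure))) borel
     (\<lambda>(w, \<theta>, \<theta>'). (norm (fst w) *\<^sub>R \<theta>, norm (snd w) *\<^sub>R \<theta>')) = (usph :: ('a::euclidean_space \<times> 'a) measure)"
    (is "distr ?P borel ?T = _")
proof (rule measure_eqI)
  interpret P: pair_prob_space "usph :: 'a measure" "usph :: 'a measure" ..
  have meas: "?T \<in> ?P \<rightarrow>\<^sub>M borel"
  proof -
    have s: "sets ?P = sets ((borel \<Otimes>\<^sub>M borel) \<Otimes>\<^sub>M (borel \<Otimes>\<^sub>M borel) :: (('a \<times> 'a) \<times> ('a \<times> 'a)) measure)"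
    proof (rule sets_pair_measure_cong)
      show "sets (usph :: ('a \<times> 'a) measure) = sets (borel \<Otimes>\<^sub>M borel)"
        by (simp only: sets_usph borel_prod)
      show "sets ((usph :: 'a measure) \<Otimes>\<^sub>M (usph :: 'a measure)) = sets (borel \<Otimes>\<^sub>M borel)"
        by (rule sets_pair_measure_cong) simp_all
    qed
    have "?T \<in> ((borel \<Otimes>\<^sub>M borel) \<Otimes>\<^sub>M (borel \<Otimes>\<^sub>M borel)) \<rightarrow>\<^sub>M borel \<Otimes>\<^sub>M borel"
      by measurable
    then show ?thesis unfolding borel_prod measurable_cong_sets[OF s refl, unfolded borel_prod] .
  qed
  fix A assume "A \<in> sets (distr ?P borel ?T)"
  then have A: "A \<in> sets borel" by simp
  have [measurable]: "A \<in> sets (borel \<Otimes>\<^sub>M borel)" unfolding borel_prod by (rule A)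
  have "emeasure (distr ?P borel ?T) A = (\<integral>\<^sup>+x. indicator A x \<partial>distr ?P borel ?T)" using A by simp
  also have "\<dots> = (\<integral>\<^sup>+p. indicator A (?T p) \<partial>?P)" by (rule nn_integral_distr[OF meas]) (use A in simp)
  also have "\<dots> = (\<integral>\<^sup>+w. \<integral>\<^sup>+q. indicator A (?T (w, q)) \<partial>(usph \<Otimes>\<^sub>M usph) \<partial>usph)"
    by (rule P.nn_integral_fst[symmetric]) (rule measurable_compose[OF meas], use A in simp)
  also have "\<dots> = (\<integral>\<^sup>+w. \<integral>\<^sup>+\<theta>. \<integral>\<^sup>+\<theta>'. indicator A (norm (fst w) *\<^sub>R \<theta>, norm (snd w) *\<^sub>R \<theta>') \<partial>usph \<partial>usph \<partial>(usph :: ('a \<times> 'a) measure))"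
    by (rule nn_integral_cong, subst usph.nn_integral_fst[symmetric]) simp_all
  also have "\<dots> = (\<integral>\<^sup>+w. indicator A w \<partial>usph)"
    by (rule nn_integral_usph_prod_polar[symmetric]) (use A in simp)
  also have "\<dots> = emeasure usph A" using A by simp
  finally show "emeasure (distr ?P borel ?T) A = emeasure usph A" .
qed simp

section \<open>From the uniform probability to the completed surface measure\<close>

abbreviation sphere_base :: "'a::euclidean_space measure" where
  "sphere_base \<equiv> scale_measure (of_nat DIM('a))
     (distr (restrict_space lborel (ball 0 1 - {0})) (restrict_space borel (sphere 0 1)) sgn)"

lemma borel_measurable_sphere_base:
  assumes "F \<in> borel_measurable borel"
  shows "F \<in> borel_measurable sphere_base"
proof -
  have "F \<in> borel_measurable (restrict_space borel (sphere 0 1))"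
    using assms by (rule measurable_restrict_space1)
  then show ?thesis by (simp cong: measurable_cong_sets)
qed

lemma nn_integral_sphere_base:
  fixes F :: "'a::euclidean_space \<Rightarrow> ennreal"
  assumes F: "F \<in> borel_measurable borel"
  shows "(\<integral>\<^sup>+x. F x \<partial>sphere_base) = ennreal (DIM('a) * unit_ball_vol DIM('a)) * (\<integral>\<^sup>+x. F x \<partial>usph)"
proof -
  let ?V = "emeasure lborel (ball (0::'a) 1)"
  have F': "F \<in> borel_measurable (distr (restrict_space lborel (ball 0 1 - {0})) (restrict_space borel (sphere 0 1)) sgn)"
    using measurable_restrict_space1[OF F, of "sphere 0 1"] by simp
  have "(\<integral>\<^sup>+x. F x \<partial>sphere_base) = of_nat DIM('a) * (\<integral>\<^sup>+x. F (sgn x) \<partial>restrict_space lborel (ball 0 1 - {0}))"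
    by (subst nn_integral_scale_measure[OF F']) (simp add: nn_integral_distr[OF measurable_sgn_sphere F'])
  also have "(\<integral>\<^sup>+x. F (sgn x) \<partial>restrict_space lborel (ball 0 1 - {0})) = (\<integral>\<^sup>+x. F (sgn x) * indicator (ball 0 1 - {0}) x \<partial>lborel)"
    by (rule nn_integral_restrict_space) simp
  also have "\<dots> = (\<integral>\<^sup>+x. indicator (ball 0 1) x * F (sgn x) \<partial>lborel)"
    by (rule nn_integral_cong_AE, rule AE_mp[OF AE_lborel_singleton[of "0::'a"]]) (simp add: indicator_def)
  also have "\<dots> = ?V * (\<integral>\<^sup>+x. F x \<partial>usph)"
    by (simp add: nn_integral_usph[OF F] ennreal_times_divide ennreal_mult_divide_eq mult.commute[of ?V])
  also have "?V = ennreal (unit_ball_vol DIM('a))" by (simp add: emeasure_ball)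
  also have "of_nat DIM('a) * (ennreal (unit_ball_vol DIM('a)) * (\<integral>\<^sup>+x. F x \<partial>usph)) =
      ennreal (DIM('a) * unit_ball_vol DIM('a)) * (\<integral>\<^sup>+x. F x \<partial>usph)"
    by (simp add: ennreal_mult mult.assoc ennreal_of_nat_eq_real_of_nat)
  finally show ?thesis .
qed

lemma nn_integral_sphere_measure:
  fixes F :: "'a::euclidean_space \<Rightarrow> ennreal"
  assumes F: "F \<in> borel_measurable borel"
  shows "(\<integral>\<^sup>+x. F x \<partial>sphere_measure) = ennreal (DIM('a) * unit_ball_vol DIM('a)) * (\<integral>\<^sup>+x. F x \<partial>usph)"
  unfolding sphere_measure_def nn_integral_completion by (rule nn_integral_sphere_base[OF F])

lemma borel_measurable_sphere_measure:
  "F \<in> borel_measurable borel \<Longrightarrow> F \<in> borel_measurable sphere_measure"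
  unfolding sphere_measure_def by (intro measurable_completion borel_measurable_sphere_base)

lemma integral_sphere_measure:
  fixes F :: "'a::euclidean_space \<Rightarrow> 'b::{banach, second_countable_topology}"
  assumes F: "F \<in> borel_measurable borel"
  shows "integral\<^sup>L sphere_measure F = (DIM('a) * unit_ball_vol DIM('a)) *\<^sub>R integral\<^sup>L usph F"
proof -
  have id: "(\<lambda>x. x) \<in> sphere_base \<rightarrow>\<^sub>M borel"
    by (rule borel_measurable_sphere_base) simp
  \<comment> \<open>The identity map carries the measure from the Borel sets of the sphere to those
    of the whole space, where it can be compared with \<open>usph\<close>: it is the same measure
    times the total mass.\<close>
  have "distr sphere_base borel (\<lambda>x. x) = density (usph :: 'a measure) (\<lambda>_. ennreal (DIM('a) * unit_ball_vol DIM('a)))"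
  proof (rule measure_eqI)
    fix A :: "'a set" assume "A \<in> sets (distr sphere_base borel (\<lambda>x. x))"
    then have A: "A \<in> sets borel" by simp
    have "emeasure (distr sphere_base borel (\<lambda>x. x)) A = (\<integral>\<^sup>+x. indicator A x \<partial>distr sphere_base borel (\<lambda>x. x))"
      using A by simp
    also have "\<dots> = (\<integral>\<^sup>+x. indicator A x \<partial>sphere_base)"
      by (rule nn_integral_distr[OF id]) (use A in simp)
    also have "\<dots> = ennreal (DIM('a) * unit_ball_vol DIM('a)) * (\<integral>\<^sup>+x. indicator A x \<partial>usph)"
      by (rule nn_integral_sphere_base) (use A in simp)
    also have "\<dots> = emeasure (density (usph :: 'a measure) (\<lambda>_. ennreal (DIM('a) * unit_ball_vol DIM('a)))) A"
      using A by (simp add: emeasure_density nn_integral_cmult)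
    finally show "emeasure (distr sphere_base borel (\<lambda>x. x)) A =
      emeasure (density (usph :: 'a measure) (\<lambda>_. ennreal (DIM('a) * unit_ball_vol DIM('a)))) A" .
  qed simp
  then have "integral\<^sup>L sphere_base F = integral\<^sup>L (density (usph :: 'a measure) (\<lambda>_. ennreal (DIM('a) * unit_ball_vol DIM('a)))) F"
    using integral_distr[OF id F] by simp
  also have "\<dots> = (\<integral>x. (DIM('a) * unit_ball_vol DIM('a)) *\<^sub>R F x \<partial>usph)"
    by (rule integral_density) (use F in auto)
  finally show ?thesis
    unfolding sphere_measure_def integral_completion[OF borel_measurable_sphere_base[OF F]] by simp
qed

lemma AE_sphere_measure_notin:
  assumes "N \<in> sets borel" "emeasure usph N = 0"
  shows "AE x in (sphere_measure :: 'a::euclidean_space measure). x \<notin> N"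
proof -
  have [measurable]: "indicator N \<in> borel_measurable sphere_measure"
    by (rule borel_measurable_sphere_measure) (use assms in simp)
  have "(\<integral>\<^sup>+x. indicator N x \<partial>(sphere_measure :: 'a measure)) = 0"
    using assms by (subst nn_integral_sphere_measure) auto
  then have "AE x in (sphere_measure :: 'a measure). (indicator N x :: ennreal) = 0"
    by (subst (asm) nn_integral_0_iff_AE) auto
  then show ?thesis by (auto simp: indicator_def elim!: eventually_mono split: if_splits)
qed

section \<open>The dyadic Hardy--Littlewood maximal function\<close>

text \<open>Dyadic radii are the only ones that occur for the dyadic operator, and a countable
  supremum is measurable at once. The value may be infinite.\<close>

definition hl_max :: "('a::euclidean_space \<Rightarrow> ennreal) \<Rightarrow> 'a \<Rightarrow> ennreal" where
  "hl_max f x = (SUP k::int. (\<integral>\<^sup>+u. f u * indicator (ball x (2 powi k)) u \<partial>lborel) /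
     emeasure lborel (ball (0::'a) (2 powi k)))"

lemma borel_measurable_ball_integral [measurable]:
  fixes f :: "'a::euclidean_space \<Rightarrow> ennreal"
  assumes [measurable]: "f \<in> borel_measurable borel"
  shows "(\<lambda>x. \<integral>\<^sup>+u. f u * indicator (ball x r) u \<partial>lborel) \<in> borel_measurable borel"
proof -
  have "(\<lambda>x. \<integral>\<^sup>+u. f u * indicator {..<r} (dist x u) \<partial>lborel) \<in> borel_measurable borel"
    by measurable
  then show ?thesis by (simp add: indicator_def)
qed

lemma borel_measurable_hl_max [measurable]:
  assumes [measurable]: "f \<in> borel_measurable borel"
  shows "hl_max f \<in> borel_measurable borel"
  unfolding hl_max_def[abs_def] by measurable

lemma emeasure_lborel_ball_pos:
  assumes "0 < r"
  shows "emeasure lborel (ball (x::'a::euclidean_space) r) \<noteq> 0"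
    and "emeasure lborel (ball (x::'a::euclidean_space) r) \<noteq> top"
  using assms by (simp_all add: emeasure_ball ennreal_eq_0_iff not_le)

text \<open>Vitali covering: every point of the level set is the centre of a ball with average above
  \<open>l\<close>; a disjoint subfamily is selected whose fivefold enlargements still cover, which
  costs \<open>5 ^ n\<close> in volume. Disjointness bounds the sum of the integrals over the
  selected balls by the whole integral.\<close>

lemma hl_max_weak_type:
  fixes f :: "'a::euclidean_space \<Rightarrow> ennreal"
  assumes f [measurable]: "f \<in> borel_measurable borel" and l: "0 < l"
  shows "ennreal l * emeasure lborel {x. ennreal l < hl_max f x} \<le> 5 ^ DIM('a) * (\<integral>\<^sup>+x. f x \<partial>lborel)"
proof (cases "(\<integral>\<^sup>+x. f x \<partial>lborel) = top")
  case True
  then show ?thesis by (simp add: ennreal_mult_top)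
next
  case fin: False
  let ?n = "DIM('a)" and ?V = "unit_ball_vol DIM('a)"
  define S where "S = {x. ennreal l < hl_max f x}"
  have "\<exists>r. r > 0 \<and> ennreal l * emeasure lborel (ball x r) < (\<integral>\<^sup>+u. f u * indicator (ball x r) u \<partial>lborel)"
    if "x \<in> S" for x
  proof -
    obtain k where k: "ennreal l < (\<integral>\<^sup>+u. f u * indicator (ball x (2 powi k)) u \<partial>lborel) /
      emeasure lborel (ball (0::'a) (2 powi k))"
      using \<open>x \<in> S\<close> unfolding S_def hl_max_def by (auto simp: less_SUP_iff)
    let ?e = "emeasure lborel (ball (0::'a) (2 powi k))"
    let ?I = "\<integral>\<^sup>+u. f u * indicator (ball x (2 powi k)) u \<partial>lborel"
    have e: "?e \<noteq> 0" "?e \<noteq> top"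
      by (auto intro!: emeasure_lborel_ball_pos simp: zero_less_power_int)
    have "\<not> ?I \<le> ennreal l * ?e"
    proof
      assume "?I \<le> ennreal l * ?e"
      then have "?I / ?e \<le> ennreal l * ?e / ?e" by (rule divide_right_mono_ennreal)
      also have "\<dots> = ennreal l" using e by (simp add: ennreal_mult_divide_eq)
      finally show False using k by simp
    qed
    then show ?thesis
      by (intro exI[of _ "2 powi k"]) (simp add: emeasure_ball not_le zero_less_power_int)
  qed
  then obtain r where r: "\<And>x. x \<in> S \<Longrightarrow> r x > 0"
    "\<And>x. x \<in> S \<Longrightarrow> ennreal l * emeasure lborel (ball x (r x)) < (\<integral>\<^sup>+u. f u * indicator (ball x (r x)) u \<partial>lborel)"
    by metis
  define I where "I = enn2real (\<integral>\<^sup>+x. f x \<partial>lborel)"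
  have I: "(\<integral>\<^sup>+x. f x \<partial>lborel) = ennreal I" using fin by (simp add: I_def top.not_eq_extremum)
  \<comment> \<open>The covering lemma needs bounded radii. A ball with average above
    \<open>l\<close> satisfies \<open>l * (?V * r ^ n) \<le> I\<close>, and
    \<open>r \<le> r ^ n\<close> once \<open>r \<ge> 1\<close>; this explains the maximum with
    1.\<close>
  define B where "B = max 1 (I / (l * ?V))"
  have rB: "r x \<le> B" if x: "x \<in> S" for x
  proof (rule ccontr)
    assume "\<not> r x \<le> B"
    then have gt: "r x > 1" "r x > I / (l * ?V)" by (auto simp: B_def)
    have "ennreal l * emeasure lborel (ball x (r x)) \<le> ennreal I"
    proof -
      have "(\<integral>\<^sup>+u. f u * indicator (ball x (r x)) u \<partial>lborel) \<le> (\<integral>\<^sup>+x. f x \<partial>lborel)"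
        by (intro nn_integral_mono) (auto simp: indicator_def)
      then show ?thesis using r(2)[OF x] I by simp
    qed
    then have "l * (?V * r x ^ ?n) \<le> I"
      using r(1)[OF x] l by (simp add: emeasure_ball I_def flip: ennreal_mult)
    moreover have "r x \<le> r x ^ ?n" using gt by (intro self_le_power) auto
    then have "l * (?V * r x) \<le> l * (?V * r x ^ ?n)" using l by (intro mult_left_mono) auto
    ultimately have "l * (?V * r x) \<le> I" by linarith
    then have "r x \<le> I / (l * ?V)" using l by (simp add: pos_le_divide_eq mult_ac)
    then show False using gt by simp
  qed
  have "S \<subseteq> (\<Union>x\<in>S. ball x (r x))" using r(1) by force
  then obtain C where C: "countable C" "C \<subseteq> S"
     "pairwise (\<lambda>i j. disjnt (ball i (r i)) (ball j (r j))) C"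
     "S \<subseteq> (\<Union>i\<in>C. ball i (5 * r i))"
    by (rule Vitali_covering_lemma_balls[where a="\<lambda>x. x" and r=r and K=S and B=B and S=S]) (use r(1) rB in auto)
  have [measurable]: "S \<in> sets borel" unfolding S_def by measurable
  have "ennreal l * emeasure lborel S = ennreal l * (\<integral>\<^sup>+x. indicator S x \<partial>lborel)" by simp
  \<comment> \<open>Sums over the countable family \<open>C\<close> are integrals against
    \<open>count_space C\<close>, so that they can be exchanged with the Lebesgue integral.\<close>
  also have "\<dots> \<le> ennreal l * (\<integral>\<^sup>+x. (\<integral>\<^sup>+i. indicator (ball i (5 * r i)) x \<partial>count_space C) \<partial>lborel)"
  proof (intro mult_left_mono nn_integral_mono)
    fix x
    show "indicator S x \<le> (\<integral>\<^sup>+i. indicator (ball i (5 * r i)) x \<partial>count_space C :: ennreal)"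
    proof (cases "x \<in> S")
      case True
      then obtain i where i: "i \<in> C" "x \<in> ball i (5 * r i)" using C(4) by blast
      then have "1 = (\<integral>\<^sup>+j. indicator {i} j \<partial>count_space C :: ennreal)"
        by (subst nn_integral_indicator) auto
      also have "\<dots> \<le> (\<integral>\<^sup>+j. indicator (ball j (5 * r j)) x \<partial>count_space C :: ennreal)"
        using i by (intro nn_integral_mono) (auto simp: indicator_def)
      finally show ?thesis using True by simp
    qed simp
  qed simp
  also have "\<dots> = ennreal l * (\<integral>\<^sup>+i. (\<integral>\<^sup>+x. indicator (ball i (5 * r i)) x \<partial>lborel) \<partial>count_space C)"
    using C(1) by (subst nn_integral_count_space_nn_integral) auto
  also have "\<dots> = (\<integral>\<^sup>+i. ennreal l * emeasure lborel (ball i (5 * r i)) \<partial>count_space C)"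
    by (simp add: nn_integral_cmult)
  also have "\<dots> = (\<integral>\<^sup>+i. 5 ^ ?n * (ennreal l * emeasure lborel (ball i (r i))) \<partial>count_space C)"
  proof (intro nn_integral_cong)
    fix i assume "i \<in> space (count_space C)"
    then have "r i > 0" using C(2) r(1) by auto
    then have "emeasure lborel (ball i (5 * r i)) = 5 ^ ?n * emeasure lborel (ball i (r i))"
      by (simp add: emeasure_ball power_mult_distrib ennreal_mult' mult_ac flip: ennreal_power)
    then show "ennreal l * emeasure lborel (ball i (5 * r i)) = 5 ^ ?n * (ennreal l * emeasure lborel (ball i (r i)))"
      by (simp add: mult_ac)
  qed
  also have "\<dots> \<le> (\<integral>\<^sup>+i. 5 ^ ?n * (\<integral>\<^sup>+u. f u * indicator (ball i (r i)) u \<partial>lborel) \<partial>count_space C)"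
  proof (intro nn_integral_mono mult_left_mono)
    fix i assume "i \<in> space (count_space C)"
    then have "i \<in> S" using C(2) by auto
    then show "ennreal l * emeasure lborel (ball i (r i)) \<le> (\<integral>\<^sup>+u. f u * indicator (ball i (r i)) u \<partial>lborel)"
      by (rule less_imp_le[OF r(2)])
  qed simp
  also have "\<dots> = 5 ^ ?n * (\<integral>\<^sup>+i. (\<integral>\<^sup>+u. f u * indicator (ball i (r i)) u \<partial>lborel) \<partial>count_space C)"
    by (rule nn_integral_cmult) simp
  also have "(\<integral>\<^sup>+i. (\<integral>\<^sup>+u. f u * indicator (ball i (r i)) u \<partial>lborel) \<partial>count_space C) =
      (\<integral>\<^sup>+u. (\<integral>\<^sup>+i. f u * indicator (ball i (r i)) u \<partial>count_space C) \<partial>lborel)"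
    using C(1) by (intro nn_integral_count_space_nn_integral[symmetric]) auto
  also have "\<dots> \<le> (\<integral>\<^sup>+u. f u \<partial>lborel)"
  proof (intro nn_integral_mono)
    fix u
    have "(\<integral>\<^sup>+i. f u * indicator (ball i (r i)) u \<partial>count_space C) \<le> f u * 1"
    proof (cases "\<exists>j\<in>C. u \<in> ball j (r j)")
      case True
      then obtain j where j: "j \<in> C" "u \<in> ball j (r j)" by blast
      have uniq: "i = j" if "i \<in> C" "u \<in> ball i (r i)" for i
      proof (rule ccontr)
        assume "i \<noteq> j"
        with C(3) that(1) j(1) have "disjnt (ball i (r i)) (ball j (r j))" by (rule pairwiseD)
        then show False using that(2) j(2) by (meson disjnt_iff)
      qed
      have "(\<integral>\<^sup>+i. f u * indicator (ball i (r i)) u \<partial>count_space C) = (\<integral>\<^sup>+i. f u * indicator {j} i \<partial>count_space C)"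
        using j by (intro nn_integral_cong) (auto simp: indicator_def dest: uniq)
      also have "\<dots> = f u * emeasure (count_space C) {j}"
        using j by (subst nn_integral_cmult_indicator) auto
      also have "\<dots> = f u * 1" using j by simp
      finally show ?thesis by simp
    next
      case False
      then have "(\<integral>\<^sup>+i. f u * indicator (ball i (r i)) u \<partial>count_space C) = (\<integral>\<^sup>+i. 0 \<partial>count_space C)"
        by (intro nn_integral_cong) (auto simp: indicator_def)
      then show ?thesis by simp
    qed
    then show "(\<integral>\<^sup>+i. f u * indicator (ball i (r i)) u \<partial>count_space C) \<le> f u" by simp
  qed
  finally show ?thesis
    unfolding S_def[symmetric] by (simp add: mult_left_mono)
qed

text \<open>Values of \<open>f\<close> up to the level \<open>c\<close> contribute at most
  \<open>c\<close> to every average. Thus a maximal function above \<open>2 * c\<close> is caused by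
  the values of \<open>f\<close> above \<open>c\<close> alone.\<close>

lemma hl_max_le_truncation:
  fixes f :: "'a::euclidean_space \<Rightarrow> ennreal"
  assumes [measurable]: "f \<in> borel_measurable borel"
  shows "hl_max f x \<le> hl_max (\<lambda>u. f u * indicator {u. c < f u} u) x + c"
  unfolding hl_max_def
proof (rule SUP_least)
  fix k :: int
  let ?B = "ball x (2 powi k)" and ?e = "emeasure lborel (ball (0::'a) (2 powi k))"
  let ?g = "\<lambda>u. f u * indicator {u. c < f u} u"
  have e: "?e \<noteq> 0" "?e \<noteq> top"
    by (auto intro!: emeasure_lborel_ball_pos simp: zero_less_power_int)
  have eB: "emeasure lborel ?B = ?e" by (simp add: emeasure_ball)
  have "(\<integral>\<^sup>+u. f u * indicator ?B u \<partial>lborel) \<le> (\<integral>\<^sup>+u. ?g u * indicator ?B u + c * indicator ?B u \<partial>lborel)"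
    by (intro nn_integral_mono) (auto simp: indicator_def not_less)
  also have "\<dots> = (\<integral>\<^sup>+u. ?g u * indicator ?B u \<partial>lborel) + c * ?e"
    by (subst nn_integral_add) (simp_all add: nn_integral_cmult_indicator eB)
  finally have "(\<integral>\<^sup>+u. f u * indicator ?B u \<partial>lborel) / ?e \<le> ((\<integral>\<^sup>+u. ?g u * indicator ?B u \<partial>lborel) + c * ?e) / ?e"
    by (rule divide_right_mono_ennreal)
  also have "\<dots> = (\<integral>\<^sup>+u. ?g u * indicator ?B u \<partial>lborel) / ?e + c"
    using e by (simp add: add_divide_distrib_ennreal ennreal_mult_divide_eq)
  also have "\<dots> \<le> (SUP k::int. (\<integral>\<^sup>+u. ?g u * indicator (ball x (2 powi k)) u \<partial>lborel) /
      emeasure lborel (ball (0::'a) (2 powi k))) + c"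
    by (intro add_right_mono SUP_upper) simp
  finally show "(\<integral>\<^sup>+u. f u * indicator ?B u \<partial>lborel) / ?e \<le> \<dots>" .
qed

section \<open>From weak type to strong type\<close>

lemma nn_integral_powr_Icc:
  assumes "a > -1" "c \<ge> 0"
  shows "(\<integral>\<^sup>+t. ennreal (t powr a) * indicator {0..c} t \<partial>lborel) = ennreal (c powr (a + 1) / (a + 1))"
  using has_integral_powr_from_0[OF assms] by (intro nn_integral_has_integral_lebesgue') auto

lemma ennreal_powr_layer_cake:
  assumes p: "p > 0"
  shows "ennreal_powr y p \<le> (\<integral>\<^sup>+t. ennreal (p * t powr (p - 1)) * indicator {t. 0 < t \<and> ennreal t < y} t \<partial>lborel)"
proof -
  have *: "ennreal (c powr p) \<le> (\<integral>\<^sup>+t. ennreal (p * t powr (p - 1)) * indicator {t. 0 < t \<and> ennreal t < y} t \<partial>lborel)"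
    if c: "c \<ge> 0" "ennreal c \<le> y" for c
  proof -
    have "ennreal (c powr p) = ennreal p * ennreal (c powr (p - 1 + 1) / (p - 1 + 1))"
      using p by (simp flip: ennreal_mult)
    also have "\<dots> = ennreal p * (\<integral>\<^sup>+t. ennreal (t powr (p - 1)) * indicator {0..c} t \<partial>lborel)"
      using p c by (subst nn_integral_powr_Icc) auto
    also have "\<dots> = (\<integral>\<^sup>+t. ennreal p * (ennreal (t powr (p - 1)) * indicator {0..c} t) \<partial>lborel)"
      by (rule nn_integral_cmult[symmetric]) measurable
    also have "\<dots> \<le> (\<integral>\<^sup>+t. ennreal (p * t powr (p - 1)) * indicator {t. 0 < t \<and> ennreal t < y} t \<partial>lborel)"
    proof (rule nn_integral_mono_AE)
      have "AE t in lborel. t \<noteq> (0::real)" "AE t in lborel. t \<noteq> c" by (rule AE_lborel_singleton)+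
      then show "AE t in lborel. ennreal p * (ennreal (t powr (p - 1)) * indicator {0..c} t) \<le>
          ennreal (p * t powr (p - 1)) * indicator {t. 0 < t \<and> ennreal t < y} t"
      proof eventually_elim
        case (elim t)
        show ?case
        proof (cases "0 < t \<and> t < c")
          case True
          then have "ennreal t < y" by (intro less_le_trans[OF ennreal_lessI c(2)]) auto
          then show ?thesis using True p by (simp add: ennreal_mult)
        next
          case False
          then show ?thesis using elim by (auto simp: indicator_def)
        qed
      qed
    qed
    finally show ?thesis .
  qed
  show ?thesis
  proof (cases y)
    case (real c)
    then show ?thesis using *[of c] by (simp add: ennreal_powr_def)
  next
    case top
    define L where "L = (\<integral>\<^sup>+t. ennreal (p * t powr (p - 1)) * indicator {t. 0 < t \<and> ennreal t < y} t \<partial>lborel)"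
    have "L = top"
    proof (cases L)
      case (real m)
      \<comment> \<open>If the integral were a finite \<open>m\<close>, the bound \<open>*\<close>
        for this \<open>c\<close>, which satisfies \<open>c powr p = m + 1\<close>, would give
        \<open>m + 1 \<le> m\<close>.\<close>
      define c where "c = (m + 1) powr (1 / p)"
      have "c powr p = m + 1" using p real by (simp add: c_def powr_powr)
      moreover have "ennreal (c powr p) \<le> L" unfolding L_def by (rule *) (simp_all add: c_def top)
      ultimately show ?thesis using real by simp
    qed
    then show ?thesis by (simp add: L_def)
  qed
qed

text \<open>Marcinkiewicz's argument: the level set at height \<open>t\<close> is estimated by the
  weak type inequality for the part of \<open>f\<close> above \<open>t / 2\<close>. In the constant,
  \<open>2 * 5 ^ n * p\<close> comes from the weak type inequality and the layer-cake formula, and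
  \<open>(2 * f x) powr (p - 1) / (p - 1)\<close> is the integral of \<open>t powr (p - 2)\<close>
  up to \<open>2 * f x\<close>, which converges at 0 because \<open>p > 1\<close>.\<close>

lemma hl_max_strong_type:
  fixes f :: "'a::euclidean_space \<Rightarrow> real"
  assumes [measurable]: "f \<in> borel_measurable borel" and nn: "\<And>x. 0 \<le> f x" and p: "p > 1"
  shows "(\<integral>\<^sup>+x. ennreal_powr (hl_max (\<lambda>u. ennreal (f u)) x) p \<partial>lborel) \<le>
    ennreal (5 ^ DIM('a) * 2 powr p * p / (p - 1)) * (\<integral>\<^sup>+x. ennreal (f x powr p) \<partial>lborel)"
proof -
  let ?n = "DIM('a)"
  let ?M = "hl_max (\<lambda>u. ennreal (f u))"
  have "(\<integral>\<^sup>+x. ennreal_powr (?M x) p \<partial>lborel) \<le>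
     (\<integral>\<^sup>+x. \<integral>\<^sup>+t. ennreal (p * t powr (p - 1)) * indicator {t. 0 < t \<and> ennreal t < ?M x} t \<partial>lborel \<partial>lborel)"
    using p by (intro nn_integral_mono ennreal_powr_layer_cake) simp
  also have "\<dots> = (\<integral>\<^sup>+x. \<integral>\<^sup>+t. ennreal (p * t powr (p - 1)) * (if 0 < t \<and> ennreal t < ?M x then 1 else 0) \<partial>lborel \<partial>lborel)"
    by (simp add: indicator_def of_bool_def)
  also have "\<dots> = (\<integral>\<^sup>+t. \<integral>\<^sup>+x. ennreal (p * t powr (p - 1)) * (if 0 < t \<and> ennreal t < ?M x then 1 else 0) \<partial>lborel \<partial>lborel)"
    by (rule lborel_pair.Fubini'[symmetric]) measurable
  also have "\<dots> \<le> (\<integral>\<^sup>+t. \<integral>\<^sup>+x. ennreal (2 * 5 ^ ?n * p) * (ennreal (f x) * (ennreal (t powr (p - 2)) * (if 0 < t \<and> t < 2 * f x then 1 else 0))) \<partial>lborel \<partial>lborel)"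
  proof (rule nn_integral_mono)
    fix t :: real
    show "(\<integral>\<^sup>+x. ennreal (p * t powr (p - 1)) * (if 0 < t \<and> ennreal t < ?M x then 1 else 0) \<partial>lborel) \<le>
      (\<integral>\<^sup>+x. ennreal (2 * 5 ^ ?n * p) * (ennreal (f x) * (ennreal (t powr (p - 2)) * (if 0 < t \<and> t < 2 * f x then 1 else 0))) \<partial>lborel)"
    proof (cases "0 < t")
      case t: True
      let ?g = "\<lambda>u. ennreal (f u) * indicator {u. ennreal (t / 2) < ennreal (f u)} u"
      have sub: "{x. ennreal t < ?M x} \<subseteq> {x. ennreal (t / 2) < hl_max ?g x}"
      proof
        fix x assume "x \<in> {x. ennreal t < ?M x}"
        then have "ennreal (t / 2 + t / 2) < hl_max ?g x + ennreal (t / 2)"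
          using hl_max_le_truncation[of "\<lambda>u. ennreal (f u)" x "ennreal (t/2)"] by (simp add: less_le_trans)
        then have gt: "ennreal (t / 2 + t / 2) < hl_max ?g x + ennreal (t / 2)" .
        have "\<not> hl_max ?g x \<le> ennreal (t / 2)"
        proof
          assume "hl_max ?g x \<le> ennreal (t / 2)"
          then have "hl_max ?g x + ennreal (t / 2) \<le> ennreal (t / 2) + ennreal (t / 2)"
            by (rule add_right_mono)
          also have "\<dots> = ennreal (t / 2 + t / 2)" using t by (intro ennreal_plus[symmetric]) auto
          finally show False using gt by simp
        qed
        then show "x \<in> {x. ennreal (t / 2) < hl_max ?g x}" by simp
      qed
      have w: "ennreal (t / 2) * emeasure lborel {x. ennreal t < ?M x} \<le> 5 ^ ?n * (\<integral>\<^sup>+x. ?g x \<partial>lborel)"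
        using t by (intro order_trans[OF mult_left_mono[OF emeasure_mono[OF sub]] hl_max_weak_type]) auto
      have "(\<integral>\<^sup>+x. ennreal (p * t powr (p - 1)) * (if 0 < t \<and> ennreal t < ?M x then 1 else 0) \<partial>lborel) =
         (\<integral>\<^sup>+x. ennreal (p * t powr (p - 1)) * indicator {x. ennreal t < ?M x} x \<partial>lborel)"
        using t by (intro nn_integral_cong) (simp add: indicator_def)
      also have "\<dots> = ennreal (p * t powr (p - 1)) * emeasure lborel {x. ennreal t < ?M x}"
        by (rule nn_integral_cmult_indicator) simp
      \<comment> \<open>One factor \<open>t / 2\<close> is split off to match the left-hand side of
        the weak type inequality at height \<open>t / 2\<close>.\<close>
      also have eqp: "p * t powr (p - 1) = (2 * p * t powr (p - 2)) * (t / 2)"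
        using t by (simp add: powr_diff field_simps power2_eq_square)
      also have "ennreal ((2 * p * t powr (p - 2)) * (t / 2)) * emeasure lborel {x. ennreal t < ?M x} =
          ennreal (2 * p * t powr (p - 2)) * (ennreal (t / 2) * emeasure lborel {x. ennreal t < ?M x})"
      proof -
        have "ennreal ((2 * p * t powr (p - 2)) * (t / 2)) = ennreal (2 * p * t powr (p - 2)) * ennreal (t / 2)"
          using p t by (intro ennreal_mult) auto
        then show ?thesis by (simp only: mult.assoc)
      qed
      also have "\<dots> \<le> ennreal (2 * p * t powr (p - 2)) * (5 ^ ?n * (\<integral>\<^sup>+x. ?g x \<partial>lborel))"
        by (intro mult_left_mono w) simp
      also have "\<dots> = (\<integral>\<^sup>+x. ennreal (2 * p * t powr (p - 2)) * (5 ^ ?n * ?g x) \<partial>lborel)"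
        by (simp add: nn_integral_cmult)
      also have "\<dots> = (\<integral>\<^sup>+x. ennreal (2 * 5 ^ ?n * p) * (ennreal (f x) * (ennreal (t powr (p - 2)) * (if 0 < t \<and> t < 2 * f x then 1 else 0))) \<partial>lborel)"
      proof (intro nn_integral_cong)
        fix x
        have "(5::ennreal) ^ ?n = ennreal (5 ^ ?n)" by (simp add: ennreal_power[symmetric])
        moreover have "indicator {u. ennreal (t / 2) < ennreal (f u)} x = (if 0 < t \<and> t < 2 * f x then 1 else 0 :: ennreal)"
          using t nn[of x] by (simp add: indicator_def ennreal_less_iff)
        ultimately show "ennreal (2 * p * t powr (p - 2)) * (5 ^ ?n * ?g x) =
           ennreal (2 * 5 ^ ?n * p) * (ennreal (f x) * (ennreal (t powr (p - 2)) * (if 0 < t \<and> t < 2 * f x then 1 else 0)))"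
          using p by (simp add: ennreal_mult mult_ac)
      qed
      finally show ?thesis unfolding eqp .
    qed simp
  qed
  also have "\<dots> = (\<integral>\<^sup>+x. \<integral>\<^sup>+t. ennreal (2 * 5 ^ ?n * p) * (ennreal (f x) * (ennreal (t powr (p - 2)) * (if 0 < t \<and> t < 2 * f x then 1 else 0))) \<partial>lborel \<partial>lborel)"
    by (rule lborel_pair.Fubini') measurable
  also have "\<dots> \<le> (\<integral>\<^sup>+x. ennreal (5 ^ DIM('a) * 2 powr p * p / (p - 1)) * ennreal (f x powr p) \<partial>lborel)"
  proof (rule nn_integral_mono)
    fix x
    have "(\<integral>\<^sup>+t. ennreal (2 * 5 ^ ?n * p) * (ennreal (f x) * (ennreal (t powr (p - 2)) * (if 0 < t \<and> t < 2 * f x then 1 else 0))) \<partial>lborel)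
       = ennreal (2 * 5 ^ ?n * p) * (ennreal (f x) * (\<integral>\<^sup>+t. ennreal (t powr (p - 2)) * (if 0 < t \<and> t < 2 * f x then 1 else 0) \<partial>lborel))"
      by (simp add: nn_integral_cmult)
    also have "\<dots> \<le> ennreal (2 * 5 ^ ?n * p) * (ennreal (f x) * (\<integral>\<^sup>+t. ennreal (t powr (p - 2)) * indicator {0..2 * f x} t \<partial>lborel))"
      by (intro mult_left_mono nn_integral_mono) (auto simp: indicator_def)
    also have "\<dots> = ennreal (2 * 5 ^ ?n * p) * (ennreal (f x) * ennreal ((2 * f x) powr (p - 2 + 1) / (p - 2 + 1)))"
      using p nn[of x] by (subst nn_integral_powr_Icc) auto
    also have "\<dots> = ennreal ((2 * 5 ^ ?n * p) * (f x * ((2 * f x) powr (p - 1) / (p - 1))))"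
    proof -
      have "ennreal (f x * c) = ennreal (f x) * ennreal c" for c
        using nn[of x] by (rule ennreal_mult')
      moreover have "ennreal ((2 * 5 ^ ?n * p) * c) = ennreal (2 * 5 ^ ?n * p) * ennreal c" for c
        using p by (intro ennreal_mult') simp
      moreover have "p - 2 + 1 = p - 1" by simp
      ultimately show ?thesis by (simp only:)
    qed
    also have "(2 * 5 ^ ?n * p) * (f x * ((2 * f x) powr (p - 1) / (p - 1))) = 5 ^ DIM('a) * 2 powr p * p / (p - 1) * (f x powr p)"
    proof (cases "f x = 0")
      case False
      then have "f x > 0" using nn[of x] by simp
      then have "f x * (2 * f x) powr (p - 1) * 2 = 2 powr p * f x powr p"
        by (simp add: powr_mult powr_diff)
      then show ?thesis using p by (simp add: field_simps)
    qed simp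
    also have "ennreal \<dots> = ennreal (5 ^ DIM('a) * 2 powr p * p / (p - 1)) * ennreal (f x powr p)"
      using p by (intro ennreal_mult) auto
    finally show "(\<integral>\<^sup>+t. ennreal (2 * 5 ^ ?n * p) * (ennreal (f x) * (ennreal (t powr (p - 2)) * (if 0 < t \<and> t < 2 * f x then 1 else 0))) \<partial>lborel)
      \<le> ennreal (5 ^ DIM('a) * 2 powr p * p / (p - 1)) * ennreal (f x powr p)" by simp
  qed
  also have "\<dots> = ennreal (5 ^ DIM('a) * 2 powr p * p / (p - 1)) * (\<integral>\<^sup>+x. ennreal (f x powr p) \<partial>lborel)"
    by (rule nn_integral_cmult) measurable
  finally show ?thesis .
qed

section \<open>Averages over dyadic cubes\<close>

definition sqint :: "('a::euclidean_space \<Rightarrow> real) \<Rightarrow> bool" where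
  "sqint f \<longleftrightarrow> f \<in> borel_measurable borel \<and> integrable lborel (\<lambda>x. (f x)\<^sup>2)"

lemma sqint_measurable [measurable_dest]: "sqint f \<Longrightarrow> f \<in> borel_measurable borel"
  and sqint_square: "sqint f \<Longrightarrow> integrable lborel (\<lambda>x. (f x)\<^sup>2)"
  by (simp_all add: sqint_def)

lemma abs_mult_le_half_squares: "\<bar>a * b\<bar> \<le> (a\<^sup>2 + b\<^sup>2) / 2" for a b :: real
  using sum_squares_bound[of "\<bar>a\<bar>" "\<bar>b\<bar>"] by (simp add: abs_mult)

lemma sqint_mult:
  assumes "sqint f" "sqint g"
  shows "integrable lborel (\<lambda>x. f x * g x)"
proof (rule Bochner_Integration.integrable_bound)
  show "integrable lborel (\<lambda>x. ((f x)\<^sup>2 + (g x)\<^sup>2) / 2)"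
    using assms by (simp add: sqint_def)
  show "(\<lambda>x. f x * g x) \<in> borel_measurable lborel"
    using sqint_measurable[OF assms(1)] sqint_measurable[OF assms(2)] by simp
  show "AE x in lborel. norm (f x * g x) \<le> norm (((f x)\<^sup>2 + (g x)\<^sup>2) / 2)"
    using abs_mult_le_half_squares by (intro AE_I2) (simp add: abs_mult)
qed

lemma sqint_diff:
  assumes "sqint f" "sqint g"
  shows "sqint (\<lambda>x. f x - g x)"
  unfolding sqint_def
proof
  note [measurable] = sqint_measurable[OF assms(1)] sqint_measurable[OF assms(2)]
  show "(\<lambda>x. f x - g x) \<in> borel_measurable borel" by measurable
  have "integrable lborel (\<lambda>x. (f x)\<^sup>2 + (g x)\<^sup>2 - 2 * (f x * g x))"
    using assms by (intro Bochner_Integration.integrable_diff Bochner_Integration.integrable_add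
      integrable_mult_right sqint_mult sqint_square)
  then show "integrable lborel (\<lambda>x. (f x - g x)\<^sup>2)" by (simp add: power2_diff algebra_simps)
qed

lemma sqint_indicator:
  assumes "A \<in> sets borel" "emeasure lborel A < \<infinity>"
  shows "sqint (indicator A)"
proof -
  have "(\<lambda>x. (indicator A x :: real)\<^sup>2) = indicator A" by (auto simp: indicator_def fun_eq_iff)
  then show ?thesis using assms by (auto simp: sqint_def integrable_indicator_iff)
qed

text \<open>The dyadic grid enters only as an equivalence relation between points; cubes appear as
  its classes, half-open because of the floor, and are never indexed.\<close>

definition same_cube :: "int \<Rightarrow> 'a::euclidean_space \<Rightarrow> 'a \<Rightarrow> bool" where
  "same_cube k x u \<longleftrightarrow> (\<forall>b\<in>Basis. \<lfloor>(x \<bullet> b) / 2 powi k\<rfloor> = \<lfloor>(u \<bullet> b) / 2 powi k\<rfloor>)"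

lemma same_cube_sym: "same_cube k x u \<longleftrightarrow> same_cube k u x"
  and same_cube_trans: "same_cube k x u \<Longrightarrow> same_cube k u w \<Longrightarrow> same_cube k x w"
  by (auto simp: same_cube_def)

lemma powi_pos [simp]: "(0::real) < 2 powi k"
  by (simp add: zero_less_power_int)

text \<open>Nestedness of the grids: the coarse floor is the fine floor divided by
  \<open>2 ^ m\<close> and rounded down, hence a function of the fine one.\<close>

lemma same_cube_mono:
  assumes "same_cube k x u" "k \<le> j"
  shows "same_cube j x u"
  unfolding same_cube_def
proof
  fix b :: 'a assume b: "b \<in> Basis"
  obtain m where m: "j = k + int m" using assms(2) zle_iff_zadd by blast
  have *: "\<lfloor>y / 2 powi j\<rfloor> = \<lfloor>y / 2 powi k\<rfloor> div (2 ^ m)" for y :: real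
  proof -
    have "y / 2 powi j = (y / 2 powi k) / real_of_int (2 ^ m)"
      by (simp add: m power_int_add)
    also have "\<lfloor>\<dots>\<rfloor> = \<lfloor>y / 2 powi k\<rfloor> div (2 ^ m)"
      by (rule floor_divide_real_eq_div) simp
    finally show ?thesis .
  qed
  show "\<lfloor>x \<bullet> b / 2 powi j\<rfloor> = \<lfloor>u \<bullet> b / 2 powi j\<rfloor>"
    using assms(1) b by (simp add: * same_cube_def)
qed

lemma same_cube_measurable [measurable]:
  "Measurable.pred (borel \<Otimes>\<^sub>M borel) (\<lambda>p. same_cube k (fst p) (snd p :: 'a::euclidean_space))"
  unfolding same_cube_def
  by (intro pred_intros_finite finite_Basis) measurable

lemma same_cube_borel [measurable]:
  assumes [measurable]: "f \<in> borel_measurable M" "g \<in> borel_measurable M"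
  shows "Measurable.pred M (\<lambda>x. same_cube k (f x) (g x :: 'a::euclidean_space))"
proof -
  have "(\<lambda>x. (f x, g x)) \<in> M \<rightarrow>\<^sub>M borel \<Otimes>\<^sub>M borel" by measurable
  from measurable_compose[OF this same_cube_measurable] show ?thesis by simp
qed

text \<open>The diameter is estimated through the sum norm, with \<open>n\<close> in place of its
  square root. This \<open>n\<close> is the one that appears later in the width of the
  annulus.\<close>

lemma norm_same_cube_le:
  fixes x u :: "'a::euclidean_space"
  assumes "same_cube k x u"
  shows "norm (x - u) \<le> DIM('a) * 2 powi k"
proof -
  let ?r = "2 powi k :: real"
  have "norm (x - u) \<le> (\<Sum>b\<in>Basis. \<bar>(x - u) \<bullet> b\<bar>)" by (rule norm_le_l1)
  also have "\<dots> \<le> (\<Sum>b\<in>(Basis::'a set). ?r)"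
  proof (rule sum_mono)
    fix b :: 'a assume "b \<in> Basis"
    then have "\<lfloor>(x \<bullet> b) / ?r\<rfloor> = \<lfloor>(u \<bullet> b) / ?r\<rfloor>" using assms by (simp add: same_cube_def)
    then have "\<bar>(x \<bullet> b) / ?r - (u \<bullet> b) / ?r\<bar> \<le> 1" by linarith
    then have "\<bar>(x - u) \<bullet> b\<bar> / ?r \<le> 1" by (simp add: inner_diff_left abs_divide flip: diff_divide_distrib)
    then show "\<bar>(x - u) \<bullet> b\<bar> \<le> ?r" by simp
  qed
  also have "\<dots> = DIM('a) * ?r" by simp
  finally show ?thesis .
qed

lemma emeasure_cube:
  fixes x :: "'a::euclidean_space"
  shows "emeasure lborel {u. same_cube k x u} = ennreal ((2 powi k) ^ DIM('a))"
proof -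
  let ?r = "2 powi k :: real"
  define l :: 'a where "l = (\<Sum>b\<in>Basis. (of_int \<lfloor>(x \<bullet> b) / ?r\<rfloor> * ?r) *\<^sub>R b)"
  define h :: 'a where "h = (\<Sum>b\<in>Basis. (of_int \<lfloor>(x \<bullet> b) / ?r\<rfloor> * ?r + ?r) *\<^sub>R b)"
  have l: "l \<bullet> b = of_int \<lfloor>(x \<bullet> b) / ?r\<rfloor> * ?r" and h: "h \<bullet> b = of_int \<lfloor>(x \<bullet> b) / ?r\<rfloor> * ?r + ?r"
    if "b \<in> Basis" for b
    using that by (simp_all add: l_def h_def)
  have eq: "\<lfloor>y / ?r\<rfloor> = m \<longleftrightarrow> of_int m * ?r \<le> y \<and> y < of_int m * ?r + ?r" for y m
    by (simp add: floor_eq_iff pos_le_divide_eq pos_divide_less_eq distrib_right)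
  have same: "same_cube k x u \<longleftrightarrow> (\<forall>b\<in>Basis. l \<bullet> b \<le> u \<bullet> b \<and> u \<bullet> b < h \<bullet> b)" for u
    unfolding same_cube_def
  proof (rule ball_cong[OF refl])
    fix b :: 'a assume b: "b \<in> Basis"
    show "(\<lfloor>x \<bullet> b / ?r\<rfloor> = \<lfloor>u \<bullet> b / ?r\<rfloor>) \<longleftrightarrow> (l \<bullet> b \<le> u \<bullet> b \<and> u \<bullet> b < h \<bullet> b)"
      unfolding l[OF b] h[OF b] by (subst eq_commute) (rule eq)
  qed
  have "box l h \<subseteq> {u. same_cube k x u}" "{u. same_cube k x u} \<subseteq> cbox l h"
    by (auto simp: same mem_box less_imp_le)
  then have "emeasure lborel (box l h) \<le> emeasure lborel {u. same_cube k x u}"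
    "emeasure lborel {u. same_cube k x u} \<le> emeasure lborel (cbox l h)"
    by (auto intro!: emeasure_mono)
  moreover have "(\<Prod>b\<in>Basis. (h - l) \<bullet> b) = ?r ^ DIM('a)"
    by (simp add: inner_diff_left l h)
  moreover have "l \<bullet> b \<le> h \<bullet> b" if "b \<in> Basis" for b
    using that by (simp add: l h less_imp_le)
  ultimately show ?thesis
    by (intro antisym) (simp_all add: emeasure_lborel_box emeasure_lborel_cbox)
qed

lemma measure_cube: "measure lborel {u::'a::euclidean_space. same_cube k x u} = (2 powi k) ^ DIM('a)"
  by (simp add: measure_def emeasure_cube)

section \<open>Averaging over cubes as an orthogonal projection\<close>

abbreviation cube_ind :: "int \<Rightarrow> 'a::euclidean_space \<Rightarrow> 'a \<Rightarrow> real" where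
  "cube_ind k x u \<equiv> indicator {u. same_cube k x u} u"

lemma sqint_cube_ind: "sqint (cube_ind k (x::'a::euclidean_space))"
  by (rule sqint_indicator) (simp_all add: emeasure_cube)

text \<open>The averages \<open>E_k\<close> of the overview, written as an integral with a symmetric
  kernel and not as an abstract conditional expectation, so that self-adjointness is an instance of
  Fubini's theorem.\<close>

definition cube_avg :: "int \<Rightarrow> ('a::euclidean_space \<Rightarrow> real) \<Rightarrow> 'a \<Rightarrow> real" where
  "cube_avg k f x = (\<integral>u. cube_ind k x u * f u \<partial>lborel) / (2 powi k) ^ DIM('a)"

lemma integrable_cube_mult: "sqint f \<Longrightarrow> integrable lborel (\<lambda>u. cube_ind k x u * f u)"
  by (intro sqint_mult sqint_cube_ind)

lemma cube_avg_diff: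
  assumes "sqint f" "sqint g"
  shows "cube_avg k (\<lambda>x. f x - g x) x = cube_avg k f x - cube_avg k g x"
  unfolding cube_avg_def
  using integrable_cube_mult[OF assms(1), of k x] integrable_cube_mult[OF assms(2), of k x]
  by (simp add: right_diff_distrib diff_divide_distrib)

lemma cube_avg_const:
  assumes "\<And>w. same_cube k u w \<Longrightarrow> g w = g u"
  shows "cube_avg k g u = g (u::'a::euclidean_space)"
proof -
  have "(\<integral>w. cube_ind k u w * g w \<partial>lborel) = (\<integral>w. g u * cube_ind k u w \<partial>lborel)"
  proof (intro Bochner_Integration.integral_cong refl)
    fix w
    show "cube_ind k u w * g w = g u * cube_ind k u w"
      by (cases "same_cube k u w") (simp_all add: assms[of w])
  qed
  then show ?thesis by (simp add: cube_avg_def measure_cube)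
qed

lemma cube_avg_measurable [measurable]:
  assumes [measurable]: "f \<in> borel_measurable borel"
  shows "cube_avg k f \<in> borel_measurable borel"
proof -
  have "(\<lambda>x. \<integral>u. (if same_cube k x u then 1 else 0) * f u \<partial>lborel) \<in> borel_measurable borel"
    by measurable
  then show ?thesis
    unfolding cube_avg_def[abs_def] by (simp add: indicator_def of_bool_def)
qed

text \<open>Jensen's inequality, read off from the nonnegativity of the variance of \<open>f\<close>
  on the cube.\<close>

lemma cube_avg_square_le:
  fixes x :: "'a::euclidean_space"
  assumes f: "sqint f"
  shows "(cube_avg k f x)\<^sup>2 \<le> (\<integral>u. cube_ind k x u * (f u)\<^sup>2 \<partial>lborel) / (2 powi k) ^ DIM('a)"
proof -
  let ?c = "(2 powi k) ^ DIM('a) :: real" and ?m = "cube_avg k f x"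
  have c: "?c > 0" by simp
  have i1: "integrable lborel (\<lambda>u. cube_ind k x u * f u)" by (rule integrable_cube_mult[OF f])
  have i2: "integrable lborel (\<lambda>u. cube_ind k x u * (f u)\<^sup>2)"
    using integrable_mult_indicator[OF _ sqint_square[OF f], of "{u. same_cube k x u}"] by simp
  have i3: "integrable lborel (cube_ind k x)"
    by (simp add: integrable_indicator_iff emeasure_cube)
  have "0 \<le> (\<integral>u. cube_ind k x u * (f u - ?m)\<^sup>2 \<partial>lborel)"
    by (intro integral_nonneg_AE AE_I2) simp
  also have "\<dots> = (\<integral>u. cube_ind k x u * (f u)\<^sup>2 - 2 * ?m * (cube_ind k x u * f u) + ?m\<^sup>2 * cube_ind k x u \<partial>lborel)"
    by (intro Bochner_Integration.integral_cong) (simp_all add: power2_diff algebra_simps)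
  also have "\<dots> = (\<integral>u. cube_ind k x u * (f u)\<^sup>2 \<partial>lborel) - 2 * ?m * (\<integral>u. cube_ind k x u * f u \<partial>lborel) + ?m\<^sup>2 * ?c"
    using i1 i2 i3 by (simp add: measure_cube)
  also have "(\<integral>u. cube_ind k x u * f u \<partial>lborel) = ?m * ?c"
    using c by (simp add: cube_avg_def)
  finally have "?m\<^sup>2 * ?c \<le> (\<integral>u. cube_ind k x u * (f u)\<^sup>2 \<partial>lborel)"
    by (simp add: power2_eq_square algebra_simps)
  then show ?thesis using c by (simp add: pos_le_divide_eq)
qed

text \<open>By symmetry of the kernel each \<open>u\<close> is counted for all \<open>x\<close> in
  its own cube, a set of volume \<open>(2 powi k) ^ n\<close>.\<close>

lemma nn_integral_cube_avg_kernel: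
  fixes F :: "'a::euclidean_space \<Rightarrow> ennreal"
  assumes [measurable]: "F \<in> borel_measurable borel"
  shows "(\<integral>\<^sup>+x. \<integral>\<^sup>+u. ennreal (cube_ind k x u) * F u \<partial>lborel \<partial>lborel) =
    ennreal ((2 powi k) ^ DIM('a)) * (\<integral>\<^sup>+u. F u \<partial>lborel)"
proof -
  have "(\<integral>\<^sup>+x. \<integral>\<^sup>+u. ennreal (cube_ind k x u) * F u \<partial>lborel \<partial>lborel) =
     (\<integral>\<^sup>+x. \<integral>\<^sup>+u. (if same_cube k x u then 1 else 0) * F u \<partial>lborel \<partial>lborel)"
    by (intro nn_integral_cong) (simp add: indicator_def)
  also have "\<dots> = (\<integral>\<^sup>+u. \<integral>\<^sup>+x. (if same_cube k x u then 1 else 0) * F u \<partial>lborel \<partial>lborel)"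
    by (rule lborel_pair.Fubini'[symmetric]) measurable
  also have "\<dots> = (\<integral>\<^sup>+u. \<integral>\<^sup>+x. F u * indicator {x. same_cube k u x} x \<partial>lborel \<partial>lborel)"
    by (intro nn_integral_cong) (simp add: indicator_def same_cube_sym)
  also have "\<dots> = (\<integral>\<^sup>+u. F u * ennreal ((2 powi k) ^ DIM('a)) \<partial>lborel)"
    by (intro nn_integral_cong) (simp add: nn_integral_cmult_indicator emeasure_cube)
  also have "\<dots> = ennreal ((2 powi k) ^ DIM('a)) * (\<integral>\<^sup>+u. F u \<partial>lborel)"
    by (simp add: nn_integral_multc mult.commute)
  finally show ?thesis .
qed

lemma sqint_cube_avg:
  fixes f :: "'a::euclidean_space \<Rightarrow> real"
  assumes f: "sqint f"
  shows "sqint (cube_avg k f)"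
  unfolding sqint_def
proof
  note [measurable] = sqint_measurable[OF f]
  show "cube_avg k f \<in> borel_measurable borel" by measurable
  let ?c = "(2 powi k) ^ DIM('a) :: real"
  have i2: "integrable lborel (\<lambda>u. cube_ind k x u * (f u)\<^sup>2)" for x
    using integrable_mult_indicator[OF _ sqint_square[OF f], of "{u. same_cube k x u}"] by simp
  have "(\<integral>\<^sup>+x. ennreal ((cube_avg k f x)\<^sup>2) \<partial>lborel) \<le> (\<integral>\<^sup>+x. ennreal (1 / ?c) * (\<integral>\<^sup>+u. ennreal (cube_ind k x u) * ennreal ((f u)\<^sup>2) \<partial>lborel) \<partial>lborel)"
  proof (rule nn_integral_mono)
    fix x
    have "ennreal ((cube_avg k f x)\<^sup>2) \<le> ennreal ((1 / ?c) * (\<integral>u. cube_ind k x u * (f u)\<^sup>2 \<partial>lborel))"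
      using cube_avg_square_le[OF f, of k x] by (intro ennreal_leI) simp
    also have "\<dots> = ennreal (1 / ?c) * ennreal (\<integral>u. cube_ind k x u * (f u)\<^sup>2 \<partial>lborel)"
      by (rule ennreal_mult') simp
    also have "ennreal (\<integral>u. cube_ind k x u * (f u)\<^sup>2 \<partial>lborel) = (\<integral>\<^sup>+u. ennreal (cube_ind k x u * (f u)\<^sup>2) \<partial>lborel)"
      by (rule nn_integral_eq_integral[OF i2, symmetric]) simp
    finally show "ennreal ((cube_avg k f x)\<^sup>2) \<le> ennreal (1 / ?c) * (\<integral>\<^sup>+u. ennreal (cube_ind k x u) * ennreal ((f u)\<^sup>2) \<partial>lborel)"
      by (simp add: ennreal_mult')
  qed
  also have "\<dots> = ennreal (1 / ?c) * (\<integral>\<^sup>+x. \<integral>\<^sup>+u. ennreal (cube_ind k x u) * ennreal ((f u)\<^sup>2) \<partial>lborel \<partial>lborel)"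
  proof (rule nn_integral_cmult)
    have "(\<lambda>x. \<integral>\<^sup>+u. (if same_cube k x u then 1 else 0) * ennreal ((f u)\<^sup>2) \<partial>lborel) \<in> borel_measurable borel"
      by measurable
    also have "(\<lambda>x. \<integral>\<^sup>+u. (if same_cube k x u then 1 else 0) * ennreal ((f u)\<^sup>2) \<partial>lborel) =
        (\<lambda>x. \<integral>\<^sup>+u. ennreal (cube_ind k x u) * ennreal ((f u)\<^sup>2) \<partial>lborel)"
      by (intro ext nn_integral_cong) (simp add: indicator_def)
    finally show "(\<lambda>x. \<integral>\<^sup>+u. ennreal (cube_ind k x u) * ennreal ((f u)\<^sup>2) \<partial>lborel) \<in> borel_measurable lborel"
      by simp
  qed
  also have "\<dots> = ennreal (1 / ?c) * (ennreal ?c * (\<integral>\<^sup>+u. ennreal ((f u)\<^sup>2) \<partial>lborel))"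
    by (subst nn_integral_cube_avg_kernel) simp_all
  also have "\<dots> < \<infinity>"
    using sqint_square[OF f] by (auto simp: integrable_iff_bounded ennreal_mult_less_top)
  finally show "integrable lborel (\<lambda>x. (cube_avg k f x)\<^sup>2)"
    by (auto simp: integrable_iff_bounded)
qed

text \<open>Self-adjointness, from the symmetry of the kernel. Fubini's theorem applies because on
  pairs in a common cube the product \<open>f x * g u\<close> is dominated by
  \<open>(f x)\<^sup>2 + (g u)\<^sup>2\<close>, and each square integrates over these pairs to a
  cube volume times a squared norm.\<close>

lemma integral_mult_cube_avg:
  fixes f g :: "'a::euclidean_space \<Rightarrow> real"
  assumes f: "sqint f" and g: "sqint g"
  shows "(\<integral>x. f x * cube_avg k g x \<partial>lborel) = (\<integral>x. cube_avg k f x * g x \<partial>lborel)"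
proof -
  note [measurable] = sqint_measurable[OF f] sqint_measurable[OF g]
  let ?c = "(2 powi k) ^ DIM('a) :: real"
  let ?i = "\<lambda>x u. if same_cube k x u then 1 else 0 :: real"
  have ci: "cube_ind k x u = ?i x u" for x u :: 'a by (simp add: indicator_def)
  have fin: "(\<integral>\<^sup>+x. ennreal ((h x)\<^sup>2) \<partial>lborel) < \<infinity>" if "sqint h" for h :: "'a \<Rightarrow> real"
    using sqint_square[OF that] by (auto simp: integrable_iff_bounded)
  have int: "integrable (lborel \<Otimes>\<^sub>M lborel) (\<lambda>(x, u). ?i x u * (f x * g u))"
  proof (rule integrableI_bounded)
    show "(\<lambda>(x, u). ?i x u * (f x * g u)) \<in> borel_measurable (lborel \<Otimes>\<^sub>M lborel)" by measurable
    have "(\<integral>\<^sup>+p. ennreal (norm (case p of (x, u) \<Rightarrow> ?i x u * (f x * g u))) \<partial>(lborel \<Otimes>\<^sub>M lborel)) =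
       (\<integral>\<^sup>+x. \<integral>\<^sup>+u. ennreal (norm (?i x u * (f x * g u))) \<partial>lborel \<partial>lborel)"
      by (subst lborel.nn_integral_fst[symmetric]) simp_all
    also have "\<dots> \<le> (\<integral>\<^sup>+x. \<integral>\<^sup>+u. ennreal (?i x u) * ennreal ((f x)\<^sup>2) + ennreal (?i x u) * ennreal ((g u)\<^sup>2) \<partial>lborel \<partial>lborel)"
    proof (rule nn_integral_mono, rule nn_integral_mono)
      fix x u
      have "\<bar>f x * g u\<bar> \<le> (f x)\<^sup>2 + (g u)\<^sup>2"
        by (rule order_trans[OF abs_mult_le_half_squares]) simp
      then show "ennreal (norm (?i x u * (f x * g u))) \<le> ennreal (?i x u) * ennreal ((f x)\<^sup>2) + ennreal (?i x u) * ennreal ((g u)\<^sup>2)"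
        by (simp flip: ennreal_plus)
    qed
    also have "\<dots> = (\<integral>\<^sup>+x. \<integral>\<^sup>+u. ennreal (?i x u) * ennreal ((f x)\<^sup>2) \<partial>lborel \<partial>lborel) +
        (\<integral>\<^sup>+x. \<integral>\<^sup>+u. ennreal (?i x u) * ennreal ((g u)\<^sup>2) \<partial>lborel \<partial>lborel)"
      by (simp add: nn_integral_add)
    also have "(\<integral>\<^sup>+x. \<integral>\<^sup>+u. ennreal (?i x u) * ennreal ((g u)\<^sup>2) \<partial>lborel \<partial>lborel) = ennreal ?c * (\<integral>\<^sup>+x. ennreal ((g x)\<^sup>2) \<partial>lborel)"
      using nn_integral_cube_avg_kernel[of "\<lambda>u. ennreal ((g u)\<^sup>2)" k] by (simp add: ci)
    also have "(\<integral>\<^sup>+x. \<integral>\<^sup>+u. ennreal (?i x u) * ennreal ((f x)\<^sup>2) \<partial>lborel \<partial>lborel) =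
        (\<integral>\<^sup>+u. \<integral>\<^sup>+x. ennreal (?i x u) * ennreal ((f x)\<^sup>2) \<partial>lborel \<partial>lborel)"
      by (rule lborel_pair.Fubini'[symmetric]) measurable
    also have "\<dots> = (\<integral>\<^sup>+u. \<integral>\<^sup>+x. ennreal (cube_ind k u x) * ennreal ((f x)\<^sup>2) \<partial>lborel \<partial>lborel)"
      by (simp add: ci same_cube_sym)
    also have "\<dots> = ennreal ?c * (\<integral>\<^sup>+x. ennreal ((f x)\<^sup>2) \<partial>lborel)"
      by (rule nn_integral_cube_avg_kernel) measurable
    also have "\<dots> + ennreal ?c * (\<integral>\<^sup>+x. ennreal ((g x)\<^sup>2) \<partial>lborel) < \<infinity>"
      using fin[OF f] fin[OF g] by (simp add: ennreal_mult_less_top)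
    finally show "(\<integral>\<^sup>+p. ennreal (norm (case p of (x, u) \<Rightarrow> ?i x u * (f x * g u))) \<partial>(lborel \<Otimes>\<^sub>M lborel)) < \<infinity>" .
  qed
  have l: "(\<integral>u. ?i x u * (f x * g u) \<partial>lborel) = f x * (\<integral>u. ?i x u * g u \<partial>lborel)" for x
    by (subst integral_mult_right_zero[symmetric]) (simp only: mult.left_commute)
  have r: "(\<integral>x. ?i x u * (f x * g u) \<partial>lborel) = (\<integral>x. ?i u x * f x \<partial>lborel) * g u" for u
    by (subst integral_mult_left_zero[symmetric]) (simp only: mult.assoc same_cube_sym)
  have "(\<integral>x. f x * cube_avg k g x \<partial>lborel) = (\<integral>x. (\<integral>u. ?i x u * (f x * g u) \<partial>lborel) / ?c \<partial>lborel)"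
    unfolding cube_avg_def ci l by simp
  also have "\<dots> = (\<integral>x. (\<integral>u. ?i x u * (f x * g u) \<partial>lborel) \<partial>lborel) / ?c" by simp
  also have "(\<integral>x. (\<integral>u. ?i x u * (f x * g u) \<partial>lborel) \<partial>lborel) = (\<integral>u. (\<integral>x. ?i x u * (f x * g u) \<partial>lborel) \<partial>lborel)"
    by (rule lborel_pair.Fubini_integral[OF int, symmetric])
  also have "\<dots> / ?c = (\<integral>u. (\<integral>x. ?i x u * (f x * g u) \<partial>lborel) / ?c \<partial>lborel)" by simp
  also have "\<dots> = (\<integral>x. cube_avg k f x * g x \<partial>lborel)"
    unfolding cube_avg_def ci r by simp
  finally show ?thesis .
qed

text \<open>The indicator of the coarse cube is constant on fine cubes and so is fixed by the fine
  average; self-adjointness moves the fine average from \<open>f\<close> to this indicator.\<close>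

lemma cube_avg_cube_avg:
  assumes f: "sqint f" and "k \<le> j"
  shows "cube_avg j (cube_avg k f) x = cube_avg j f (x::'a::euclidean_space)"
proof -
  have "cube_avg k (cube_ind j x) u = cube_ind j x u" for u
  proof (rule cube_avg_const)
    fix w assume "same_cube k u w"
    then have "same_cube j u w" using \<open>k \<le> j\<close> by (rule same_cube_mono)
    then show "cube_ind j x w = cube_ind j x u"
      by (auto simp: indicator_def intro: same_cube_trans same_cube_sym[THEN iffD1])
  qed
  then show ?thesis
    unfolding cube_avg_def[of j] integral_mult_cube_avg[OF sqint_cube_ind f] by simp
qed

lemma integral_cube_avg_mult:
  fixes f :: "'a::euclidean_space \<Rightarrow> real"
  assumes f: "sqint f" and "k \<le> j"
  shows "(\<integral>x. cube_avg j f x * cube_avg k f x \<partial>lborel) = (\<integral>x. (cube_avg j f x)\<^sup>2 \<partial>lborel)"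
proof -
  have *: "(\<integral>x. cube_avg j f x * cube_avg i f x \<partial>lborel) = (\<integral>x. f x * cube_avg j f x \<partial>lborel)" if "i \<le> j" for i
    using integral_mult_cube_avg[OF f sqint_cube_avg[OF f, of i], of j] cube_avg_cube_avg[OF f that] by simp
  show ?thesis using *[OF \<open>k \<le> j\<close>] *[of j] by (simp add: power2_eq_square)
qed

text \<open>Pythagoras for nested projections. The squared norm of a martingale difference becomes a
  difference of two energies, which telescopes when it is summed over scales.\<close>

lemma integral_cube_avg_diff_square:
  fixes f :: "'a::euclidean_space \<Rightarrow> real"
  assumes f: "sqint f" and "k \<le> j"
  shows "(\<integral>x. (cube_avg k f x - cube_avg j f x)\<^sup>2 \<partial>lborel) =
    (\<integral>x. (cube_avg k f x)\<^sup>2 \<partial>lborel) - (\<integral>x. (cube_avg j f x)\<^sup>2 \<partial>lborel)"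
proof -
  have "(\<integral>x. (cube_avg k f x - cube_avg j f x)\<^sup>2 \<partial>lborel) =
     (\<integral>x. (cube_avg k f x)\<^sup>2 - 2 * (cube_avg j f x * cube_avg k f x) + (cube_avg j f x)\<^sup>2 \<partial>lborel)"
    by (simp add: power2_diff algebra_simps)
  also have "\<dots> = (\<integral>x. (cube_avg k f x)\<^sup>2 \<partial>lborel) - 2 * (\<integral>x. cube_avg j f x * cube_avg k f x \<partial>lborel) + (\<integral>x. (cube_avg j f x)\<^sup>2 \<partial>lborel)"
    using sqint_cube_avg[OF f, of k] sqint_cube_avg[OF f, of j]
      sqint_mult[OF sqint_cube_avg[OF f, of j] sqint_cube_avg[OF f, of k]]
    by (simp add: sqint_square)
  also have "\<dots> = (\<integral>x. (cube_avg k f x)\<^sup>2 \<partial>lborel) - (\<integral>x. (cube_avg j f x)\<^sup>2 \<partial>lborel)"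
    by (simp add: integral_cube_avg_mult[OF assms])
  finally show ?thesis .
qed

lemma integral_diff_cube_avg_square:
  fixes f :: "'a::euclidean_space \<Rightarrow> real"
  assumes f: "sqint f"
  shows "(\<integral>x. (f x - cube_avg j f x)\<^sup>2 \<partial>lborel) = (\<integral>x. (f x)\<^sup>2 \<partial>lborel) - (\<integral>x. (cube_avg j f x)\<^sup>2 \<partial>lborel)"
proof -
  have "(\<integral>x. (f x - cube_avg j f x)\<^sup>2 \<partial>lborel) =
     (\<integral>x. (f x)\<^sup>2 - 2 * (f x * cube_avg j f x) + (cube_avg j f x)\<^sup>2 \<partial>lborel)"
    by (simp add: power2_diff algebra_simps)
  also have "\<dots> = (\<integral>x. (f x)\<^sup>2 \<partial>lborel) - 2 * (\<integral>x. f x * cube_avg j f x \<partial>lborel) + (\<integral>x. (cube_avg j f x)\<^sup>2 \<partial>lborel)"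
    using f sqint_cube_avg[OF f, of j] sqint_mult[OF f sqint_cube_avg[OF f, of j]]
    by (simp add: sqint_square)
  also have "(\<integral>x. f x * cube_avg j f x \<partial>lborel) = (\<integral>x. (cube_avg j f x)\<^sup>2 \<partial>lborel)"
    using integral_mult_cube_avg[OF f sqint_cube_avg[OF f, of j], of j] cube_avg_cube_avg[OF f, of j j]
    by (simp add: power2_eq_square)
  finally show ?thesis by simp
qed

text \<open>The cube around a point at distance at most \<open>2 powi k\<close> from
  \<open>x\<close> lies within \<open>n + 1\<close> side lengths of \<open>x\<close>. Because
  \<open>hl_max\<close> has dyadic radii, \<open>n + 1\<close> is rounded up to
  \<open>2 ^ (n + 1)\<close>; the constant is the ratio of the volumes of this ball and the
  cube.\<close>

lemma cube_avg_le_hl_max: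
  fixes f :: "'a::euclidean_space \<Rightarrow> real"
  assumes f: "sqint f" and y: "norm y \<le> 1"
  shows "ennreal \<bar>cube_avg k f (x - 2 powi k *\<^sub>R y)\<bar> \<le>
    ennreal (unit_ball_vol DIM('a) * (2 ^ (DIM('a) + 1)) ^ DIM('a)) * hl_max (\<lambda>u. ennreal \<bar>f u\<bar>) x"
proof -
  let ?n = "DIM('a)" and ?r = "2 powi k :: real" and ?z = "x - 2 powi k *\<^sub>R y"
  note [measurable] = sqint_measurable[OF f]
  define R where "R = (2 powi (k + int (?n + 1)) :: real)"
  have R: "R = ?r * 2 ^ (?n + 1)" unfolding R_def by (subst power_int_add) (simp_all only: power_int_of_nat, simp)
  have R0: "R > 0" by (simp add: R_def)
  have sub: "u \<in> ball x R" if "same_cube k ?z u" for u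
  proof -
    have "norm (x - u) \<le> norm (x - ?z) + norm (?z - u)"
      using norm_triangle_ineq[of "x - ?z" "?z - u"] by simp
    also have "\<dots> \<le> ?r * 1 + ?n * ?r"
      using norm_same_cube_le[OF that] y by (intro add_mono) (simp_all add: mult_left_le)
    also have "\<dots> = ?r * real (?n + 1)" by (simp add: algebra_simps)
    also have "\<dots> < ?r * 2 ^ (?n + 1)"
      using of_nat_less_two_power[of "?n + 1", where 'a=real] by (intro mult_strict_left_mono) auto
    finally show ?thesis by (simp add: R dist_norm)
  qed
  let ?I = "\<integral>\<^sup>+u. ennreal \<bar>f u\<bar> * indicator (ball x R) u \<partial>lborel"
  have "ennreal \<bar>cube_avg k f ?z\<bar> = ennreal \<bar>\<integral>u. cube_ind k ?z u * f u \<partial>lborel\<bar> / ennreal (?r ^ ?n)"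
    by (simp add: cube_avg_def abs_divide divide_ennreal)
  also have "\<dots> \<le> ?I / ennreal (?r ^ ?n)"
  proof (rule divide_right_mono_ennreal)
    have "ennreal \<bar>\<integral>u. cube_ind k ?z u * f u \<partial>lborel\<bar> \<le> (\<integral>\<^sup>+u. ennreal (norm (cube_ind k ?z u * f u)) \<partial>lborel)"
      using integral_norm_bound_ennreal[OF integrable_cube_mult[OF f, of k ?z]] by simp
    also have "\<dots> \<le> ?I"
      using sub by (intro nn_integral_mono) (auto simp: indicator_def)
    finally show "ennreal \<bar>\<integral>u. cube_ind k ?z u * f u \<partial>lborel\<bar> \<le> ?I" .
  qed
  also have "\<dots> = ennreal (unit_ball_vol ?n * (2 ^ (?n + 1)) ^ ?n) * (?I / emeasure lborel (ball (0::'a) R))"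
  proof -
    have e: "emeasure lborel (ball (0::'a) R) = ennreal (unit_ball_vol ?n * (2 ^ (?n + 1)) ^ ?n) * ennreal (?r ^ ?n)"
      using R0 by (simp add: emeasure_ball R power_mult_distrib mult_ac flip: ennreal_mult)
    let ?K = "ennreal (unit_ball_vol ?n * (2 ^ (?n + 1)) ^ ?n)"
    have K: "?K \<noteq> 0" "?K \<noteq> top" by (simp_all add: ennreal_eq_0_iff not_le)
    have "?K * (?I / (?K * ennreal (?r ^ ?n))) = (?I * ?K) / (ennreal (?r ^ ?n) * ?K)"
      by (simp only: ennreal_times_divide mult.commute)
    also have "\<dots> = ?I / ennreal (?r ^ ?n)"
      using K by (intro divide_mult_eq) auto
    finally show ?thesis unfolding e ..
  qed
  also have "\<dots> \<le> ennreal (unit_ball_vol ?n * (2 ^ (?n + 1)) ^ ?n) * hl_max (\<lambda>u. ennreal \<bar>f u\<bar>) x"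
    unfolding hl_max_def R_def by (intro mult_left_mono SUP_upper) auto
  finally show ?thesis .
qed

section \<open>Square functions of spherical means\<close>

lemma nn_integral_chord_polar:
  fixes F :: "'a::euclidean_space \<Rightarrow> ennreal"
  assumes [measurable]: "F \<in> borel_measurable borel"
  shows "(\<integral>\<^sup>+v. F v \<partial>chord) = (\<integral>\<^sup>+v. \<integral>\<^sup>+\<theta>. F (norm v *\<^sub>R \<theta>) \<partial>usph \<partial>(chord :: 'a measure))"
proof -
  have "(\<integral>\<^sup>+v. F v \<partial>chord) = (\<integral>\<^sup>+v. F v \<partial>distr (chord \<Otimes>\<^sub>M usph) borel (\<lambda>(v::'a, \<theta>::'a). norm v *\<^sub>R \<theta>))"
    by (simp only: chord_polar)
  also have "\<dots> = (\<integral>\<^sup>+p. F (case p of (v::'a, \<theta>::'a) \<Rightarrow> norm v *\<^sub>R \<theta>) \<partial>(chord \<Otimes>\<^sub>M usph))"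
    by (rule nn_integral_distr) measurable
  also have "\<dots> = (\<integral>\<^sup>+v. \<integral>\<^sup>+\<theta>. F (norm v *\<^sub>R \<theta>) \<partial>usph \<partial>(chord :: 'a measure))"
    by (subst usph.nn_integral_fst[symmetric]) simp_all
  finally show ?thesis .
qed

interpretation chord: prob_space chord
  by (rule prob_space_chord)

text \<open>Given its length, a chord has uniform direction, so the left-hand side evaluates
  \<open>F\<close> at \<open>t * norm y * norm v\<close> times a uniform direction, an expression
  symmetric in radius and chord length. Attaching the direction to \<open>y\<close> instead of the
  chord turns chords of spheres of radius \<open>t * norm y\<close> into points of the solid ball of
  radius \<open>t * norm v\<close>.\<close>

lemma nn_integral_ball_chord:
  fixes F :: "'a::euclidean_space \<Rightarrow> ennreal"
  assumes [measurable]: "F \<in> borel_measurable borel"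
  shows "(\<integral>\<^sup>+y. indicator (ball 0 1) y * (\<integral>\<^sup>+v. F ((t * norm y) *\<^sub>R v) \<partial>chord) \<partial>(lborel :: 'a measure)) =
    (\<integral>\<^sup>+v. \<integral>\<^sup>+y. indicator (ball 0 1) y * F ((t * norm v) *\<^sub>R y) \<partial>lborel \<partial>(chord :: 'a measure))"
proof -
  interpret P1: pair_sigma_finite "lborel :: 'a measure" "chord :: 'a measure" ..
  have "(\<integral>\<^sup>+y. indicator (ball 0 1) y * (\<integral>\<^sup>+v. F ((t * norm y) *\<^sub>R v) \<partial>chord) \<partial>(lborel :: 'a measure)) =
     (\<integral>\<^sup>+y. indicator (ball 0 1) y * (\<integral>\<^sup>+v. \<integral>\<^sup>+\<theta>. F ((t * norm y) *\<^sub>R norm v *\<^sub>R \<theta>) \<partial>usph \<partial>(chord :: 'a measure)) \<partial>(lborel :: 'a measure))"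
    by (subst nn_integral_chord_polar) simp_all
  also have "\<dots> = (\<integral>\<^sup>+y. \<integral>\<^sup>+v. \<integral>\<^sup>+\<theta>. indicator {..<1} (norm y) * F ((t * norm v) *\<^sub>R norm y *\<^sub>R \<theta>) \<partial>usph \<partial>(chord :: 'a measure) \<partial>(lborel :: 'a measure))"
  proof (rule nn_integral_cong)
    fix y :: 'a
    have "indicator (ball 0 1) y = (indicator {..<1} (norm y) :: ennreal)" by (simp add: indicator_def)
    then show "indicator (ball 0 1) y * (\<integral>\<^sup>+v. \<integral>\<^sup>+\<theta>. F ((t * norm y) *\<^sub>R norm v *\<^sub>R \<theta>) \<partial>usph \<partial>(chord :: 'a measure)) =
       (\<integral>\<^sup>+v. \<integral>\<^sup>+\<theta>. indicator {..<1} (norm y) * F ((t * norm v) *\<^sub>R norm y *\<^sub>R \<theta>) \<partial>usph \<partial>(chord :: 'a measure))"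
      by (simp add: nn_integral_cmult mult_ac)
  qed
  also have "\<dots> = (\<integral>\<^sup>+v. \<integral>\<^sup>+y. \<integral>\<^sup>+\<theta>. indicator {..<1} (norm y) * F ((t * norm v) *\<^sub>R norm y *\<^sub>R \<theta>) \<partial>usph \<partial>(lborel :: 'a measure) \<partial>(chord :: 'a measure))"
    by (rule P1.Fubini'[symmetric]) measurable
  also have "\<dots> = (\<integral>\<^sup>+v. \<integral>\<^sup>+y. indicator (ball 0 1) y * F ((t * norm v) *\<^sub>R y) \<partial>lborel \<partial>(chord :: 'a measure))"
  proof (rule nn_integral_cong)
    fix v :: 'a
    have "(\<integral>\<^sup>+y. indicator (ball 0 1) y * F ((t * norm v) *\<^sub>R y) \<partial>lborel) =
       (\<integral>\<^sup>+y. \<integral>\<^sup>+\<theta>. indicator (ball 0 1) (norm y *\<^sub>R \<theta>) * F ((t * norm v) *\<^sub>R norm y *\<^sub>R \<theta>) \<partial>usph \<partial>(lborel :: 'a measure))"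
      by (rule nn_integral_polar) measurable
    also have "\<dots> = (\<integral>\<^sup>+y. \<integral>\<^sup>+\<theta>. indicator {..<1} (norm y) * F ((t * norm v) *\<^sub>R norm y *\<^sub>R \<theta>) \<partial>usph \<partial>(lborel :: 'a measure))"
    proof (rule nn_integral_cong, rule nn_integral_cong_AE)
      fix y :: 'a
      show "AE \<theta> in usph. indicator (ball 0 1) (norm y *\<^sub>R \<theta>) * F ((t * norm v) *\<^sub>R norm y *\<^sub>R \<theta>) =
         indicator {..<1} (norm y) * F ((t * norm v) *\<^sub>R norm y *\<^sub>R \<theta>)"
        using AE_usph_norm by eventually_elim (simp add: indicator_def)
    qed
    finally show "(\<integral>\<^sup>+y. \<integral>\<^sup>+\<theta>. indicator {..<1} (norm y) * F ((t * norm v) *\<^sub>R norm y *\<^sub>R \<theta>) \<partial>usph \<partial>(lborel :: 'a measure)) =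
      (\<integral>\<^sup>+y. indicator (ball 0 1) y * F ((t * norm v) *\<^sub>R y) \<partial>lborel)" ..
  qed
  finally show ?thesis .
qed

section \<open>Autocorrelation and spherical means\<close>

lemma integrable_lborel_shift:
  fixes f :: "'a::euclidean_space \<Rightarrow> real"
  assumes "integrable lborel f"
  shows "integrable lborel (\<lambda>x. f (t + x))"
proof -
  have "integrable (distr lborel borel ((+) t)) f" using assms by (simp add: lborel_distr_plus)
  then show ?thesis by (subst (asm) integrable_distr_eq) (use assms in auto)
qed

lemma integral_lborel_shift:
  fixes f :: "'a::euclidean_space \<Rightarrow> real"
  assumes "f \<in> borel_measurable borel"
  shows "(\<integral>x. f (t + x) \<partial>lborel) = (\<integral>x. f x \<partial>lborel)"
proof -
  have "(\<integral>x. f x \<partial>lborel) = (\<integral>x. f x \<partial>distr lborel borel ((+) t))" by (simp add: lborel_distr_plus)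
  also have "\<dots> = (\<integral>x. f (t + x) \<partial>lborel)" by (rule integral_distr) (use assms in auto)
  finally show ?thesis ..
qed

lemma sqint_shift: "sqint h \<Longrightarrow> sqint (\<lambda>x. h (t + x))" for h :: "'a::euclidean_space \<Rightarrow> real"
  using integrable_lborel_shift[of "\<lambda>x. (h x)\<^sup>2" t]
  by (auto simp: sqint_def intro!: measurable_compose[of "(+) t" borel borel h])

definition sqnorm :: "('a::euclidean_space \<Rightarrow> real) \<Rightarrow> real" where
  "sqnorm h = (\<integral>x. (h x)\<^sup>2 \<partial>lborel)"

lemma sqnorm_nonneg: "0 \<le> sqnorm h"
  by (simp add: sqnorm_def)

lemma nn_integral_square: "sqint h \<Longrightarrow> (\<integral>\<^sup>+x. ennreal ((h x)\<^sup>2) \<partial>lborel) = ennreal (sqnorm h)"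
  unfolding sqnorm_def by (rule nn_integral_eq_integral[OF sqint_square]) auto

lemma nn_integral_square_shift:
  fixes h :: "'a::euclidean_space \<Rightarrow> real"
  assumes "sqint h"
  shows "(\<integral>\<^sup>+x. ennreal ((h (t + x))\<^sup>2) \<partial>lborel) = ennreal (sqnorm h)"
proof -
  note [measurable] = sqint_measurable[OF assms]
  show ?thesis
    using nn_integral_lborel_shift[of "\<lambda>x. ennreal ((h x)\<^sup>2)" t] nn_integral_square[OF assms] by simp
qed

lemma nn_integral_abs_mult_shift:
  fixes h :: "'a::euclidean_space \<Rightarrow> real"
  assumes "sqint h"
  shows "(\<integral>\<^sup>+x. ennreal \<bar>h x * h (t + x)\<bar> \<partial>lborel) \<le> ennreal (sqnorm h)"
proof -
  note [measurable] = sqint_measurable[OF assms]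
  have "(\<integral>\<^sup>+x. ennreal \<bar>h x * h (t + x)\<bar> \<partial>lborel) \<le>
      (\<integral>\<^sup>+x. ennreal (1/2) * (ennreal ((h x)\<^sup>2) + ennreal ((h (t + x))\<^sup>2)) \<partial>lborel)"
  proof (rule nn_integral_mono)
    fix x
    have "ennreal \<bar>h x * h (t + x)\<bar> \<le> ennreal (1/2 * ((h x)\<^sup>2 + (h (t + x))\<^sup>2))"
      using abs_mult_le_half_squares[of "h x" "h (t + x)"] by (intro ennreal_leI) simp
    also have "\<dots> = ennreal (1/2) * (ennreal ((h x)\<^sup>2) + ennreal ((h (t + x))\<^sup>2))"
      by (subst ennreal_mult') simp_all
    finally show "ennreal \<bar>h x * h (t + x)\<bar> \<le> \<dots>" .
  qed
  also have "\<dots> = ennreal (1/2) * (ennreal (sqnorm h) + ennreal (sqnorm h))"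
    by (simp add: nn_integral_cmult nn_integral_add nn_integral_square[OF assms] nn_integral_square_shift[OF assms])
  also have "\<dots> = ennreal (sqnorm h)"
  proof -
    have "ennreal (sqnorm h) = ennreal (1/2 * (sqnorm h + sqnorm h))" by simp
    also have "\<dots> = ennreal (1/2) * ennreal (sqnorm h + sqnorm h)" by (rule ennreal_mult') simp
    also have "ennreal (sqnorm h + sqnorm h) = ennreal (sqnorm h) + ennreal (sqnorm h)"
      by (intro ennreal_plus sqnorm_nonneg)
    finally show ?thesis ..
  qed
  finally show ?thesis .
qed

definition autocorr :: "('a::euclidean_space \<Rightarrow> real) \<Rightarrow> 'a \<Rightarrow> real" where
  "autocorr h u = (\<integral>x. h x * h (u + x) \<partial>lborel)"

lemma autocorr_measurable [measurable]:
  assumes [measurable]: "h \<in> borel_measurable borel"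
  shows "autocorr h \<in> borel_measurable borel"
  unfolding autocorr_def[abs_def] by measurable

lemma abs_autocorr_le:
  assumes "sqint h"
  shows "\<bar>autocorr h u\<bar> \<le> sqnorm h"
proof -
  have i: "integrable lborel (\<lambda>x. h x * h (u + x))"
    by (intro sqint_mult sqint_shift assms)
  have "ennreal \<bar>autocorr h u\<bar> \<le> (\<integral>\<^sup>+x. ennreal \<bar>h x * h (u + x)\<bar> \<partial>lborel)"
    using integral_norm_bound_ennreal[OF i] by (simp add: autocorr_def)
  also have "\<dots> \<le> ennreal (sqnorm h)" by (rule nn_integral_abs_mult_shift[OF assms])
  finally show ?thesis using sqnorm_nonneg[of h] by simp
qed

definition sph_mean :: "real \<Rightarrow> ('a::euclidean_space \<Rightarrow> real) \<Rightarrow> 'a \<Rightarrow> real" where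
  "sph_mean r h x = (\<integral>\<theta>. h (x - r *\<^sub>R \<theta>) \<partial>usph)"

lemma sph_mean_measurable [measurable]:
  assumes [measurable]: "h \<in> borel_measurable borel" "r \<in> borel_measurable M" "x \<in> borel_measurable M"
  shows "(\<lambda>p. sph_mean (r p) h (x p :: 'a::euclidean_space)) \<in> borel_measurable M"
  unfolding sph_mean_def by measurable

text \<open>For each fixed radius the square is integrable over almost every sphere by Fubini's
  theorem. At the other centres \<open>sph_mean\<close> may take the default value 0 of the
  integral; this null set is invisible to the \<open>L\<^sup>2\<close> norm, but it makes additivity
  of the means an almost-everywhere statement.\<close>

lemma AE_integrable_sphere:
  fixes h :: "'a::euclidean_space \<Rightarrow> real"
  assumes h: "sqint h"
  shows "AE x in lborel. integrable usph (\<lambda>\<theta>. h (x - r *\<^sub>R \<theta>))"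
proof -
  note [measurable] = sqint_measurable[OF h]
  interpret P: pair_sigma_finite "lborel :: 'a measure" "usph :: 'a measure" ..
  have sh: "(\<integral>\<^sup>+x. ennreal ((h (x - r *\<^sub>R \<theta>))\<^sup>2) \<partial>lborel) = ennreal (sqnorm h)" for \<theta> :: 'a
    using nn_integral_square_shift[OF h, of "- (r *\<^sub>R \<theta>)"] by simp
  have "(\<integral>\<^sup>+x. \<integral>\<^sup>+\<theta>. ennreal ((h (x - r *\<^sub>R \<theta>))\<^sup>2) \<partial>usph \<partial>lborel) =
     (\<integral>\<^sup>+\<theta>. \<integral>\<^sup>+x. ennreal ((h (x - r *\<^sub>R \<theta>))\<^sup>2) \<partial>lborel \<partial>(usph :: 'a measure))"
    by (rule P.Fubini'[symmetric]) measurable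
  also have "\<dots> = ennreal (sqnorm h)"
    using usph.emeasure_space_1[where 'a='a] by (simp add: sh)
  finally have "(\<integral>\<^sup>+x. \<integral>\<^sup>+\<theta>. ennreal ((h (x - r *\<^sub>R \<theta>))\<^sup>2) \<partial>usph \<partial>lborel) \<noteq> \<infinity>" by simp
  then have "AE x in lborel. (\<integral>\<^sup>+\<theta>. ennreal ((h (x - r *\<^sub>R \<theta>))\<^sup>2) \<partial>usph) \<noteq> \<infinity>"
    by (intro nn_integral_PInf_AE) auto
  then show ?thesis
  proof eventually_elim
    case (elim x)
    have "integrable usph (\<lambda>\<theta>. 1 + (h (x - r *\<^sub>R \<theta>))\<^sup>2)"
      using elim by (intro Bochner_Integration.integrable_add usph.integrable_const)
        (auto simp: integrable_iff_bounded less_top)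
    then show ?case
    proof (rule Bochner_Integration.integrable_bound)
      show "AE \<theta> in usph. norm (h (x - r *\<^sub>R \<theta>)) \<le> norm (1 + (h (x - r *\<^sub>R \<theta>))\<^sup>2)"
      proof (rule AE_I2)
        fix \<theta>
        have "2 * \<bar>a\<bar> \<le> 1 + a\<^sup>2" for a :: real
          using sum_squares_bound[of 1 "\<bar>a\<bar>"] by simp
        from this[of "h (x - r *\<^sub>R \<theta>)"]
        show "norm (h (x - r *\<^sub>R \<theta>)) \<le> norm (1 + (h (x - r *\<^sub>R \<theta>))\<^sup>2)" by simp
      qed
    qed measurable
  qed
qed

text \<open>The square of a mean is a double integral over pairs of points of the sphere. When
  \<open>x\<close> is integrated first, a translation leaves the autocorrelation at \<open>r\<close>
  times the difference of the pair, so only the law of chords matters. The second claim records that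
  the right-hand integral is nonnegative, so that \<open>ennreal\<close> does not cut it off in
  later sums.\<close>

lemma nn_integral_sph_mean_square:
  fixes h :: "'a::euclidean_space \<Rightarrow> real"
  assumes h: "sqint h"
  shows "(\<integral>\<^sup>+x. ennreal ((sph_mean r h x)\<^sup>2) \<partial>lborel) = ennreal (\<integral>v. autocorr h (r *\<^sub>R v) \<partial>chord)"
    and "0 \<le> (\<integral>v. autocorr h (r *\<^sub>R v) \<partial>chord)"
proof -
  note [measurable] = sqint_measurable[OF h]
  interpret U: pair_prob_space "usph :: 'a measure" "usph :: 'a measure" ..
  interpret P: pair_sigma_finite "lborel :: 'a measure" "(usph :: 'a measure) \<Otimes>\<^sub>M (usph :: 'a measure)" ..
  interpret P1: pair_sigma_finite "lborel :: 'a measure" "usph :: 'a measure" ..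
  define G where "G x q = h (x - r *\<^sub>R fst q) * h (x - r *\<^sub>R snd q)" for x :: 'a and q :: "'a \<times> 'a"
  have Gm [measurable]: "case_prod G \<in> borel_measurable (lborel \<Otimes>\<^sub>M ((usph :: 'a measure) \<Otimes>\<^sub>M (usph :: 'a measure)))"
    unfolding G_def case_prod_unfold by measurable
  have shift: "(\<integral>x. G x q \<partial>lborel) = autocorr h (r *\<^sub>R (fst q - snd q))" for q
  proof -
    have "(\<integral>x. G x q \<partial>lborel) = (\<integral>x. G (r *\<^sub>R fst q + x) q \<partial>lborel)"
      unfolding G_def by (rule integral_lborel_shift[symmetric]) measurable
    also have "\<dots> = autocorr h (r *\<^sub>R (fst q - snd q))"
      unfolding G_def autocorr_def by (intro Bochner_Integration.integral_cong) (simp_all add: algebra_simps)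
    finally show ?thesis .
  qed
  have nshift: "(\<integral>\<^sup>+x. ennreal \<bar>G x q\<bar> \<partial>lborel) \<le> ennreal (sqnorm h)" for q
  proof -
    have "(\<integral>\<^sup>+x. ennreal \<bar>G x q\<bar> \<partial>lborel) = (\<integral>\<^sup>+x. ennreal \<bar>G (r *\<^sub>R fst q + x) q\<bar> \<partial>lborel)"
      unfolding G_def by (rule nn_integral_lborel_shift[symmetric]) measurable
    also have "\<dots> = (\<integral>\<^sup>+x. ennreal \<bar>h x * h (r *\<^sub>R (fst q - snd q) + x)\<bar> \<partial>lborel)"
      unfolding G_def by (intro nn_integral_cong) (simp add: algebra_simps)
    also have "\<dots> \<le> ennreal (sqnorm h)" by (rule nn_integral_abs_mult_shift[OF h])
    finally show ?thesis .
  qed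
  have int: "integrable (lborel \<Otimes>\<^sub>M (usph \<Otimes>\<^sub>M usph)) (case_prod G)"
  proof (rule integrableI_bounded)
    have "(\<integral>\<^sup>+p. ennreal (norm (case_prod G p)) \<partial>(lborel \<Otimes>\<^sub>M (usph \<Otimes>\<^sub>M usph))) =
      (\<integral>\<^sup>+q. \<integral>\<^sup>+x. ennreal \<bar>G x q\<bar> \<partial>lborel \<partial>(usph \<Otimes>\<^sub>M usph))"
      by (subst P.nn_integral_snd[symmetric]) simp_all
    also have "\<dots> \<le> (\<integral>\<^sup>+q. ennreal (sqnorm h) \<partial>((usph :: 'a measure) \<Otimes>\<^sub>M (usph :: 'a measure)))"
      by (intro nn_integral_mono nshift)
    also have "\<dots> < \<infinity>" using U.emeasure_space_1 by (simp add: ennreal_mult_less_top)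
    finally show "(\<integral>\<^sup>+p. ennreal (norm (case_prod G p)) \<partial>(lborel \<Otimes>\<^sub>M (usph \<Otimes>\<^sub>M usph))) < \<infinity>" .
  qed (rule Gm)
  have sq: "AE x in lborel. (\<integral>q. G x q \<partial>(usph \<Otimes>\<^sub>M usph)) = (sph_mean r h x)\<^sup>2"
    using P.AE_integrable_fst[OF int]
  proof eventually_elim
    case (elim x)
    have "(\<integral>q. G x q \<partial>(usph \<Otimes>\<^sub>M usph)) = (\<integral>w. (\<integral>w'. G x (w, w') \<partial>usph) \<partial>usph)"
      by (rule U.integral_fst'[symmetric]) (rule elim)
    also have "\<dots> = (\<integral>w. h (x - r *\<^sub>R w) * sph_mean r h x \<partial>usph)"
      by (simp add: G_def sph_mean_def)
    also have "\<dots> = (sph_mean r h x)\<^sup>2"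
      by (simp add: sph_mean_def power2_eq_square)
    finally show ?case .
  qed
  have i1: "integrable lborel (\<lambda>x. (\<integral>q. G x q \<partial>(usph \<Otimes>\<^sub>M usph)))"
    by (rule P.integrable_fst[OF int])
  have i2: "integrable lborel (\<lambda>x. (sph_mean r h x)\<^sup>2)"
    by (rule integrable_cong_AE_imp[OF i1]) (use sq in \<open>auto elim!: eventually_mono\<close>)
  have "(\<integral>x. (sph_mean r h x)\<^sup>2 \<partial>lborel) = (\<integral>x. (\<integral>q. G x q \<partial>(usph \<Otimes>\<^sub>M usph)) \<partial>lborel)"
    by (rule integral_cong_AE) (use sq in \<open>auto elim!: eventually_mono\<close>)
  also have "\<dots> = (\<integral>q. (\<integral>x. G x q \<partial>lborel) \<partial>(usph \<Otimes>\<^sub>M usph))"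
    by (rule P.Fubini_integral[OF int, symmetric])
  also have "\<dots> = (\<integral>q. autocorr h (r *\<^sub>R (case q of (w, w') \<Rightarrow> w - w')) \<partial>(usph \<Otimes>\<^sub>M usph))"
    by (simp add: shift case_prod_unfold)
  also have "\<dots> = (\<integral>v. autocorr h (r *\<^sub>R v) \<partial>chord)"
    unfolding chord_def by (rule integral_distr[symmetric]) measurable
  finally have eq: "(\<integral>x. (sph_mean r h x)\<^sup>2 \<partial>lborel) = (\<integral>v. autocorr h (r *\<^sub>R v) \<partial>chord)" .
  then show "(\<integral>\<^sup>+x. ennreal ((sph_mean r h x)\<^sup>2) \<partial>lborel) = ennreal (\<integral>v. autocorr h (r *\<^sub>R v) \<partial>chord)"
    using nn_integral_eq_integral[OF i2] by simp
  show "0 \<le> (\<integral>v. autocorr h (r *\<^sub>R v) \<partial>chord)" unfolding eq[symmetric] by simp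
qed

text \<open>The radius is \<open>t * norm y\<close> with \<open>y\<close> in the unit ball, so radii
  carry a weight proportional to \<open>r ^ (n - 1)\<close>. This is the weight obtained when a
  marginal of the large sphere is bounded by Lebesgue measure on the ball.\<close>

definition sph_square :: "real \<Rightarrow> ('a::euclidean_space \<Rightarrow> real) \<Rightarrow> ennreal" where
  "sph_square t h = (\<integral>\<^sup>+y. indicator (ball 0 1) y * (\<integral>\<^sup>+x. ennreal ((sph_mean (t * norm y) h x)\<^sup>2) \<partial>(lborel :: 'a measure)) \<partial>(lborel :: 'a measure))"

definition ball_corr :: "('a::euclidean_space \<Rightarrow> real) \<Rightarrow> real \<Rightarrow> real" where
  "ball_corr h r = (\<integral>y. indicator (ball 0 1) y * autocorr h (r *\<^sub>R y) \<partial>lborel)"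

lemma integrable_ball_autocorr:
  fixes h :: "'a::euclidean_space \<Rightarrow> real"
  assumes h: "sqint h"
  shows "integrable lborel (\<lambda>y::'a. indicator (ball 0 1) y * autocorr h (r *\<^sub>R y))"
proof (rule Bochner_Integration.integrable_bound)
  note [measurable] = sqint_measurable[OF h]
  show "integrable lborel (\<lambda>y::'a. sqnorm h * indicator (ball 0 1) y)"
    by (intro integrable_mult_right) (simp add: integrable_indicator_iff less_top[symmetric])
  show "(\<lambda>y::'a. indicator (ball 0 1) y * autocorr h (r *\<^sub>R y)) \<in> borel_measurable lborel" by measurable
  show "AE y in lborel. norm (indicator (ball 0 1) y * autocorr h (r *\<^sub>R y)) \<le> norm (sqnorm h * indicator (ball 0 1) y)"
    using abs_autocorr_le[OF h] sqnorm_nonneg[of h] by (intro AE_I2) (simp add: indicator_def)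
qed

text \<open>The exchange of radius and chord length is available for nonnegative integrands, whereas
  the autocorrelation changes sign. It is therefore raised by its bound \<open>sqnorm h\<close>; the
  shift adds the finite amount \<open>?N * ?V\<close> on both sides and is cancelled at the
  end.\<close>

lemma sph_square_le_ball_corr:
  fixes h :: "'a::euclidean_space \<Rightarrow> real"
  assumes h: "sqint h" and b: "\<And>v::'a. ball_corr h (t * norm v) \<le> b v" "\<And>v. 0 \<le> b v" and [measurable]: "b \<in> borel_measurable borel"
  shows "sph_square t h \<le> (\<integral>\<^sup>+v. ennreal (b v) \<partial>chord)"
proof -
  note [measurable] = sqint_measurable[OF h]
  let ?N = "sqnorm h" and ?V = "unit_ball_vol DIM('a)"
  define F where "F u = ennreal (autocorr h u + ?N)" for u
  have [measurable]: "F \<in> borel_measurable borel" unfolding F_def[abs_def] by measurable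
  have nn: "0 \<le> autocorr h u + ?N" for u using abs_autocorr_le[OF h, of u] by linarith
  have ci: "integrable chord (\<lambda>v. autocorr h (r *\<^sub>R v))" for r
    using abs_autocorr_le[OF h] by (intro chord.integrable_const_bound[of _ ?N]) auto
  have Fc: "(\<integral>\<^sup>+v. F (r *\<^sub>R v) \<partial>chord) = (\<integral>\<^sup>+x. ennreal ((sph_mean r h x)\<^sup>2) \<partial>lborel) + ennreal ?N" for r
  proof -
    have "(\<integral>\<^sup>+v. F (r *\<^sub>R v) \<partial>chord) = ennreal (\<integral>v. autocorr h (r *\<^sub>R v) + ?N \<partial>chord)"
      unfolding F_def by (rule nn_integral_eq_integral) (use ci nn in auto)
    also have "(\<integral>v. autocorr h (r *\<^sub>R v) + ?N \<partial>chord) = (\<integral>v. autocorr h (r *\<^sub>R v) \<partial>chord) + ?N"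
      using ci[of r] chord.prob_space[where 'a='a] by simp
    also have "ennreal \<dots> = ennreal (\<integral>v. autocorr h (r *\<^sub>R v) \<partial>chord) + ennreal ?N"
      using nn_integral_sph_mean_square(2)[OF h, of r] sqnorm_nonneg[of h] by simp
    finally show ?thesis by (simp add: nn_integral_sph_mean_square(1)[OF h])
  qed
  have "sph_square t h + ennreal (?N * ?V) =
     (\<integral>\<^sup>+y. indicator (ball 0 1) y * (\<integral>\<^sup>+x. ennreal ((sph_mean (t * norm y) h x)\<^sup>2) \<partial>(lborel :: 'a measure)) + indicator (ball 0 1) y * ennreal ?N \<partial>(lborel :: 'a measure))"
  proof -
    have "(\<integral>\<^sup>+y. indicator (ball 0 1) y * ennreal ?N \<partial>(lborel :: 'a measure)) = emeasure lborel (ball (0::'a) 1) * ennreal ?N"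
      by (subst nn_integral_multc) simp_all
    also have "\<dots> = ennreal (?N * ?V)"
      by (simp add: emeasure_ball ennreal_mult sqnorm_nonneg mult.commute)
    finally show ?thesis unfolding sph_square_def by (subst nn_integral_add) simp_all
  qed
  also have "\<dots> = (\<integral>\<^sup>+y. indicator (ball 0 1) y * (\<integral>\<^sup>+v. F ((t * norm y) *\<^sub>R v) \<partial>chord) \<partial>(lborel :: 'a measure))"
    by (simp add: Fc distrib_left)
  also have "\<dots> = (\<integral>\<^sup>+v. \<integral>\<^sup>+y. indicator (ball 0 1) y * F ((t * norm v) *\<^sub>R y) \<partial>lborel \<partial>(chord :: 'a measure))"
    by (rule nn_integral_ball_chord) measurable
  also have "\<dots> \<le> (\<integral>\<^sup>+v. ennreal (b v) + ennreal (?N * ?V) \<partial>(chord :: 'a measure))"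
  proof (rule nn_integral_mono)
    fix v :: 'a
    let ?r = "t * norm v"
    have i2: "integrable lborel (\<lambda>y::'a. ?N * indicator (ball 0 1) y)"
      by (intro integrable_mult_right) (simp add: integrable_indicator_iff less_top[symmetric])
    have "(\<integral>\<^sup>+y. indicator (ball 0 1) y * F (?r *\<^sub>R y) \<partial>lborel) =
       (\<integral>\<^sup>+y. ennreal (indicator (ball 0 1) y * autocorr h (?r *\<^sub>R y) + ?N * indicator (ball 0 1) y) \<partial>lborel)"
      unfolding F_def by (intro nn_integral_cong) (simp add: indicator_def)
    also have "\<dots> = ennreal (\<integral>y. indicator (ball 0 1) y * autocorr h (?r *\<^sub>R y) + ?N * indicator (ball 0 1) y \<partial>lborel)"
      using integrable_ball_autocorr[OF h, of ?r] i2 nn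
      by (intro nn_integral_eq_integral Bochner_Integration.integrable_add AE_I2) (auto simp: indicator_def)
    also have "(\<integral>y. indicator (ball 0 1) y * autocorr h (?r *\<^sub>R y) + ?N * indicator (ball 0 1) y \<partial>lborel) = ball_corr h ?r + ?N * ?V"
      using integrable_ball_autocorr[OF h, of ?r] i2
      by (subst Bochner_Integration.integral_add) (simp_all add: ball_corr_def content_ball)
    also have "ennreal \<dots> \<le> ennreal (b v + ?N * ?V)" by (intro ennreal_leI add_right_mono b)
    also have "\<dots> = ennreal (b v) + ennreal (?N * ?V)" using b(2)[of v] sqnorm_nonneg[of h] by simp
    finally show "(\<integral>\<^sup>+y. indicator (ball 0 1) y * F (?r *\<^sub>R y) \<partial>lborel) \<le> ennreal (b v) + ennreal (?N * ?V)" .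
  qed
  also have "\<dots> = (\<integral>\<^sup>+v. ennreal (b v) \<partial>chord) + ennreal (?N * ?V)"
    using chord.emeasure_space_1[where 'a='a] by (simp add: nn_integral_add)
  finally show ?thesis by (simp add: ennreal_add_left_cancel_le add.commute[of _ "ennreal (?N * ?V)"])
qed

section \<open>The gain for functions with vanishing cube averages\<close>

lemma ball_corr_le_const:
  fixes h :: "'a::euclidean_space \<Rightarrow> real"
  assumes h: "sqint h"
  shows "ball_corr h r \<le> sqnorm h * unit_ball_vol DIM('a)"
proof -
  have i2: "integrable lborel (\<lambda>y::'a. sqnorm h * indicator (ball 0 1) y)"
    by (intro integrable_mult_right) (simp add: integrable_indicator_iff less_top[symmetric])
  have "ball_corr h r \<le> (\<integral>y. sqnorm h * indicator (ball (0::'a) 1) y \<partial>lborel)"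
    unfolding ball_corr_def
    using abs_autocorr_le[OF h, THEN abs_le_D1]
    by (intro integral_mono integrable_ball_autocorr[OF h] i2) (auto simp: indicator_def)
  also have "\<dots> = sqnorm h * unit_ball_vol DIM('a)" by (simp add: content_ball)
  finally show ?thesis .
qed

lemma emeasure_annulus:
  assumes e: "0 \<le> e" "e \<le> 1"
  shows "emeasure lborel {y::'a::euclidean_space. \<bar>norm y - 1\<bar> \<le> e} \<le> ennreal (unit_ball_vol DIM('a) * DIM('a) * 2 ^ DIM('a) * e)"
proof -
  let ?n = "DIM('a)" and ?V = "unit_ball_vol DIM('a)"
  have "emeasure lborel {y::'a. \<bar>norm y - 1\<bar> \<le> e} \<le> emeasure lborel (cball (0::'a) (1 + e) - ball 0 (1 - e))"
    by (intro emeasure_mono) auto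
  also have "\<dots> = emeasure lborel (cball (0::'a) (1 + e)) - emeasure lborel (ball (0::'a) (1 - e))"
    using e by (intro emeasure_Diff) (auto simp: emeasure_ball)
  also have "\<dots> = ennreal (?V * (1 + e) ^ ?n - ?V * (1 - e) ^ ?n)"
    using e by (simp add: emeasure_ball emeasure_cball ennreal_minus)
  also have "\<dots> \<le> ennreal (?V * ?n * 2 ^ ?n * e)"
  proof (rule ennreal_leI)
    \<comment> \<open>A crude bound, linear in \<open>e\<close>, by induction on the exponent:
      \<open>1 + e\<close> and \<open>1 - e\<close> are both estimated by 2.\<close>
    have "(1 + e) ^ m - (1 - e) ^ m \<le> real m * 2 ^ m * e" for m
    proof (induction m)
      case (Suc m)
      have "(1 + e) ^ Suc m - (1 - e) ^ Suc m = (1 + e) * ((1 + e) ^ m - (1 - e) ^ m) + 2 * e * (1 - e) ^ m"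
        by (simp add: algebra_simps)
      also have "\<dots> \<le> 2 * (real m * 2 ^ m * e) + 2 * e * 2 ^ m"
      proof (intro add_mono mult_mono mult_left_mono Suc.IH)
        have "(1 - e) ^ m \<le> (1 + e) ^ m" using e by (intro power_mono) auto
        then show "0 \<le> (1 + e) ^ m - (1 - e) ^ m" by simp
        show "(1 - e) ^ m \<le> 2 ^ m" using e by (intro power_mono) auto
      qed (use e in auto)
      also have "\<dots> = real (Suc m) * 2 ^ Suc m * e" by (simp add: algebra_simps)
      finally show ?case .
    qed simp
    from mult_left_mono[OF this[of ?n], of ?V]
    show "?V * (1 + e) ^ ?n - ?V * (1 - e) ^ ?n \<le> ?V * ?n * 2 ^ ?n * e"
      by (simp add: algebra_simps)
  qed
  finally show ?thesis .
qed

text \<open>By self-adjointness the integral of \<open>h\<close> over a ball is unchanged when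
  \<open>cube_avg i g\<close> is subtracted from the indicator \<open>g\<close> of the ball. The
  difference is at most 1 in absolute value and vanishes on every cube lying inside or outside the
  ball, so only points within one cube diameter of the boundary contribute. For each remaining shift
  the pairing of \<open>h\<close> with its translate costs at most \<open>sqnorm h\<close>.\<close>

lemma ball_corr_le_annulus:
  fixes h :: "'a::euclidean_space \<Rightarrow> real"
  assumes h: "sqint h" and z: "\<And>x. cube_avg i h x = 0" and r: "0 < r"
  shows "ennreal (ball_corr h r) \<le> ennreal (sqnorm h) * emeasure lborel {y::'a. \<bar>norm y - 1\<bar> \<le> DIM('a) * 2 powi i / r}"
proof -
  note [measurable] = sqint_measurable[OF h]
  let ?d = "DIM('a) * 2 powi i :: real"
  let ?A = "{y::'a. \<bar>norm y - 1\<bar> \<le> ?d / r}"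
  \<comment> \<open>Up to the factor \<open>r ^ n\<close> this is the integral of \<open>h\<close>
    over \<open>ball x r\<close>.\<close>
  define \<beta> where "\<beta> x = (\<integral>y. indicator (ball 0 1) y * h (r *\<^sub>R y + x) \<partial>lborel)" for x :: 'a
  have beta: "ennreal \<bar>\<beta> x\<bar> \<le> (\<integral>\<^sup>+y. indicator ?A y * ennreal \<bar>h (r *\<^sub>R y + x)\<bar> \<partial>lborel)" for x
  proof -
    define g :: "'a \<Rightarrow> real" where "g = indicator (ball x r)"
    have g: "sqint g" unfolding g_def using r by (intro sqint_indicator) (simp_all add: emeasure_ball)
    note [measurable] = sqint_measurable[OF g]
    have g01: "0 \<le> g u" "g u \<le> 1" for u by (simp_all add: g_def)
    have avg01: "0 \<le> cube_avg i g u" "cube_avg i g u \<le> 1" for u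
    proof -
      show "0 \<le> cube_avg i g u"
        unfolding cube_avg_def using g01 by (intro divide_nonneg_nonneg integral_nonneg_AE AE_I2) auto
      have "(\<integral>w. cube_ind i u w * g w \<partial>lborel) \<le> (\<integral>w. cube_ind i u w \<partial>lborel)"
      proof (rule integral_mono)
        show "integrable lborel (\<lambda>w. cube_ind i u w * g w)" by (rule integrable_cube_mult[OF g])
        show "integrable lborel (\<lambda>w. cube_ind i u w)" by (simp add: integrable_indicator_iff emeasure_cube)
        show "cube_ind i u w * g w \<le> cube_ind i u w" for w using g01[of w] by (simp add: indicator_def)
      qed
      then show "cube_avg i g u \<le> 1" by (simp add: cube_avg_def measure_cube)
    qed
    have far: "cube_avg i g u = g u" if "\<not> \<bar>norm (u - x) - r\<bar> \<le> ?d" for u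
    proof (rule cube_avg_const)
      fix w assume "same_cube i u w"
      then have "norm (u - w) \<le> ?d" by (rule norm_same_cube_le)
      moreover have "\<bar>norm (u - x) - norm (w - x)\<bar> \<le> norm (u - w)"
        using norm_triangle_ineq3[of "u - x" "w - x"] by simp
      ultimately have "(norm (w - x) < r) = (norm (u - x) < r)" using that by linarith
      then show "g w = g u" by (simp add: g_def indicator_def dist_norm norm_minus_commute)
    qed
    have "0 = (\<integral>u. g u * cube_avg i h u \<partial>lborel)" by (simp add: z)
    also have "\<dots> = (\<integral>u. cube_avg i g u * h u \<partial>lborel)" by (rule integral_mult_cube_avg[OF g h])
    finally have 0: "(\<integral>u. cube_avg i g u * h u \<partial>lborel) = 0" by simp
    have i1: "integrable lborel (\<lambda>u. g u * h u)" "integrable lborel (\<lambda>u. cube_avg i g u * h u)"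
      by (intro sqint_mult g h sqint_cube_avg)+
    have i3: "integrable lborel (\<lambda>u. (g u - cube_avg i g u) * h u)"
      using Bochner_Integration.integrable_diff[OF i1] by (simp add: left_diff_distrib)
    have "(\<integral>u. g u * h u \<partial>lborel) = (\<integral>u. (g u - cube_avg i g u) * h u \<partial>lborel)"
      using i1 0 by (simp add: left_diff_distrib)
    then have "ennreal \<bar>\<integral>u. g u * h u \<partial>lborel\<bar> \<le> (\<integral>\<^sup>+u. ennreal (norm ((g u - cube_avg i g u) * h u)) \<partial>lborel)"
      using integral_norm_bound_ennreal[OF i3] by simp
    also have "\<dots> \<le> (\<integral>\<^sup>+u. indicator {u. \<bar>norm (u - x) - r\<bar> \<le> ?d} u * ennreal \<bar>h u\<bar> \<partial>lborel)"
    proof (rule nn_integral_mono)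
      fix u
      have "\<bar>g u - cube_avg i g u\<bar> \<le> 1" using g01[of u] avg01[of u] by linarith
      then have "\<bar>g u - cube_avg i g u\<bar> * \<bar>h u\<bar> \<le> 1 * \<bar>h u\<bar>" by (intro mult_right_mono) auto
      then show "ennreal (norm ((g u - cube_avg i g u) * h u)) \<le> indicator {u. \<bar>norm (u - x) - r\<bar> \<le> ?d} u * ennreal \<bar>h u\<bar>"
        using far[of u] by (simp add: indicator_def abs_mult ennreal_leI)
    qed
    also have "\<dots> = ennreal (\<bar>r\<bar> ^ DIM('a)) * (\<integral>\<^sup>+y. indicator {u. \<bar>norm (u - x) - r\<bar> \<le> ?d} (x + r *\<^sub>R y) * ennreal \<bar>h (x + r *\<^sub>R y)\<bar> \<partial>lborel)"
      by (rule nn_integral_lborel_affine) (use r in auto)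
    also have "(\<integral>\<^sup>+y. indicator {u. \<bar>norm (u - x) - r\<bar> \<le> ?d} (x + r *\<^sub>R y) * ennreal \<bar>h (x + r *\<^sub>R y)\<bar> \<partial>lborel) =
        (\<integral>\<^sup>+y. indicator ?A y * ennreal \<bar>h (r *\<^sub>R y + x)\<bar> \<partial>lborel)"
    proof (rule nn_integral_cong)
      fix y :: 'a
      have "\<bar>r * norm y - r\<bar> = r * \<bar>norm y - 1\<bar>"
        using abs_mult[of r "norm y - 1"] r by (simp add: algebra_simps)
      then have "\<bar>norm (x + r *\<^sub>R y - x) - r\<bar> \<le> ?d \<longleftrightarrow> \<bar>norm y - 1\<bar> \<le> ?d / r"
        using r by (simp add: pos_le_divide_eq mult.commute)
      then show "indicator {u. \<bar>norm (u - x) - r\<bar> \<le> ?d} (x + r *\<^sub>R y) * ennreal \<bar>h (x + r *\<^sub>R y)\<bar> =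
         indicator ?A y * ennreal \<bar>h (r *\<^sub>R y + x)\<bar>"
        by (simp add: indicator_def add.commute)
    qed
    finally have le: "ennreal \<bar>\<integral>u. g u * h u \<partial>lborel\<bar> \<le> ennreal (\<bar>r\<bar> ^ DIM('a)) * (\<integral>\<^sup>+y. indicator ?A y * ennreal \<bar>h (r *\<^sub>R y + x)\<bar> \<partial>lborel)" .
    have "(\<integral>u. g u * h u \<partial>lborel) = \<bar>r\<bar> ^ DIM('a) * (\<integral>y. g (x + r *\<^sub>R y) * h (x + r *\<^sub>R y) \<partial>lborel)"
    proof -
      have "(\<integral>u. g u * h u \<partial>lborel) = (\<integral>u. g u * h u \<partial>density (distr lborel borel (\<lambda>y. x + r *\<^sub>R y)) (\<lambda>_. ennreal (\<bar>r\<bar> ^ DIM('a))))"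
        using r by (subst lborel_affine[of r x]) auto
      also have "\<dots> = (\<integral>u. (\<bar>r\<bar> ^ DIM('a)) *\<^sub>R (g u * h u) \<partial>distr lborel borel (\<lambda>y. x + r *\<^sub>R y))"
        by (rule integral_density) auto
      also have "\<dots> = (\<integral>y. (\<bar>r\<bar> ^ DIM('a)) *\<^sub>R (g (x + r *\<^sub>R y) * h (x + r *\<^sub>R y)) \<partial>lborel)"
        by (rule integral_distr) measurable
      finally show ?thesis by simp
    qed
    also have "(\<integral>y. g (x + r *\<^sub>R y) * h (x + r *\<^sub>R y) \<partial>lborel) = \<beta> x"
      unfolding \<beta>_def g_def using r
      by (intro Bochner_Integration.integral_cong) (auto simp: indicator_def dist_norm add.commute)
    finally have "ennreal \<bar>\<integral>u. g u * h u \<partial>lborel\<bar> = ennreal (\<bar>r\<bar> ^ DIM('a)) * ennreal \<bar>\<beta> x\<bar>"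
      by (simp add: abs_mult ennreal_mult)
    with le have "ennreal (\<bar>r\<bar> ^ DIM('a)) * ennreal \<bar>\<beta> x\<bar> \<le> ennreal (\<bar>r\<bar> ^ DIM('a)) * (\<integral>\<^sup>+y. indicator ?A y * ennreal \<bar>h (r *\<^sub>R y + x)\<bar> \<partial>lborel)"
      by simp
    moreover have "ennreal (\<bar>r\<bar> ^ DIM('a)) \<noteq> 0" "ennreal (\<bar>r\<bar> ^ DIM('a)) \<noteq> top"
      using r by (simp_all add: ennreal_eq_0_iff not_le)
    ultimately show ?thesis by (simp add: ennreal_mult_le_mult_iff)
  qed
  have Gm: "(\<lambda>(x, y). h x * (indicator (ball 0 1) y * h (r *\<^sub>R y + x))) \<in> borel_measurable (lborel \<Otimes>\<^sub>M (lborel :: 'a measure))"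
    by measurable
  have int: "integrable (lborel \<Otimes>\<^sub>M lborel) (\<lambda>(x, y::'a). h x * (indicator (ball 0 1) y * h (r *\<^sub>R y + x)))"
  proof (rule integrableI_bounded[OF Gm])
    have "(\<integral>\<^sup>+p. ennreal (norm (case p of (x, y::'a) \<Rightarrow> h x * (indicator (ball 0 1) y * h (r *\<^sub>R y + x)))) \<partial>(lborel \<Otimes>\<^sub>M lborel)) =
      (\<integral>\<^sup>+y. \<integral>\<^sup>+x. ennreal (norm (h x * (indicator (ball 0 1) y * h (r *\<^sub>R y + x)))) \<partial>lborel \<partial>(lborel :: 'a measure))"
      by (subst lborel_pair.nn_integral_snd[symmetric]) simp_all
    also have "\<dots> \<le> (\<integral>\<^sup>+y. ennreal (sqnorm h) * indicator (ball 0 1) y \<partial>(lborel :: 'a measure))"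
    proof (rule nn_integral_mono)
      fix y :: 'a
      have "(\<integral>\<^sup>+x. ennreal (norm (h x * (indicator (ball 0 1) y * h (r *\<^sub>R y + x)))) \<partial>lborel) =
         (\<integral>\<^sup>+x. indicator (ball 0 1) y * ennreal \<bar>h x * h (r *\<^sub>R y + x)\<bar> \<partial>lborel)"
        by (intro nn_integral_cong) (simp add: indicator_def)
      also have "\<dots> \<le> indicator (ball 0 1) y * ennreal (sqnorm h)"
        using nn_integral_abs_mult_shift[OF h, of "r *\<^sub>R y"] by (simp add: nn_integral_cmult mult_left_mono)
      finally show "(\<integral>\<^sup>+x. ennreal (norm (h x * (indicator (ball 0 1) y * h (r *\<^sub>R y + x)))) \<partial>lborel) \<le> ennreal (sqnorm h) * indicator (ball 0 1) y"
        by (simp add: mult.commute)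
    qed
    also have "\<dots> < \<infinity>" by (simp add: nn_integral_cmult_indicator emeasure_ball ennreal_mult_less_top)
    finally show "(\<integral>\<^sup>+p. ennreal (norm (case p of (x, y::'a) \<Rightarrow> h x * (indicator (ball 0 1) y * h (r *\<^sub>R y + x)))) \<partial>(lborel \<Otimes>\<^sub>M lborel)) < \<infinity>" .
  qed
  have "ball_corr h r = (\<integral>y. (\<integral>x. h x * (indicator (ball 0 1) y * h (r *\<^sub>R y + x)) \<partial>lborel) \<partial>(lborel :: 'a measure))"
    unfolding ball_corr_def autocorr_def
    by (simp add: mult.left_commute[of "h _" "indicator _ _"])
  also have "\<dots> = (\<integral>x. (\<integral>y. h x * (indicator (ball 0 1) y * h (r *\<^sub>R y + x)) \<partial>lborel) \<partial>lborel)"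
    by (rule lborel_pair.Fubini_integral[OF int])
  also have "\<dots> = (\<integral>x. h x * \<beta> x \<partial>lborel)" by (simp add: \<beta>_def)
  finally have bc: "ball_corr h r = (\<integral>x. h x * \<beta> x \<partial>lborel)" .
  have ib: "integrable lborel (\<lambda>x. h x * \<beta> x)"
    using lborel_pair.integrable_fst[OF int] by (simp add: \<beta>_def)
  have "ennreal (ball_corr h r) \<le> ennreal \<bar>\<integral>x. h x * \<beta> x \<partial>lborel\<bar>" unfolding bc by (intro ennreal_leI) simp
  also have "\<dots> \<le> (\<integral>\<^sup>+x. ennreal (norm (h x * \<beta> x)) \<partial>lborel)"
    using integral_norm_bound_ennreal[OF ib] by simp
  also have "\<dots> \<le> (\<integral>\<^sup>+x. \<integral>\<^sup>+y. indicator ?A y * ennreal \<bar>h x * h (r *\<^sub>R y + x)\<bar> \<partial>lborel \<partial>lborel)"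
  proof (rule nn_integral_mono)
    fix x
    have "ennreal (norm (h x * \<beta> x)) = ennreal \<bar>h x\<bar> * ennreal \<bar>\<beta> x\<bar>" by (simp add: abs_mult ennreal_mult)
    also have "\<dots> \<le> ennreal \<bar>h x\<bar> * (\<integral>\<^sup>+y. indicator ?A y * ennreal \<bar>h (r *\<^sub>R y + x)\<bar> \<partial>lborel)"
      by (intro mult_left_mono beta) simp
    also have "\<dots> = (\<integral>\<^sup>+y. ennreal \<bar>h x\<bar> * (indicator ?A y * ennreal \<bar>h (r *\<^sub>R y + x)\<bar>) \<partial>lborel)"
      by (rule nn_integral_cmult[symmetric]) measurable
    also have "\<dots> = (\<integral>\<^sup>+y. indicator ?A y * ennreal \<bar>h x * h (r *\<^sub>R y + x)\<bar> \<partial>lborel)"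
      by (simp add: abs_mult ennreal_mult mult_ac)
    finally show "ennreal (norm (h x * \<beta> x)) \<le> \<dots>" .
  qed
  also have "\<dots> = (\<integral>\<^sup>+y. \<integral>\<^sup>+x. indicator ?A y * ennreal \<bar>h x * h (r *\<^sub>R y + x)\<bar> \<partial>lborel \<partial>lborel)"
    by (rule lborel_pair.Fubini'[symmetric]) measurable
  also have "\<dots> \<le> (\<integral>\<^sup>+y. ennreal (sqnorm h) * indicator ?A y \<partial>lborel)"
  proof (rule nn_integral_mono)
    fix y :: 'a
    show "(\<integral>\<^sup>+x. indicator ?A y * ennreal \<bar>h x * h (r *\<^sub>R y + x)\<bar> \<partial>lborel) \<le> ennreal (sqnorm h) * indicator ?A y"
      using nn_integral_abs_mult_shift[OF h, of "r *\<^sub>R y"] by (simp add: nn_integral_cmult mult_left_mono mult.commute[of _ "indicator _ _"])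
  qed
  also have "\<dots> = ennreal (sqnorm h) * emeasure lborel ?A"
    by (rule nn_integral_cmult_indicator) simp
  finally show ?thesis .
qed

text \<open>
  With \<open>\<epsilon> = n 2\<^sup>i / t\<close>, chords of length at most \<open>sqrt \<epsilon>\<close> have probability \<open>O(sqrt \<epsilon>)\<close>; for longer
  chords the ball contributes only an annulus of width \<open>O(sqrt \<epsilon>)\<close>.
\<close>

lemma sph_square_smoothing:
  fixes h :: "'a::euclidean_space \<Rightarrow> real"
  assumes h: "sqint h" and z: "\<And>x. cube_avg i h x = 0" and t: "0 < t" and dim: "DIM('a) \<ge> 2"
  shows "sph_square t h \<le> ennreal ((2 ^ DIM('a) + unit_ball_vol DIM('a) * DIM('a) * 2 ^ DIM('a)) *
    sqrt (DIM('a) * 2 powi i / t) * sqnorm h)"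
proof -
  let ?n = "DIM('a)" and ?V = "unit_ball_vol DIM('a)" and ?N = "sqnorm h"
  define \<epsilon> where "\<epsilon> = ?n * 2 powi i / t"
  define K where "K = ?V * ?n * 2 ^ ?n"
  have eps: "0 < \<epsilon>" using t by (simp add: \<epsilon>_def DIM_positive)
  \<comment> \<open>The inequality \<open>?V \<le> K\<close> serves the case \<open>e > 1\<close>
    below, outside the range of the annulus estimate: there the trivial bound \<open>?N * ?V\<close>
    is already at most \<open>?N * (K * e)\<close>.\<close>
  have "1 * 1 \<le> real ?n * 2 ^ ?n" using DIM_positive[where 'a='a] by (intro mult_mono) auto
  then have "?V * 1 \<le> ?V * (real ?n * 2 ^ ?n)" by (intro mult_left_mono) auto
  then have KV: "?V \<le> K" by (simp add: K_def mult.assoc)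
  define b where "b v = ?N * (if norm v \<le> sqrt \<epsilon> then ?V else K * sqrt \<epsilon>)" for v :: 'a
  have K0: "0 \<le> K" by (simp add: K_def)
  have "sph_square t h \<le> (\<integral>\<^sup>+v. ennreal (b v) \<partial>chord)"
  proof (rule sph_square_le_ball_corr[OF h])
    show "0 \<le> b v" for v using K0 eps sqnorm_nonneg[of h] by (simp add: b_def)
    show "b \<in> borel_measurable borel" unfolding b_def by measurable
    fix v :: 'a
    show "ball_corr h (t * norm v) \<le> b v"
    proof (cases "norm v \<le> sqrt \<epsilon>")
      case True
      then show ?thesis using ball_corr_le_const[OF h] by (simp add: b_def)
    next
      case False
      then have v: "sqrt \<epsilon> < norm v" by simp
      have s0: "0 < sqrt \<epsilon>" using eps by simp
      then have v0: "0 < norm v" using v by linarith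
      \<comment> \<open>The relative width of the annulus at radius \<open>t * norm v\<close>. Since
        \<open>norm v\<close> exceeds \<open>sqrt \<epsilon>\<close>, it is at most
        \<open>sqrt \<epsilon>\<close>.\<close>
      define e where "e = \<epsilon> / norm v"
      have e0: "0 \<le> e" using eps by (simp add: e_def)
      have "\<epsilon> = sqrt \<epsilon> * sqrt \<epsilon>" using eps by simp
      also have "\<dots> \<le> sqrt \<epsilon> * norm v" using v s0 by (intro mult_left_mono) auto
      finally have es: "e \<le> sqrt \<epsilon>" using v0 by (simp add: e_def pos_divide_le_eq)
      have "ball_corr h (t * norm v) \<le> ?N * (K * e)"
      proof (cases "e \<le> 1")
        case True
        have "?n * 2 powi i / (t * norm v) = e" by (simp add: e_def \<epsilon>_def)
        then have "ennreal (ball_corr h (t * norm v)) \<le> ennreal ?N * emeasure lborel {y::'a. \<bar>norm y - 1\<bar> \<le> e}"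
          using ball_corr_le_annulus[OF h z, of "t * norm v"] t v0 by simp
        also have "\<dots> \<le> ennreal ?N * ennreal (K * e)"
          unfolding K_def by (intro mult_left_mono emeasure_annulus e0 True) simp
        also have "\<dots> = ennreal (?N * (K * e))" using sqnorm_nonneg[of h] by (simp add: ennreal_mult')
        finally show ?thesis using K0 e0 sqnorm_nonneg[of h] by simp
      next
        case False
        have "?N * ?V \<le> ?N * (K * e)"
        proof (intro mult_left_mono)
          have "?V * 1 \<le> K * e" using KV K0 False by (intro mult_mono) auto
          then show "?V \<le> K * e" by simp
        qed (rule sqnorm_nonneg)
        then show ?thesis using ball_corr_le_const[OF h, of "t * norm v"] by linarith
      qed
      also have "\<dots> \<le> ?N * (K * sqrt \<epsilon>)"
        using es K0 sqnorm_nonneg[of h] by (intro mult_left_mono) auto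
      finally show ?thesis using False by (simp add: b_def)
    qed
  qed
  also have "\<dots> \<le> (\<integral>\<^sup>+v. ennreal (?N * ?V) * indicator {v. norm v \<le> sqrt \<epsilon>} v + ennreal (?N * (K * sqrt \<epsilon>)) \<partial>(chord :: 'a measure))"
    by (intro nn_integral_mono) (auto simp: b_def indicator_def)
  also have "\<dots> = ennreal (?N * ?V) * emeasure chord {v::'a. norm v \<le> sqrt \<epsilon>} + ennreal (?N * (K * sqrt \<epsilon>))"
    using chord.emeasure_space_1[where 'a='a] by (simp add: nn_integral_add nn_integral_cmult_indicator)
  also have "\<dots> \<le> ennreal (?N * ?V) * ennreal (2 ^ ?n / ?V * sqrt \<epsilon>) + ennreal (?N * (K * sqrt \<epsilon>))"
    using eps by (intro add_right_mono mult_left_mono emeasure_chord_cball dim) auto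
  also have "\<dots> = ennreal (?N * ?V * (2 ^ ?n / ?V * sqrt \<epsilon>) + ?N * (K * sqrt \<epsilon>))"
  proof -
    have "ennreal (?N * ?V) * ennreal (2 ^ ?n / ?V * sqrt \<epsilon>) = ennreal (?N * ?V * (2 ^ ?n / ?V * sqrt \<epsilon>))"
      using sqnorm_nonneg[of h] by (intro ennreal_mult'[symmetric]) simp
    moreover have "ennreal (?N * ?V * (2 ^ ?n / ?V * sqrt \<epsilon>) + ?N * (K * sqrt \<epsilon>)) =
        ennreal (?N * ?V * (2 ^ ?n / ?V * sqrt \<epsilon>)) + ennreal (?N * (K * sqrt \<epsilon>))"
      using sqnorm_nonneg[of h] K0 eps by (intro ennreal_plus) auto
    ultimately show ?thesis by (simp only:)
  qed
  also have "?N * ?V * (2 ^ ?n / ?V * sqrt \<epsilon>) + ?N * (K * sqrt \<epsilon>) = (2 ^ ?n + K) * sqrt \<epsilon> * ?N"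
    using unit_ball_vol_pos[of "real ?n"] by (simp add: field_simps del: unit_ball_vol_pos)
  finally show ?thesis by (simp add: K_def \<epsilon>_def)
qed

section \<open>Summation over the scales\<close>

lemma sum_square_le_weighted:
  fixes a w :: "'i \<Rightarrow> real"
  assumes "\<And>m. m \<in> M \<Longrightarrow> 0 < w m"
  shows "(\<Sum>m\<in>M. a m)\<^sup>2 \<le> (\<Sum>m\<in>M. w m) * (\<Sum>m\<in>M. 1 / w m * (a m)\<^sup>2)"
proof -
  have "(\<Sum>m\<in>M. a m) = (\<Sum>m\<in>M. sqrt (w m) * (a m / sqrt (w m)))"
    using assms by (intro sum.cong) (auto simp: less_imp_neq[symmetric])
  also have "\<dots>\<^sup>2 \<le> (\<Sum>m\<in>M. (sqrt (w m))\<^sup>2) * (\<Sum>m\<in>M. (a m / sqrt (w m))\<^sup>2)"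
    by (rule Cauchy_Schwarz_ineq_sum)
  also have "(\<Sum>m\<in>M. (sqrt (w m))\<^sup>2) = (\<Sum>m\<in>M. w m)"
    using assms by (intro sum.cong) (auto simp: less_imp_le)
  also have "(\<Sum>m\<in>M. (a m / sqrt (w m))\<^sup>2) = (\<Sum>m\<in>M. 1 / w m * (a m)\<^sup>2)"
    using assms by (intro sum.cong) (auto simp: power_divide less_imp_le)
  finally show ?thesis .
qed

text \<open>Weighted Cauchy--Schwarz at each point and radius, then integrated. The weights are left
  free: their sum is the loss, and a geometric choice keeps it bounded independently of the number
  of terms. The means are additive at almost every centre, which suffices for each radius.\<close>

lemma sph_square_sum_le:
  fixes H :: "'i \<Rightarrow> 'a::euclidean_space \<Rightarrow> real"
  assumes M: "finite M" and H: "\<And>m. m \<in> M \<Longrightarrow> sqint (H m)" and w: "\<And>m. m \<in> M \<Longrightarrow> 0 < w m"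
  shows "sph_square t (\<lambda>x. \<Sum>m\<in>M. H m x) \<le>
    ennreal (\<Sum>m\<in>M. w m) * (\<Sum>m\<in>M. ennreal (1 / w m) * sph_square t (H m))"
proof -
  have Hm [measurable]: "H m \<in> borel_measurable borel" if "m \<in> M" for m
    using sqint_measurable[OF H[OF that]] .
  let ?W = "ennreal (\<Sum>m\<in>M. w m)"
  have inner: "(\<integral>\<^sup>+x. ennreal ((sph_mean r (\<lambda>x. \<Sum>m\<in>M. H m x) x)\<^sup>2) \<partial>(lborel :: 'a measure)) \<le>
      ?W * (\<Sum>m\<in>M. ennreal (1 / w m) * (\<integral>\<^sup>+x. ennreal ((sph_mean r (H m) x)\<^sup>2) \<partial>(lborel :: 'a measure)))" for r
  proof -
    have "AE x in lborel. \<forall>m\<in>M. integrable usph (\<lambda>\<theta>. H m (x - r *\<^sub>R \<theta>))"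
      using M H by (intro AE_finite_allI AE_integrable_sphere)
    then have "AE x in lborel. ennreal ((sph_mean r (\<lambda>x. \<Sum>m\<in>M. H m x) x)\<^sup>2) \<le>
       ?W * (\<Sum>m\<in>M. ennreal (1 / w m) * ennreal ((sph_mean r (H m) x)\<^sup>2))"
    proof eventually_elim
      case (elim x)
      have "sph_mean r (\<lambda>x. \<Sum>m\<in>M. H m x) x = (\<Sum>m\<in>M. sph_mean r (H m) x)"
        unfolding sph_mean_def using elim by (intro Bochner_Integration.integral_sum) auto
      then have "ennreal ((sph_mean r (\<lambda>x. \<Sum>m\<in>M. H m x) x)\<^sup>2) \<le>
          ennreal ((\<Sum>m\<in>M. w m) * (\<Sum>m\<in>M. 1 / w m * (sph_mean r (H m) x)\<^sup>2))"
        using sum_square_le_weighted[OF w] by (auto intro!: ennreal_leI)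
      also have "\<dots> = ?W * ennreal (\<Sum>m\<in>M. 1 / w m * (sph_mean r (H m) x)\<^sup>2)"
        using w by (intro ennreal_mult' sum_nonneg) (auto intro: less_imp_le)
      also have "ennreal (\<Sum>m\<in>M. 1 / w m * (sph_mean r (H m) x)\<^sup>2) = (\<Sum>m\<in>M. ennreal (1 / w m * (sph_mean r (H m) x)\<^sup>2))"
        using w by (intro sum_ennreal[symmetric]) (auto intro!: mult_nonneg_nonneg simp: less_imp_le)
      also have "\<dots> = (\<Sum>m\<in>M. ennreal (1 / w m) * ennreal ((sph_mean r (H m) x)\<^sup>2))"
        using w by (intro sum.cong refl ennreal_mult') (auto simp: less_imp_le)
      finally show ?case .
    qed
    then have "(\<integral>\<^sup>+x. ennreal ((sph_mean r (\<lambda>x. \<Sum>m\<in>M. H m x) x)\<^sup>2) \<partial>(lborel :: 'a measure)) \<le>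
       (\<integral>\<^sup>+x. ?W * (\<Sum>m\<in>M. ennreal (1 / w m) * ennreal ((sph_mean r (H m) x)\<^sup>2)) \<partial>lborel)"
      by (rule nn_integral_mono_AE)
    also have "\<dots> = ?W * (\<integral>\<^sup>+x. (\<Sum>m\<in>M. ennreal (1 / w m) * ennreal ((sph_mean r (H m) x)\<^sup>2)) \<partial>lborel)"
      by (rule nn_integral_cmult) measurable
    also have "(\<integral>\<^sup>+x. (\<Sum>m\<in>M. ennreal (1 / w m) * ennreal ((sph_mean r (H m) x)\<^sup>2)) \<partial>lborel) =
       (\<Sum>m\<in>M. \<integral>\<^sup>+x. ennreal (1 / w m) * ennreal ((sph_mean r (H m) x)\<^sup>2) \<partial>lborel)"
      by (rule nn_integral_sum) measurable
    also have "\<dots> = (\<Sum>m\<in>M. ennreal (1 / w m) * (\<integral>\<^sup>+x. ennreal ((sph_mean r (H m) x)\<^sup>2) \<partial>lborel))"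
      by (intro sum.cong refl nn_integral_cmult) measurable
    finally show ?thesis .
  qed
  have "sph_square t (\<lambda>x. \<Sum>m\<in>M. H m x) \<le> (\<integral>\<^sup>+y. ?W * (\<Sum>m\<in>M. ennreal (1 / w m) *
      (indicator (ball 0 1) y * (\<integral>\<^sup>+x. ennreal ((sph_mean (t * norm y) (H m) x)\<^sup>2) \<partial>(lborel :: 'a measure)))) \<partial>(lborel :: 'a measure))"
    unfolding sph_square_def
  proof (rule nn_integral_mono)
    fix y :: 'a
    show "indicator (ball 0 1) y * (\<integral>\<^sup>+x. ennreal ((sph_mean (t * norm y) (\<lambda>x. \<Sum>m\<in>M. H m x) x)\<^sup>2) \<partial>(lborel :: 'a measure)) \<le>
       ?W * (\<Sum>m\<in>M. ennreal (1 / w m) * (indicator (ball 0 1) y * (\<integral>\<^sup>+x. ennreal ((sph_mean (t * norm y) (H m) x)\<^sup>2) \<partial>(lborel :: 'a measure))))"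
      using inner[of "t * norm y"] by (cases "y \<in> ball 0 1") simp_all
  qed
  also have "\<dots> = ?W * (\<integral>\<^sup>+y. (\<Sum>m\<in>M. ennreal (1 / w m) *
      (indicator (ball 0 1) y * (\<integral>\<^sup>+x. ennreal ((sph_mean (t * norm y) (H m) x)\<^sup>2) \<partial>(lborel :: 'a measure)))) \<partial>(lborel :: 'a measure))"
    by (rule nn_integral_cmult) measurable
  also have "(\<integral>\<^sup>+y. (\<Sum>m\<in>M. ennreal (1 / w m) *
      (indicator (ball 0 1) y * (\<integral>\<^sup>+x. ennreal ((sph_mean (t * norm y) (H m) x)\<^sup>2) \<partial>(lborel :: 'a measure)))) \<partial>(lborel :: 'a measure)) =
      (\<Sum>m\<in>M. \<integral>\<^sup>+y. ennreal (1 / w m) * (indicator (ball 0 1) y * (\<integral>\<^sup>+x. ennreal ((sph_mean (t * norm y) (H m) x)\<^sup>2) \<partial>(lborel :: 'a measure))) \<partial>(lborel :: 'a measure))"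
    by (rule nn_integral_sum) measurable
  also have "\<dots> = (\<Sum>m\<in>M. ennreal (1 / w m) * sph_square t (H m))"
    unfolding sph_square_def by (intro sum.cong refl nn_integral_cmult) measurable
  finally show ?thesis .
qed

lemma sum_int_telescope:
  fixes g :: "int \<Rightarrow> real"
  assumes "a \<le> b"
  shows "(\<Sum>k\<in>{a..b}. g (k - 1) - g k) = g (a - 1) - g b"
  using assms
proof (induction b rule: int_ge_induct)
  case (step i)
  have "{a..i + 1} = insert (i + 1) {a..i}" using step.hyps by auto
  then show ?case using step by simp
qed simp

lemma sqnorm_cube_avg_le:
  assumes "sqint f"
  shows "sqnorm (cube_avg j f) \<le> sqnorm f"
proof -
  have "0 \<le> (\<integral>x. (f x - cube_avg j f x)\<^sup>2 \<partial>lborel)" by simp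
  then show ?thesis unfolding integral_diff_cube_avg_square[OF assms] by (simp add: sqnorm_def)
qed

text \<open>The martingale difference \<open>m\<close> levels below the scale \<open>k\<close> has
  zero average over cubes of side \<open>2 powi (k - m)\<close>, so smoothing gains
  \<open>2 powr (- m / 2)\<close> for it. At fixed depth \<open>m\<close> the squared norms of these
  differences, summed over \<open>k\<close>, telescope to at most \<open>sqnorm f\<close>; the
  remaining sum over \<open>m\<close> is geometric. The constant does not depend on
  \<open>K\<close>, so the window of scales can later be exhausted.\<close>

lemma cube_avg_residual_square_function:
  assumes dim: "DIM('a::euclidean_space) \<ge> 2"
  obtains C where "0 < C" "\<And>(f :: 'a \<Rightarrow> real) K. sqint f \<Longrightarrow>
    (\<Sum>k\<in>{-int K..int K}. sph_square (2 powi k) (\<lambda>x. f x - cube_avg k f x)) \<le> ennreal (C * sqnorm f)"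
proof -
  let ?n = "DIM('a)"
  \<comment> \<open>\<open>\<mu>\<^sup>4 = 1 / sqrt 2\<close> is the decay per scale in the smoothing estimate; half of it, \<open>\<mu>\<^sup>2\<close>, pays
    for the weights of the Cauchy--Schwarz inequality.\<close>
  define \<mu> :: real where "\<mu> = (1/2) powr (1/8)"
  have mu: "0 < \<mu>" "\<mu> < 1"
    using powr_less_mono2[of "1/8" "1/2" 1] by (simp_all add: \<mu>_def)
  have mu8: "\<mu> ^ 8 = 1/2" unfolding \<mu>_def by (simp add: powr_power)
  have mu2: "0 < \<mu>\<^sup>2" "\<mu>\<^sup>2 < 1" using mu by (simp_all add: power_less_one_iff abs_square_less_1)
  define C0 where "C0 = (2 ^ ?n + unit_ball_vol ?n * ?n * 2 ^ ?n) * sqrt ?n"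
  define S where "S = 1 / (1 - \<mu>\<^sup>2)"
  have C0: "0 < C0" unfolding C0_def using DIM_positive[where 'a='a] by (intro mult_pos_pos add_pos_nonneg) auto
  have S: "0 < S" using mu2 by (simp add: S_def)
  have geo: "(\<Sum>m\<in>A. (\<mu>\<^sup>2) ^ m) \<le> S" if "finite A" for A
    unfolding S_def using mu2 that
    by (subst suminf_geometric[symmetric]) (auto intro!: sum_le_suminf summable_geometric)
  have main: "(\<Sum>k\<in>{-int K..int K}. sph_square (2 powi k) (\<lambda>x. f x - cube_avg k f x)) \<le> ennreal (S * C0 * (S + 1) * sqnorm f)"
    if f: "sqint f" for f :: "'a \<Rightarrow> real" and K :: nat
  proof -
    let ?I = "{-int K..int K}"
    define e where "e j = sqnorm (cube_avg j f)" for j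
    have e: "0 \<le> e j" "e j \<le> sqnorm f" for j
      by (simp_all add: e_def sqnorm_nonneg sqnorm_cube_avg_le[OF f])
    have "(\<lambda>n. (2 * real K + 1) * (\<mu>\<^sup>2) ^ n) \<longlonglongrightarrow> (2 * real K + 1) * 0"
      using mu2 by (intro tendsto_mult_left LIMSEQ_realpow_zero) auto
    then have "eventually (\<lambda>n. (2 * real K + 1) * (\<mu>\<^sup>2) ^ n < 1) sequentially"
      by (rule order_tendstoD) simp
    then obtain n0 where n0: "(2 * real K + 1) * (\<mu>\<^sup>2) ^ n0 < 1"
      by (auto simp: eventually_sequentially)
    \<comment> \<open>The martingale telescope is cut at a level \<open>n0\<close> so deep that the \<open>2 K + 1\<close> remainders together cost at
      most the norm of \<open>f\<close> once, which avoids the convergence of \<open>cube_avg j f\<close> as \<open>j\<close> tends to minus infinity.\<close>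
    define H where "H k m = (if m < n0 then (\<lambda>x. cube_avg (k - int m - 1) f x - cube_avg (k - int m) f x)
        else (\<lambda>x. f x - cube_avg (k - int n0) f x))" for k m
    have Hs: "sqint (H k m)" for k m
      unfolding H_def by (auto intro!: sqint_diff sqint_cube_avg f)
    have Hz: "cube_avg (k - int m) (H k m) x = 0" if "m \<le> n0" for k m x
    proof (cases "m < n0")
      case True
      then show ?thesis
        by (simp add: H_def cube_avg_diff sqint_cube_avg f cube_avg_cube_avg)
    next
      case False
      then have "m = n0" using that by simp
      then show ?thesis
        by (simp add: H_def cube_avg_diff sqint_cube_avg f cube_avg_cube_avg)
    qed
    have Hsum: "(\<Sum>m\<le>n0. H k m x) = f x - cube_avg k f x" for k x
    proof -
      have "(\<Sum>m<n. cube_avg (k - int m - 1) f x - cube_avg (k - int m) f x) = cube_avg (k - int n) f x - cube_avg k f x" for n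
        by (induction n) (simp_all add: algebra_simps)
      moreover have "(\<Sum>m\<le>n0. H k m x) = (\<Sum>m<n0. cube_avg (k - int m - 1) f x - cube_avg (k - int m) f x) + (f x - cube_avg (k - int n0) f x)"
        unfolding lessThan_Suc_atMost[symmetric] by (simp add: H_def)
      ultimately show ?thesis by simp
    qed
    \<comment> \<open>Smoothing at cube level \<open>k - int m\<close> and radius scale
      \<open>2 powi k\<close>: the square root of the ratio of the two scales is
      \<open>(\<mu> ^ m) ^ 4\<close>, because \<open>\<mu> ^ 8 = 1/2\<close>.\<close>
    have sq: "sph_square (2 powi k) (H k m) \<le> ennreal (C0 * (\<mu> ^ m) ^ 4 * sqnorm (H k m))" if "m \<le> n0" for k m
    proof -
      have "sqrt (?n * 2 powi (k - int m) / 2 powi k) = sqrt ?n * (\<mu> ^ m) ^ 4"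
      proof -
        have "2 powi (k - int m) / 2 powi k = (1/2::real) ^ m"
          by (simp add: power_int_diff power_divide)
        also have "\<dots> = ((\<mu> ^ m) ^ 4)\<^sup>2"
          unfolding mu8[symmetric] by (simp add: mult.commute flip: power_mult)
        finally have eq: "2 powi (k - int m) / 2 powi k = ((\<mu> ^ m) ^ 4)\<^sup>2" .
        have "sqrt (?n * 2 powi (k - int m) / 2 powi k) = sqrt (?n * ((\<mu> ^ m) ^ 4)\<^sup>2)"
          by (simp only: times_divide_eq_right[symmetric] eq)
        also have "\<dots> = sqrt ?n * (\<mu> ^ m) ^ 4"
          unfolding real_sqrt_mult using mu by (subst real_sqrt_abs) simp
        finally show ?thesis .
      qed
      then show ?thesis
        using sph_square_smoothing[OF Hs[of k m] Hz[OF that, of k] _ dim, of "2 powi k"] by (simp add: C0_def mult.assoc)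
    qed
    have one: "sph_square (2 powi k) (\<lambda>x. f x - cube_avg k f x) \<le> ennreal (S * C0 * (\<Sum>m\<le>n0. (\<mu>\<^sup>2) ^ m * sqnorm (H k m)))" for k
    proof -
      have "sph_square (2 powi k) (\<lambda>x. f x - cube_avg k f x) = sph_square (2 powi k) (\<lambda>x. \<Sum>m\<in>{..n0}. H k m x)"
        by (simp add: Hsum)
      also have "\<dots> \<le> ennreal (\<Sum>m\<in>{..n0}. (\<mu>\<^sup>2) ^ m) * (\<Sum>m\<in>{..n0}. ennreal (1 / (\<mu>\<^sup>2) ^ m) * sph_square (2 powi k) (H k m))"
        using mu by (intro sph_square_sum_le Hs) auto
      also have "\<dots> \<le> ennreal S * (\<Sum>m\<in>{..n0}. ennreal (1 / (\<mu>\<^sup>2) ^ m) * ennreal (C0 * (\<mu> ^ m) ^ 4 * sqnorm (H k m)))"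
        by (intro mult_mono sum_mono ennreal_leI geo sq) auto
      also have "\<dots> = ennreal S * (\<Sum>m\<in>{..n0}. ennreal (C0 * ((\<mu>\<^sup>2) ^ m * sqnorm (H k m))))"
      proof (intro arg_cong[where f="\<lambda>x. ennreal S * x"] sum.cong refl)
        fix m
        have "(\<mu> ^ m) ^ 4 = (\<mu>\<^sup>2) ^ m * (\<mu>\<^sup>2) ^ m" by (simp flip: power_mult power_add) (simp add: mult.commute)
        then have "C0 * ((\<mu>\<^sup>2) ^ m * sqnorm (H k m)) = 1 / (\<mu>\<^sup>2) ^ m * (C0 * (\<mu> ^ m) ^ 4 * sqnorm (H k m))"
          using mu by simp
        then show "ennreal (1 / (\<mu>\<^sup>2) ^ m) * ennreal (C0 * (\<mu> ^ m) ^ 4 * sqnorm (H k m)) = ennreal (C0 * ((\<mu>\<^sup>2) ^ m * sqnorm (H k m)))"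
          using mu by (simp only: ennreal_mult'[symmetric] zero_le_divide_1_iff zero_le_power)
      qed
      also have "\<dots> = ennreal S * ennreal (\<Sum>m\<in>{..n0}. C0 * ((\<mu>\<^sup>2) ^ m * sqnorm (H k m)))"
        using C0 mu sqnorm_nonneg by (subst sum_ennreal) (auto intro!: mult_nonneg_nonneg)
      also have "\<dots> = ennreal (S * (\<Sum>m\<in>{..n0}. C0 * ((\<mu>\<^sup>2) ^ m * sqnorm (H k m))))"
        using S by (intro ennreal_mult'[symmetric]) simp
      finally show ?thesis by (simp add: sum_distrib_left mult.assoc)
    qed
    have "(\<Sum>k\<in>?I. \<Sum>m\<le>n0. (\<mu>\<^sup>2) ^ m * sqnorm (H k m)) = (\<Sum>m\<le>n0. (\<mu>\<^sup>2) ^ m * (\<Sum>k\<in>?I. sqnorm (H k m)))"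
      by (subst sum.swap) (simp add: sum_distrib_left)
    also have "\<dots> = (\<Sum>m<n0. (\<mu>\<^sup>2) ^ m * (\<Sum>k\<in>?I. sqnorm (H k m))) + (\<mu>\<^sup>2) ^ n0 * (\<Sum>k\<in>?I. sqnorm (H k n0))"
      unfolding lessThan_Suc_atMost[symmetric] by simp
    also have "\<dots> \<le> (\<Sum>m<n0. (\<mu>\<^sup>2) ^ m * sqnorm f) + (\<mu>\<^sup>2) ^ n0 * (\<Sum>k\<in>?I. sqnorm f)"
    proof (intro add_mono sum_mono mult_left_mono)
      \<comment> \<open>At fixed depth the squared norms are differences of consecutive energies, so
        their sum over \<open>k\<close> is at most the largest energy, however many scales are
        involved.\<close>
      fix m assume "m \<in> {..<n0}"
      then have "sqnorm (H k m) = e (k - 1 - int m) - e (k - int m)" for k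
        unfolding H_def sqnorm_def e_def using integral_cube_avg_diff_square[OF f, of "k - int m - 1" "k - int m"]
        by (simp add: algebra_simps)
      then have "(\<Sum>k\<in>?I. sqnorm (H k m)) = (\<Sum>k\<in>?I. e (k - 1 - int m) - e (k - int m))" by simp
      also have "\<dots> = e (- int K - 1 - int m) - e (int K - int m)"
        by (rule sum_int_telescope[where g="\<lambda>k. e (k - int m)"]) simp
      also have "\<dots> \<le> sqnorm f" using e[of "- int K - 1 - int m"] e[of "int K - int m"] by linarith
      finally show "(\<Sum>k\<in>?I. sqnorm (H k m)) \<le> sqnorm f" .
    next
      fix k
      show "sqnorm (H k n0) \<le> sqnorm f"
        unfolding H_def sqnorm_def using integral_diff_cube_avg_square[OF f, of "k - int n0"] by simp
    qed (use mu in auto)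
    also have "\<dots> = (\<Sum>m<n0. (\<mu>\<^sup>2) ^ m) * sqnorm f + (2 * real K + 1) * (\<mu>\<^sup>2) ^ n0 * sqnorm f"
      by (simp add: sum_distrib_right)
    also have "\<dots> \<le> S * sqnorm f + 1 * sqnorm f"
      using n0 by (intro add_mono mult_right_mono geo sqnorm_nonneg) auto
    finally have tot: "(\<Sum>k\<in>?I. \<Sum>m\<le>n0. (\<mu>\<^sup>2) ^ m * sqnorm (H k m)) \<le> (S + 1) * sqnorm f"
      by (simp add: algebra_simps)
    have "(\<Sum>k\<in>?I. sph_square (2 powi k) (\<lambda>x. f x - cube_avg k f x)) \<le>
      (\<Sum>k\<in>?I. ennreal (S * C0 * (\<Sum>m\<le>n0. (\<mu>\<^sup>2) ^ m * sqnorm (H k m))))"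
      by (intro sum_mono one)
    also have "\<dots> = ennreal (\<Sum>k\<in>?I. S * C0 * (\<Sum>m\<le>n0. (\<mu>\<^sup>2) ^ m * sqnorm (H k m)))"
      using C0 S mu by (intro sum_ennreal mult_nonneg_nonneg sum_nonneg) (auto simp: sqnorm_nonneg)
    also have "\<dots> \<le> ennreal (S * C0 * (S + 1) * sqnorm f)"
      using tot C0 S by (intro ennreal_leI) (simp add: mult.assoc mult_left_mono flip: sum_distrib_left)
    finally show ?thesis .
  qed
  show ?thesis
    by (rule that[of "S * C0 * (S + 1)"]) (use S C0 main in auto)
qed

section \<open>Bilinear spherical averages of square integrable functions\<close>

lemma nn_integral_ball_translate_le_hl_max:
  fixes \<Phi> :: "'a::euclidean_space \<Rightarrow> ennreal"
  assumes [measurable]: "\<Phi> \<in> borel_measurable borel"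
  shows "(\<integral>\<^sup>+y. indicator (ball 0 1) y * \<Phi> (x - 2 powi k *\<^sub>R y) \<partial>lborel) \<le> ennreal (unit_ball_vol DIM('a)) * hl_max \<Phi> x"
proof -
  let ?r = "2 powi k :: real" and ?n = "DIM('a)" and ?V = "unit_ball_vol DIM('a)"
  have "(\<integral>\<^sup>+u. \<Phi> u * indicator (ball x ?r) u \<partial>lborel) =
     ennreal (\<bar>- ?r\<bar> ^ ?n) * (\<integral>\<^sup>+y. \<Phi> (x + (- ?r) *\<^sub>R y) * indicator (ball x ?r) (x + (- ?r) *\<^sub>R y) \<partial>lborel)"
    by (rule nn_integral_lborel_affine) auto
  also have "(\<integral>\<^sup>+y. \<Phi> (x + (- ?r) *\<^sub>R y) * indicator (ball x ?r) (x + (- ?r) *\<^sub>R y) \<partial>lborel) =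
     (\<integral>\<^sup>+y. indicator (ball 0 1) y * \<Phi> (x - ?r *\<^sub>R y) \<partial>lborel)"
    by (intro nn_integral_cong) (simp add: indicator_def dist_norm)
  finally have eq: "(\<integral>\<^sup>+u. \<Phi> u * indicator (ball x ?r) u \<partial>lborel) =
     ennreal (?r ^ ?n) * (\<integral>\<^sup>+y. indicator (ball 0 1) y * \<Phi> (x - ?r *\<^sub>R y) \<partial>lborel)"
    by simp
  let ?J = "\<integral>\<^sup>+y. indicator (ball 0 1) y * \<Phi> (x - ?r *\<^sub>R y) \<partial>lborel"
  have nz: "ennreal (?r ^ ?n) \<noteq> 0" "ennreal (?r ^ ?n) \<noteq> \<infinity>" "ennreal ?V \<noteq> 0" "ennreal ?V \<noteq> \<infinity>"
    by (simp_all add: ennreal_eq_0_iff not_le)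
  have "?J = ennreal ?V * (?J / ennreal ?V)"
    using nz by (simp add: ennreal_times_divide mult_divide_eq_ennreal mult.commute[of "ennreal ?V"])
  also have "?J / ennreal ?V = (?J * ennreal (?r ^ ?n)) / (ennreal ?V * ennreal (?r ^ ?n))"
    by (rule divide_mult_eq[symmetric]) (use nz in auto)
  also have "\<dots> = (\<integral>\<^sup>+u. \<Phi> u * indicator (ball x ?r) u \<partial>lborel) / emeasure lborel (ball (0::'a) ?r)"
    unfolding eq by (simp add: emeasure_ball ennreal_mult mult.commute)
  also have "ennreal ?V * \<dots> \<le> ennreal ?V * hl_max \<Phi> x"
    unfolding hl_max_def by (intro mult_left_mono SUP_upper) auto
  finally show ?thesis .
qed

lemma borel_measurable_fst_snd_prod [measurable]:
  "fst \<in> borel_measurable (borel :: ('a::euclidean_space \<times> 'b::euclidean_space) measure)"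
  "snd \<in> borel_measurable (borel :: ('a::euclidean_space \<times> 'b::euclidean_space) measure)"
  unfolding borel_prod[symmetric] by measurable

text \<open>An upper bound for the density of either component of a uniform point on the large
  sphere. It depends on the dimension only, which the type argument carries.\<close>

definition marg_const :: "'a::euclidean_space itself \<Rightarrow> real" where
  "marg_const _ = unit_ball_vol DIM('a) / unit_ball_vol DIM('a \<times> 'a)"

lemma marg_const_pos: "0 < marg_const TYPE('a::euclidean_space)"
  by (simp add: marg_const_def)

lemma nn_integral_usph_marginals_le:
  fixes \<Phi> :: "'a::euclidean_space \<Rightarrow> ennreal"
  assumes [measurable]: "\<Phi> \<in> borel_measurable borel" and dim: "DIM('a) \<ge> 2"
  shows "(\<integral>\<^sup>+w. \<Phi> (fst w) \<partial>(usph :: ('a \<times> 'a) measure)) \<le> ennreal (marg_const TYPE('a)) * (\<integral>\<^sup>+y. indicator (ball 0 1) y * \<Phi> y \<partial>lborel)"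
    and "(\<integral>\<^sup>+w. \<Phi> (snd w) \<partial>(usph :: ('a \<times> 'a) measure)) \<le> ennreal (marg_const TYPE('a)) * (\<integral>\<^sup>+y. indicator (ball 0 1) y * \<Phi> y \<partial>lborel)"
  unfolding marg_const_def
  by (rule nn_integral_usph_fst_le nn_integral_usph_snd_le; use assms in simp)+

text \<open>The price of passing from an average over one component of the sphere to a normalised
  average over a ball: the density bound times the volume of the unit ball.\<close>

definition avg_const :: "'a::euclidean_space itself \<Rightarrow> real" where
  "avg_const _ = marg_const TYPE('a) * unit_ball_vol DIM('a)"

lemma avg_const_nonneg: "0 \<le> avg_const TYPE('a::euclidean_space)"
  using marg_const_pos[where 'a='a] by (simp add: avg_const_def)

lemma nn_integral_usph_translate_le_hl_max:
  fixes \<Phi> :: "'a::euclidean_space \<Rightarrow> ennreal"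
  assumes [measurable]: "\<Phi> \<in> borel_measurable borel" and dim: "DIM('a) \<ge> 2"
  shows "(\<integral>\<^sup>+w. \<Phi> (x - 2 powi k *\<^sub>R fst w) \<partial>(usph :: ('a \<times> 'a) measure)) \<le> ennreal (avg_const TYPE('a)) * hl_max \<Phi> x"
    and "(\<integral>\<^sup>+w. \<Phi> (x - 2 powi k *\<^sub>R snd w) \<partial>(usph :: ('a \<times> 'a) measure)) \<le> ennreal (avg_const TYPE('a)) * hl_max \<Phi> x"
proof -
  let ?J = "\<integral>\<^sup>+y. indicator (ball 0 1) y * \<Phi> (x - 2 powi k *\<^sub>R y) \<partial>lborel"
  have m: "(\<lambda>y. \<Phi> (x - 2 powi k *\<^sub>R y)) \<in> borel_measurable borel" by measurable
  have "ennreal (marg_const TYPE('a)) * ?J \<le> ennreal (marg_const TYPE('a)) * (ennreal (unit_ball_vol DIM('a)) * hl_max \<Phi> x)"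
    by (intro mult_left_mono nn_integral_ball_translate_le_hl_max) auto
  also have "\<dots> = ennreal (avg_const TYPE('a)) * hl_max \<Phi> x"
    unfolding avg_const_def using marg_const_pos[where 'a='a] by (simp add: ennreal_mult mult.assoc)
  finally have *: "ennreal (marg_const TYPE('a)) * ?J \<le> ennreal (avg_const TYPE('a)) * hl_max \<Phi> x" .
  show "(\<integral>\<^sup>+w. \<Phi> (x - 2 powi k *\<^sub>R fst w) \<partial>(usph :: ('a \<times> 'a) measure)) \<le> ennreal (avg_const TYPE('a)) * hl_max \<Phi> x"
    using nn_integral_usph_marginals_le(1)[OF m dim] * by (rule order_trans)
  show "(\<integral>\<^sup>+w. \<Phi> (x - 2 powi k *\<^sub>R snd w) \<partial>(usph :: ('a \<times> 'a) measure)) \<le> ennreal (avg_const TYPE('a)) * hl_max \<Phi> x"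
    using nn_integral_usph_marginals_le(2)[OF m dim] * by (rule order_trans)
qed

text \<open>The bilinear average for real functions and the normalised measure. Complex functions
  and the mass of the sphere are restored at the end.\<close>

definition bilin :: "real \<Rightarrow> ('a::euclidean_space \<Rightarrow> real) \<Rightarrow> ('a \<Rightarrow> real) \<Rightarrow> 'a \<Rightarrow> real" where
  "bilin t F G x = (\<integral>w. F (x - t *\<^sub>R fst w) * G (x - t *\<^sub>R snd w) \<partial>usph)"

lemma bilin_measurable [measurable]:
  assumes [measurable]: "F \<in> borel_measurable borel" "G \<in> borel_measurable borel"
  shows "bilin t F G \<in> borel_measurable borel"
  unfolding bilin_def[abs_def] by measurable

lemma bilin_scale: "bilin t (\<lambda>x. a * F x) (\<lambda>x. b * G x) x = a * b * bilin t F G x"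
proof -
  have "bilin t (\<lambda>x. a * F x) (\<lambda>x. b * G x) x = (\<integral>w. (a * b) * (F (x - t *\<^sub>R fst w) * G (x - t *\<^sub>R snd w)) \<partial>usph)"
    unfolding bilin_def by (intro Bochner_Integration.integral_cong refl) (simp add: mult_ac)
  then show ?thesis by (simp add: bilin_def)
qed

lemma nn_integral_ball_square_finite:
  fixes h :: "'a::euclidean_space \<Rightarrow> real"
  assumes h: "sqint h" and t: "t \<noteq> 0"
  shows "(\<integral>\<^sup>+y. indicator (ball 0 1) y * ennreal ((h (x - t *\<^sub>R y))\<^sup>2) \<partial>lborel) < \<infinity>"
proof -
  note [measurable] = sqint_measurable[OF h]
  have "ennreal (sqnorm h) = (\<integral>\<^sup>+u. ennreal ((h u)\<^sup>2) \<partial>lborel)" by (rule nn_integral_square[OF h, symmetric])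
  also have "\<dots> = ennreal (\<bar>- t\<bar> ^ DIM('a)) * (\<integral>\<^sup>+y. ennreal ((h (x + (- t) *\<^sub>R y))\<^sup>2) \<partial>lborel)"
    by (rule nn_integral_lborel_affine) (use t in auto)
  finally have eq: "ennreal (sqnorm h) = ennreal (\<bar>- t\<bar> ^ DIM('a)) * (\<integral>\<^sup>+y. ennreal ((h (x + (- t) *\<^sub>R y))\<^sup>2) \<partial>lborel)" .
  have "(\<integral>\<^sup>+y. ennreal ((h (x + (- t) *\<^sub>R y))\<^sup>2) \<partial>lborel) = (\<integral>\<^sup>+y. ennreal ((h (x - t *\<^sub>R y))\<^sup>2) \<partial>lborel)"
    by (intro nn_integral_cong) simp
  then have "ennreal (\<bar>- t\<bar> ^ DIM('a)) * (\<integral>\<^sup>+y. ennreal ((h (x - t *\<^sub>R y))\<^sup>2) \<partial>lborel) = ennreal (sqnorm h)"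
    unfolding eq by (simp only:)
  then have "ennreal (\<bar>- t\<bar> ^ DIM('a)) * (\<integral>\<^sup>+y. ennreal ((h (x - t *\<^sub>R y))\<^sup>2) \<partial>lborel) < \<infinity>"
    by (simp only: ennreal_less_top infinity_ennreal_def)
  moreover have nz: "ennreal (\<bar>- t\<bar> ^ DIM('a)) \<noteq> 0"
    using t by (subst ennreal_eq_0_iff) (simp add: not_le)
  ultimately have "(\<integral>\<^sup>+y. ennreal ((h (x - t *\<^sub>R y))\<^sup>2) \<partial>lborel) < \<infinity>"
    using nz by (simp only: ennreal_mult_less_top infinity_ennreal_def) (auto simp del: ennreal_eq_0_iff abs_minus_cancel)
  moreover have "(\<integral>\<^sup>+y. indicator (ball 0 1) y * ennreal ((h (x - t *\<^sub>R y))\<^sup>2) \<partial>lborel) \<le> (\<integral>\<^sup>+y. ennreal ((h (x - t *\<^sub>R y))\<^sup>2) \<partial>lborel)"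
    by (intro nn_integral_mono) (simp add: indicator_def)
  ultimately show ?thesis by (rule le_less_trans[rotated])
qed

text \<open>The product is dominated by a sum of squares in separate components, and each component
  has bounded density. Hence integrability holds at every \<open>x\<close>, in contrast to the
  spherical means of the single functions.\<close>

lemma integrable_bilin:
  fixes F G :: "'a::euclidean_space \<Rightarrow> real"
  assumes F: "sqint F" and G: "sqint G" and t: "t \<noteq> 0" and dim: "DIM('a) \<ge> 2"
  shows "integrable usph (\<lambda>w. F (x - t *\<^sub>R fst w) * G (x - t *\<^sub>R snd w))"
proof (rule integrableI_bounded)
  note [measurable] = sqint_measurable[OF F] sqint_measurable[OF G]
  show "(\<lambda>w. F (x - t *\<^sub>R fst w) * G (x - t *\<^sub>R snd w)) \<in> borel_measurable usph" by measurable
  have "(\<integral>\<^sup>+w. ennreal (norm (F (x - t *\<^sub>R fst w) * G (x - t *\<^sub>R snd w))) \<partial>(usph :: ('a \<times> 'a) measure)) \<le>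
     (\<integral>\<^sup>+w. ennreal ((F (x - t *\<^sub>R fst w))\<^sup>2) + ennreal ((G (x - t *\<^sub>R snd w))\<^sup>2) \<partial>(usph :: ('a \<times> 'a) measure))"
  proof (rule nn_integral_mono)
    fix w :: "'a \<times> 'a"
    have "\<bar>a * b\<bar> \<le> a\<^sup>2 + b\<^sup>2" for a b :: real
      by (rule order_trans[OF abs_mult_le_half_squares]) simp
    then show "ennreal (norm (F (x - t *\<^sub>R fst w) * G (x - t *\<^sub>R snd w))) \<le> ennreal ((F (x - t *\<^sub>R fst w))\<^sup>2) + ennreal ((G (x - t *\<^sub>R snd w))\<^sup>2)"
      by (simp flip: ennreal_plus)
  qed
  also have "\<dots> = (\<integral>\<^sup>+w. ennreal ((F (x - t *\<^sub>R fst w))\<^sup>2) \<partial>(usph :: ('a \<times> 'a) measure)) + (\<integral>\<^sup>+w. ennreal ((G (x - t *\<^sub>R snd w))\<^sup>2) \<partial>(usph :: ('a \<times> 'a) measure))"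
    by (rule nn_integral_add) measurable
  also have "\<dots> < \<infinity>"
  proof -
    have "(\<integral>\<^sup>+w. ennreal ((F (x - t *\<^sub>R fst w))\<^sup>2) \<partial>(usph :: ('a \<times> 'a) measure)) \<le>
      ennreal (marg_const TYPE('a)) * (\<integral>\<^sup>+y. indicator (ball 0 1) y * ennreal ((F (x - t *\<^sub>R y))\<^sup>2) \<partial>lborel)"
      by (rule nn_integral_usph_marginals_le(1)[of "\<lambda>y. ennreal ((F (x - t *\<^sub>R y))\<^sup>2)"]) (use dim in auto)
    also have "\<dots> < \<infinity>" using nn_integral_ball_square_finite[OF F t, of x] by (simp add: ennreal_mult_less_top)
    finally have 1: "(\<integral>\<^sup>+w. ennreal ((F (x - t *\<^sub>R fst w))\<^sup>2) \<partial>(usph :: ('a \<times> 'a) measure)) < \<infinity>" .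
    have "(\<integral>\<^sup>+w. ennreal ((G (x - t *\<^sub>R snd w))\<^sup>2) \<partial>(usph :: ('a \<times> 'a) measure)) \<le>
      ennreal (marg_const TYPE('a)) * (\<integral>\<^sup>+y. indicator (ball 0 1) y * ennreal ((G (x - t *\<^sub>R y))\<^sup>2) \<partial>lborel)"
      by (rule nn_integral_usph_marginals_le(2)[of "\<lambda>y. ennreal ((G (x - t *\<^sub>R y))\<^sup>2)"]) (use dim in auto)
    also have "\<dots> < \<infinity>" using nn_integral_ball_square_finite[OF G t, of x] by (simp add: ennreal_mult_less_top)
    finally have 2: "(\<integral>\<^sup>+w. ennreal ((G (x - t *\<^sub>R snd w))\<^sup>2) \<partial>(usph :: ('a \<times> 'a) measure)) < \<infinity>" .
    show ?thesis using 1 2 by simp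
  qed
  finally show "(\<integral>\<^sup>+w. ennreal (norm (F (x - t *\<^sub>R fst w) * G (x - t *\<^sub>R snd w))) \<partial>(usph :: ('a \<times> 'a) measure)) < \<infinity>" .
qed

text \<open>Independent rotations of the two components are inserted and integrated first. For fixed
  norms of the components the integrand is a product of a function of \<open>\<theta>\<close> and
  one of \<open>\<theta>'\<close>, and each factor integrates to a spherical mean.\<close>

lemma bilin_eq_sph_means:
  fixes F G :: "'a::euclidean_space \<Rightarrow> real"
  assumes F: "sqint F" and G: "sqint G" and t: "t \<noteq> 0" and dim: "DIM('a) \<ge> 2"
  shows "bilin t F G x = (\<integral>w. sph_mean (t * norm (fst w)) F x * sph_mean (t * norm (snd w)) G x \<partial>(usph :: ('a \<times> 'a) measure))"
    and "integrable (usph :: ('a \<times> 'a) measure) (\<lambda>w. sph_mean (t * norm (fst w)) F x * sph_mean (t * norm (snd w)) G x)"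
proof -
  note [measurable] = sqint_measurable[OF F] sqint_measurable[OF G]
  interpret U: pair_prob_space "usph :: 'a measure" "usph :: 'a measure" ..
  interpret P: pair_sigma_finite "usph :: ('a \<times> 'a) measure" "(usph :: 'a measure) \<Otimes>\<^sub>M (usph :: 'a measure)" ..
  let ?P = "(usph :: ('a \<times> 'a) measure) \<Otimes>\<^sub>M ((usph :: 'a measure) \<Otimes>\<^sub>M (usph :: 'a measure))"
  let ?T = "\<lambda>(w :: 'a \<times> 'a, \<theta> :: 'a, \<theta>' :: 'a). (norm (fst w) *\<^sub>R \<theta>, norm (snd w) *\<^sub>R \<theta>')"
  let ?\<Psi> = "\<lambda>w. F (x - t *\<^sub>R fst w) * G (x - t *\<^sub>R snd w)"
  have T: "?T \<in> ?P \<rightarrow>\<^sub>M borel"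
  proof -
    have "(\<lambda>p. norm (fst (fst p)) *\<^sub>R fst (snd p)) \<in> borel_measurable ?P" "(\<lambda>p. norm (snd (fst p)) *\<^sub>R snd (snd p)) \<in> borel_measurable ?P"
      by measurable
    then have "(\<lambda>p. (norm (fst (fst p)) *\<^sub>R fst (snd p), norm (snd (fst p)) *\<^sub>R snd (snd p))) \<in> ?P \<rightarrow>\<^sub>M borel \<Otimes>\<^sub>M borel"
      by (rule measurable_Pair)
    then show ?thesis unfolding borel_prod by (simp add: case_prod_unfold)
  qed
  have \<Psi>: "?\<Psi> \<in> borel_measurable borel" by measurable
  define G' where "G' w q = ?\<Psi> (?T (w, q))" for w q
  have int: "integrable ?P (case_prod G')"
  proof -
    have "integrable (distr ?P borel ?T) ?\<Psi>"
      unfolding distr_usph_prod by (rule integrable_bilin[OF F G t dim])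
    then have "integrable ?P (\<lambda>p. ?\<Psi> (?T p))" by (rule integrable_distr[OF T])
    then show ?thesis by (simp add: G'_def case_prod_unfold)
  qed
  have inner: "AE w in usph. (\<integral>q. G' w q \<partial>(usph \<Otimes>\<^sub>M usph)) = sph_mean (t * norm (fst w)) F x * sph_mean (t * norm (snd w)) G x"
    using P.AE_integrable_fst[OF int]
  proof eventually_elim
    case (elim w)
    have "(\<integral>q. G' w q \<partial>(usph \<Otimes>\<^sub>M usph)) = (\<integral>\<theta>. (\<integral>\<theta>'. G' w (\<theta>, \<theta>') \<partial>usph) \<partial>usph)"
      by (rule U.integral_fst'[symmetric]) (rule elim)
    also have "\<dots> = (\<integral>\<theta>. F (x - (t * norm (fst w)) *\<^sub>R \<theta>) * sph_mean (t * norm (snd w)) G x \<partial>usph)"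
      by (simp add: G'_def sph_mean_def)
    also have "\<dots> = sph_mean (t * norm (fst w)) F x * sph_mean (t * norm (snd w)) G x"
      by (simp add: sph_mean_def)
    finally show ?case .
  qed
  have m: "(\<lambda>w. sph_mean (t * norm (fst w)) F x * sph_mean (t * norm (snd w)) G x) \<in> borel_measurable (usph :: ('a \<times> 'a) measure)"
    by measurable
  have "bilin t F G x = (\<integral>w. ?\<Psi> w \<partial>distr ?P borel ?T)"
    unfolding bilin_def distr_usph_prod ..
  also have "\<dots> = (\<integral>p. case_prod G' p \<partial>?P)"
    by (subst integral_distr[OF T]) (use \<Psi> in \<open>auto simp: G'_def case_prod_unfold\<close>)
  also have "\<dots> = (\<integral>w. (\<integral>q. G' w q \<partial>(usph \<Otimes>\<^sub>M usph)) \<partial>usph)"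
    by (rule P.integral_fst[OF int, symmetric])
  also have "\<dots> = (\<integral>w. sph_mean (t * norm (fst w)) F x * sph_mean (t * norm (snd w)) G x \<partial>(usph :: ('a \<times> 'a) measure))"
    by (rule integral_cong_AE) (use inner m borel_measurable_integrable[OF P.integrable_fst[OF int]] in auto)
  finally show "bilin t F G x = \<dots>" .
  show "integrable (usph :: ('a \<times> 'a) measure) (\<lambda>w. sph_mean (t * norm (fst w)) F x * sph_mean (t * norm (snd w)) G x)"
    by (rule integrable_cong_AE_imp[OF P.integrable_fst[OF int] m]) (use inner in \<open>auto elim!: eventually_mono\<close>)
qed

text \<open>After Young's inequality each square involves one component only; the bounded density of
  that component produces the average over radii in \<open>sph_square\<close>. No absolute value is
  taken inside a spherical mean, so cancellation in \<open>F\<close> and in \<open>G\<close> is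
  preserved.\<close>

lemma nn_integral_bilin_le:
  fixes F G :: "'a::euclidean_space \<Rightarrow> real"
  assumes F: "sqint F" and G: "sqint G" and t: "t \<noteq> 0" and dim: "DIM('a) \<ge> 2"
  shows "(\<integral>\<^sup>+x. ennreal \<bar>bilin t F G x\<bar> \<partial>lborel) \<le> ennreal (marg_const TYPE('a)) * (sph_square t F + sph_square t G)"
proof -
  note [measurable] = sqint_measurable[OF F] sqint_measurable[OF G]
  let ?c = "ennreal (marg_const TYPE('a))"
  let ?Q = "\<lambda>h x. \<integral>\<^sup>+y. indicator (ball 0 1) y * ennreal ((sph_mean (t * norm y) h x)\<^sup>2) \<partial>(lborel :: 'a measure)"
  have pt: "ennreal \<bar>bilin t F G x\<bar> \<le> ?c * ?Q F x + ?c * ?Q G x" for x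
  proof -
    have "ennreal \<bar>bilin t F G x\<bar> \<le> (\<integral>\<^sup>+w. ennreal (norm (sph_mean (t * norm (fst w)) F x * sph_mean (t * norm (snd w)) G x)) \<partial>(usph :: ('a \<times> 'a) measure))"
      unfolding bilin_eq_sph_means(1)[OF assms] using integral_norm_bound_ennreal[OF bilin_eq_sph_means(2)[OF assms]] by simp
    also have "\<dots> \<le> (\<integral>\<^sup>+w. ennreal ((sph_mean (t * norm (fst w)) F x)\<^sup>2) + ennreal ((sph_mean (t * norm (snd w)) G x)\<^sup>2) \<partial>(usph :: ('a \<times> 'a) measure))"
    proof (rule nn_integral_mono)
      fix w :: "'a \<times> 'a"
      have "\<bar>a * b\<bar> \<le> a\<^sup>2 + b\<^sup>2" for a b :: real
        by (rule order_trans[OF abs_mult_le_half_squares]) simp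
      then show "ennreal (norm (sph_mean (t * norm (fst w)) F x * sph_mean (t * norm (snd w)) G x)) \<le>
        ennreal ((sph_mean (t * norm (fst w)) F x)\<^sup>2) + ennreal ((sph_mean (t * norm (snd w)) G x)\<^sup>2)"
        by (simp flip: ennreal_plus)
    qed
    also have "\<dots> = (\<integral>\<^sup>+w. ennreal ((sph_mean (t * norm (fst w)) F x)\<^sup>2) \<partial>(usph :: ('a \<times> 'a) measure)) +
        (\<integral>\<^sup>+w. ennreal ((sph_mean (t * norm (snd w)) G x)\<^sup>2) \<partial>(usph :: ('a \<times> 'a) measure))"
      by (rule nn_integral_add) measurable
    also have "\<dots> \<le> ?c * ?Q F x + ?c * ?Q G x"
    proof (rule add_mono)
      show "(\<integral>\<^sup>+w. ennreal ((sph_mean (t * norm (fst w)) F x)\<^sup>2) \<partial>(usph :: ('a \<times> 'a) measure)) \<le> ?c * ?Q F x"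
        by (rule nn_integral_usph_marginals_le(1)[of "\<lambda>y. ennreal ((sph_mean (t * norm y) F x)\<^sup>2)"]) (use dim in auto)
      show "(\<integral>\<^sup>+w. ennreal ((sph_mean (t * norm (snd w)) G x)\<^sup>2) \<partial>(usph :: ('a \<times> 'a) measure)) \<le> ?c * ?Q G x"
        by (rule nn_integral_usph_marginals_le(2)[of "\<lambda>y. ennreal ((sph_mean (t * norm y) G x)\<^sup>2)"]) (use dim in auto)
    qed
    finally show ?thesis .
  qed
  have Q: "(\<integral>\<^sup>+x. ?Q h x \<partial>lborel) = sph_square t h" if [measurable]: "h \<in> borel_measurable borel" for h :: "'a \<Rightarrow> real"
  proof -
    have "(\<integral>\<^sup>+x. ?Q h x \<partial>lborel) = (\<integral>\<^sup>+y. \<integral>\<^sup>+x. indicator (ball 0 1) y * ennreal ((sph_mean (t * norm y) h x)\<^sup>2) \<partial>lborel \<partial>(lborel :: 'a measure))"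
      by (rule lborel_pair.Fubini'[symmetric]) measurable
    also have "\<dots> = sph_square t h"
      unfolding sph_square_def by (intro nn_integral_cong nn_integral_cmult) measurable
    finally show ?thesis .
  qed
  have "(\<integral>\<^sup>+x. ennreal \<bar>bilin t F G x\<bar> \<partial>lborel) \<le> (\<integral>\<^sup>+x. ?c * ?Q F x + ?c * ?Q G x \<partial>lborel)"
    by (rule nn_integral_mono) (rule pt)
  also have "\<dots> = (\<integral>\<^sup>+x. ?c * ?Q F x \<partial>lborel) + (\<integral>\<^sup>+x. ?c * ?Q G x \<partial>lborel)"
    by (rule nn_integral_add) measurable
  also have "(\<integral>\<^sup>+x. ?c * ?Q F x \<partial>lborel) = ?c * (\<integral>\<^sup>+x. ?Q F x \<partial>lborel)"
    by (rule nn_integral_cmult) measurable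
  also have "(\<integral>\<^sup>+x. ?c * ?Q G x \<partial>lborel) = ?c * (\<integral>\<^sup>+x. ?Q G x \<partial>lborel)"
    by (rule nn_integral_cmult) measurable
  finally show ?thesis by (simp add: Q distrib_left)
qed

definition cube_const :: "'a::euclidean_space itself \<Rightarrow> ennreal" where
  "cube_const _ = ennreal (unit_ball_vol DIM('a) * (2 ^ (DIM('a) + 1)) ^ DIM('a))"

lemma abs_bilin_le:
  fixes F G :: "'a::euclidean_space \<Rightarrow> real"
  assumes F: "sqint F" and G: "sqint G" and t: "t \<noteq> 0" and dim: "DIM('a) \<ge> 2"
  shows "ennreal \<bar>bilin t F G x\<bar> \<le> (\<integral>\<^sup>+w. ennreal \<bar>F (x - t *\<^sub>R fst w)\<bar> * ennreal \<bar>G (x - t *\<^sub>R snd w)\<bar> \<partial>(usph :: ('a \<times> 'a) measure))"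
  unfolding bilin_def
  using integral_norm_bound_ennreal[OF integrable_bilin[OF assms, of x]] by (simp add: abs_mult ennreal_mult)

lemma AE_usph_fst_snd: "AE w in (usph :: ('a::euclidean_space \<times> 'a) measure). norm (fst w) \<le> 1 \<and> norm (snd w) \<le> 1"
  using AE_usph_norm
proof eventually_elim
  case (elim w)
  then show ?case using norm_fst_le[of "fst w" "snd w"] norm_snd_le[of "snd w" "fst w"] by simp
qed

text \<open>With \<open>E\<close> for \<open>cube_avg k\<close>, the product splits as
  \<open>(F - E F) (G - E G) + (E F) G + (F - E F) (E G)\<close>. At scale \<open>2 powi k\<close> a
  cube average is bounded on the whole sphere by a multiple of the maximal function at the centre
  \<open>x\<close>, so it leaves the integral, and the other factor integrates to its own maximal
  function. The last two terms contribute \<open>C A\<close> and \<open>(A + C) C\<close>, which add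
  up to the stated constant.\<close>

lemma bilin_low_frequency_le:
  fixes F G :: "'a::euclidean_space \<Rightarrow> real"
  assumes F: "sqint F" and G: "sqint G" and dim: "DIM('a) \<ge> 2"
  shows "ennreal \<bar>bilin (2 powi k) F G x\<bar> \<le> ennreal \<bar>bilin (2 powi k) (\<lambda>x. F x - cube_avg k F x) (\<lambda>x. G x - cube_avg k G x) x\<bar> +
    (cube_const TYPE('a) * (2 * ennreal (avg_const TYPE('a)) + cube_const TYPE('a))) *
      (hl_max (\<lambda>u. ennreal \<bar>F u\<bar>) x * hl_max (\<lambda>u. ennreal \<bar>G u\<bar>) x)"
proof -
  note [measurable] = sqint_measurable[OF F] sqint_measurable[OF G]
  let ?t = "2 powi k :: real" and ?E = "cube_avg k"
  let ?F = "\<lambda>x. F x - ?E F x" and ?G = "\<lambda>x. G x - ?E G x"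
  let ?MF = "hl_max (\<lambda>u. ennreal \<bar>F u\<bar>) x" and ?MG = "hl_max (\<lambda>u. ennreal \<bar>G u\<bar>) x"
  let ?A = "ennreal (avg_const TYPE('a))" and ?C = "cube_const TYPE('a)"
  have sq: "sqint (?E F)" "sqint (?E G)" "sqint ?F" "sqint ?G"
    by (intro sqint_diff sqint_cube_avg F G)+
  have t: "?t \<noteq> 0" by simp
  note I = integrable_bilin[OF _ _ t dim, of _ _ x]
  note i1 = I[OF sq(3) sq(4)] and i2 = I[OF sq(1) G] and i3 = I[OF sq(3) sq(2)]
  have split: "bilin ?t F G x = bilin ?t ?F ?G x + bilin ?t (?E F) G x + bilin ?t ?F (?E G) x"
  proof -
    have "bilin ?t F G x = (\<integral>w. ?F (x - ?t *\<^sub>R fst w) * ?G (x - ?t *\<^sub>R snd w) +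
        ?E F (x - ?t *\<^sub>R fst w) * G (x - ?t *\<^sub>R snd w) + ?F (x - ?t *\<^sub>R fst w) * ?E G (x - ?t *\<^sub>R snd w) \<partial>(usph :: ('a \<times> 'a) measure))"
      unfolding bilin_def by (intro Bochner_Integration.integral_cong refl) (simp add: algebra_simps)
    also have "\<dots> = bilin ?t ?F ?G x + bilin ?t (?E F) G x + bilin ?t ?F (?E G) x"
      unfolding bilin_def
      by (simp only: Bochner_Integration.integral_add[OF Bochner_Integration.integrable_add[OF i1 i2] i3]
          Bochner_Integration.integral_add[OF i1 i2])
    finally show ?thesis .
  qed
  have EF: "AE w in (usph :: ('a \<times> 'a) measure). ennreal \<bar>?E F (x - ?t *\<^sub>R fst w)\<bar> \<le> ?C * ?MF"
    unfolding cube_const_def using AE_usph_fst_snd by eventually_elim (rule cube_avg_le_hl_max[OF F], simp)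
  have EG: "AE w in (usph :: ('a \<times> 'a) measure). ennreal \<bar>?E G (x - ?t *\<^sub>R snd w)\<bar> \<le> ?C * ?MG"
    unfolding cube_const_def using AE_usph_fst_snd by eventually_elim (rule cube_avg_le_hl_max[OF G], simp)
  have 1: "ennreal \<bar>bilin ?t (?E F) G x\<bar> \<le> ?C * ?MF * (?A * ?MG)"
  proof -
    have "ennreal \<bar>bilin ?t (?E F) G x\<bar> \<le> (\<integral>\<^sup>+w. ennreal \<bar>?E F (x - ?t *\<^sub>R fst w)\<bar> * ennreal \<bar>G (x - ?t *\<^sub>R snd w)\<bar> \<partial>(usph :: ('a \<times> 'a) measure))"
      by (rule abs_bilin_le[OF sq(1) G t dim])
    also have "\<dots> \<le> (\<integral>\<^sup>+w. ?C * ?MF * ennreal \<bar>G (x - ?t *\<^sub>R snd w)\<bar> \<partial>(usph :: ('a \<times> 'a) measure))"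
    proof (rule nn_integral_mono_AE)
      show "AE w in (usph :: ('a \<times> 'a) measure). ennreal \<bar>?E F (x - ?t *\<^sub>R fst w)\<bar> * ennreal \<bar>G (x - ?t *\<^sub>R snd w)\<bar> \<le>
        ?C * ?MF * ennreal \<bar>G (x - ?t *\<^sub>R snd w)\<bar>"
        using EF by eventually_elim (intro mult_right_mono, auto)
    qed
    also have "\<dots> = ?C * ?MF * (\<integral>\<^sup>+w. ennreal \<bar>G (x - ?t *\<^sub>R snd w)\<bar> \<partial>(usph :: ('a \<times> 'a) measure))"
      by (rule nn_integral_cmult) measurable
    also have "\<dots> \<le> ?C * ?MF * (?A * ?MG)"
      by (intro mult_left_mono nn_integral_usph_translate_le_hl_max(2)[of "\<lambda>u. ennreal \<bar>G u\<bar>"] dim) auto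
    finally show ?thesis .
  qed
  have 2: "ennreal \<bar>bilin ?t ?F (?E G) x\<bar> \<le> (?A * ?MF + ?C * ?MF) * (?C * ?MG)"
  proof -
    have "ennreal \<bar>bilin ?t ?F (?E G) x\<bar> \<le> (\<integral>\<^sup>+w. ennreal \<bar>?F (x - ?t *\<^sub>R fst w)\<bar> * ennreal \<bar>?E G (x - ?t *\<^sub>R snd w)\<bar> \<partial>(usph :: ('a \<times> 'a) measure))"
      by (rule abs_bilin_le[OF sq(3) sq(2) t dim])
    also have "\<dots> \<le> (\<integral>\<^sup>+w. (ennreal \<bar>F (x - ?t *\<^sub>R fst w)\<bar> + ?C * ?MF) * (?C * ?MG) \<partial>(usph :: ('a \<times> 'a) measure))"
    proof (rule nn_integral_mono_AE)
      show "AE w in (usph :: ('a \<times> 'a) measure). ennreal \<bar>?F (x - ?t *\<^sub>R fst w)\<bar> * ennreal \<bar>?E G (x - ?t *\<^sub>R snd w)\<bar> \<le>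
        (ennreal \<bar>F (x - ?t *\<^sub>R fst w)\<bar> + ?C * ?MF) * (?C * ?MG)"
        using EF EG
      proof eventually_elim
        case (elim w)
        have "ennreal \<bar>?F (x - ?t *\<^sub>R fst w)\<bar> \<le> ennreal (\<bar>F (x - ?t *\<^sub>R fst w)\<bar> + \<bar>?E F (x - ?t *\<^sub>R fst w)\<bar>)"
          by (intro ennreal_leI) simp
        also have "\<dots> = ennreal \<bar>F (x - ?t *\<^sub>R fst w)\<bar> + ennreal \<bar>?E F (x - ?t *\<^sub>R fst w)\<bar>" by simp
        also have "\<dots> \<le> ennreal \<bar>F (x - ?t *\<^sub>R fst w)\<bar> + ?C * ?MF" by (intro add_left_mono elim)
        finally show ?case by (intro mult_mono elim) auto
      qed
    qed
    also have "\<dots> = (\<integral>\<^sup>+w. ennreal \<bar>F (x - ?t *\<^sub>R fst w)\<bar> + ?C * ?MF \<partial>(usph :: ('a \<times> 'a) measure)) * (?C * ?MG)"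
      by (rule nn_integral_multc) measurable
    also have "(\<integral>\<^sup>+w. ennreal \<bar>F (x - ?t *\<^sub>R fst w)\<bar> + ?C * ?MF \<partial>(usph :: ('a \<times> 'a) measure)) =
        (\<integral>\<^sup>+w. ennreal \<bar>F (x - ?t *\<^sub>R fst w)\<bar> \<partial>(usph :: ('a \<times> 'a) measure)) + ?C * ?MF"
      using usph.emeasure_space_1[where 'a="'a \<times> 'a"] by (subst nn_integral_add) simp_all
    also have "(\<dots>) * (?C * ?MG) \<le> (?A * ?MF + ?C * ?MF) * (?C * ?MG)"
      by (intro mult_right_mono add_right_mono nn_integral_usph_translate_le_hl_max(1)[of "\<lambda>u. ennreal \<bar>F u\<bar>"] dim) auto
    finally show ?thesis .
  qed
  have "ennreal \<bar>bilin ?t F G x\<bar> \<le> ennreal (\<bar>bilin ?t ?F ?G x\<bar> + \<bar>bilin ?t (?E F) G x\<bar> + \<bar>bilin ?t ?F (?E G) x\<bar>)"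
    unfolding split by (intro ennreal_leI) linarith
  also have "\<dots> = ennreal \<bar>bilin ?t ?F ?G x\<bar> + ennreal \<bar>bilin ?t (?E F) G x\<bar> + ennreal \<bar>bilin ?t ?F (?E G) x\<bar>" by simp
  also have "\<dots> \<le> ennreal \<bar>bilin ?t ?F ?G x\<bar> + ?C * ?MF * (?A * ?MG) + (?A * ?MF + ?C * ?MF) * (?C * ?MG)"
    by (intro add_mono 1 2 order_refl)
  also have "\<dots> = ennreal \<bar>bilin ?t ?F ?G x\<bar> + (?C * (2 * ?A + ?C)) * (?MF * ?MG)"
  proof -
    have "?C * ?MF * (?A * ?MG) + (?A * ?MF + ?C * ?MF) * (?C * ?MG) = (?C * (2 * ?A + ?C)) * (?MF * ?MG)"
      by (simp only: mult_2 distrib_left distrib_right mult_ac add_ac)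
    then show ?thesis by (simp only: add.assoc)
  qed
  finally show ?thesis .
qed

lemma ennreal_powr_2: "ennreal_powr y 2 = y * y"
  by (cases y) (simp_all add: ennreal_powr_def ennreal_mult power2_eq_square ennreal_top_mult)

lemma ennreal_mult_le_squares: "a * b \<le> a * a + b * b" for a b :: ennreal
proof (cases "a \<le> b")
  case True
  then have "a * b \<le> b * b" by (intro mult_right_mono) auto
  then show ?thesis by (rule order_trans) simp
next
  case False
  then have "a * b \<le> a * a" by (intro mult_left_mono) auto
  then show ?thesis by (rule order_trans) simp
qed

text \<open>For the mean-zero pairs the supremum over \<open>k\<close> is simply replaced by the
  sum, since the square functions are summable over scales. What remains is one product of maximal
  functions that does not depend on \<open>k\<close>; it is integrable by the strong type bound with
  exponent 2.\<close>

lemma bilin_maximal_estimate: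
  assumes dim: "DIM('a::euclidean_space) \<ge> 2"
  obtains C where "0 < C" "\<And>F G :: 'a \<Rightarrow> real. sqint F \<Longrightarrow> sqint G \<Longrightarrow>
    (\<integral>\<^sup>+x. (SUP k::int. ennreal \<bar>bilin (2 powi k) F G x\<bar>) \<partial>lborel) \<le> ennreal (C * (sqnorm F + sqnorm G))"
proof -
  obtain C1 where C1: "0 < C1" "\<And>(f :: 'a \<Rightarrow> real) K. sqint f \<Longrightarrow>
    (\<Sum>k\<in>{-int K..int K}. sph_square (2 powi k) (\<lambda>x. f x - cube_avg k f x)) \<le> ennreal (C1 * sqnorm f)"
    using cube_avg_residual_square_function[OF dim] by metis
  define C2 :: real where "C2 = 5 ^ DIM('a) * 2 powr 2 * 2 / (2 - 1)"
  define D where "D = unit_ball_vol DIM('a) * (2 ^ (DIM('a) + 1)) ^ DIM('a)"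
  define B where "B = D * (2 * avg_const TYPE('a) + D)"
  have D: "0 \<le> D" by (simp add: D_def)
  have B: "cube_const TYPE('a) * (2 * ennreal (avg_const TYPE('a)) + cube_const TYPE('a)) = ennreal B"
  proof -
    have "2 * ennreal (avg_const TYPE('a)) = ennreal (2 * avg_const TYPE('a))"
      using avg_const_nonneg[where 'a='a] by (simp add: ennreal_mult)
    moreover have "ennreal (2 * avg_const TYPE('a) + D) = ennreal (2 * avg_const TYPE('a)) + ennreal D"
      using avg_const_nonneg[where 'a='a] D by (intro ennreal_plus) auto
    moreover have "ennreal B = ennreal D * ennreal (2 * avg_const TYPE('a) + D)"
      unfolding B_def using D by (rule ennreal_mult')
    ultimately show ?thesis by (simp only: cube_const_def D_def[symmetric])
  qed
  have B0: "0 \<le> B" unfolding B_def using D avg_const_nonneg[where 'a='a] by simp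
  have C2: "0 \<le> C2" by (simp add: C2_def)
  define m where "m = marg_const TYPE('a)"
  have m: "0 < m" unfolding m_def by (rule marg_const_pos)
  have main: "(\<integral>\<^sup>+x. (SUP k::int. ennreal \<bar>bilin (2 powi k) F G x\<bar>) \<partial>lborel) \<le> ennreal ((m * C1 + B * C2) * (sqnorm F + sqnorm G))"
    if F: "sqint F" and G: "sqint G" for F G :: "'a \<Rightarrow> real"
  proof -
    note [measurable] = sqint_measurable[OF F] sqint_measurable[OF G]
    let ?MF = "hl_max (\<lambda>u. ennreal \<bar>F u\<bar>)" and ?MG = "hl_max (\<lambda>u. ennreal \<bar>G u\<bar>)"
    define T where "T k x = ennreal \<bar>bilin (2 powi k) (\<lambda>x. F x - cube_avg k F x) (\<lambda>x. G x - cube_avg k G x) x\<bar>" for k x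
    have [measurable]: "T k \<in> borel_measurable borel" for k unfolding T_def[abs_def] by measurable
    \<comment> \<open>Sums over symmetric finite windows increase with \<open>K\<close>, so monotone
      convergence gives the full sum from bounds that are uniform in \<open>K\<close>.\<close>
    define S where "S K x = (\<Sum>k\<in>{-int K..int K}. T k x)" for K :: nat and x
    have [measurable]: "S K \<in> borel_measurable borel" for K unfolding S_def[abs_def] by measurable
    have inc: "incseq S"
      unfolding incseq_def le_fun_def S_def by (intro allI impI sum_mono2) auto
    have TS: "T k x \<le> (SUP K. S K x)" for k x
    proof -
      have "T k x \<le> S (nat \<bar>k\<bar>) x" unfolding S_def by (rule member_le_sum) auto
      also have "\<dots> \<le> (SUP K. S K x)" by (rule SUP_upper) simp
      finally show ?thesis .
    qed
    have "(\<integral>\<^sup>+x. (SUP k::int. ennreal \<bar>bilin (2 powi k) F G x\<bar>) \<partial>lborel) \<le>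
       (\<integral>\<^sup>+x. (SUP K. S K x) + ennreal B * (?MF x * ?MF x + ?MG x * ?MG x) \<partial>lborel)"
    proof (rule nn_integral_mono, rule SUP_least)
      fix x :: 'a and k :: int
      have "ennreal \<bar>bilin (2 powi k) F G x\<bar> \<le> T k x + ennreal B * (?MF x * ?MG x)"
        using bilin_low_frequency_le[OF F G dim, of k x] unfolding B T_def .
      also have "\<dots> \<le> (SUP K. S K x) + ennreal B * (?MF x * ?MF x + ?MG x * ?MG x)"
        by (intro add_mono TS mult_left_mono ennreal_mult_le_squares) auto
      finally show "ennreal \<bar>bilin (2 powi k) F G x\<bar> \<le> \<dots>" .
    qed
    also have "\<dots> = (\<integral>\<^sup>+x. (SUP K. S K x) \<partial>lborel) + ennreal B * ((\<integral>\<^sup>+x. ?MF x * ?MF x \<partial>lborel) + (\<integral>\<^sup>+x. ?MG x * ?MG x \<partial>lborel))"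
      by (simp add: nn_integral_add nn_integral_cmult)
    also have "\<dots> \<le> ennreal (m * C1 * (sqnorm F + sqnorm G)) + ennreal B * ennreal (C2 * (sqnorm F + sqnorm G))"
    proof (intro add_mono mult_left_mono)
      have "(\<integral>\<^sup>+x. (SUP K. S K x) \<partial>lborel) = (SUP K. \<integral>\<^sup>+x. S K x \<partial>lborel)"
        by (rule nn_integral_monotone_convergence_SUP[OF inc]) simp
      also have "\<dots> \<le> ennreal (m * C1 * (sqnorm F + sqnorm G))"
      proof (rule SUP_least)
        fix K :: nat
        let ?I = "{-int K..int K}"
        have "(\<integral>\<^sup>+x. S K x \<partial>lborel) = (\<Sum>k\<in>?I. \<integral>\<^sup>+x. T k x \<partial>lborel)"
          unfolding S_def by (rule nn_integral_sum) simp
        also have "\<dots> \<le> (\<Sum>k\<in>?I. ennreal m * (sph_square (2 powi k) (\<lambda>x. F x - cube_avg k F x) + sph_square (2 powi k) (\<lambda>x. G x - cube_avg k G x)))"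
          unfolding T_def m_def
          by (intro sum_mono nn_integral_bilin_le sqint_diff sqint_cube_avg F G dim) simp
        also have "\<dots> = ennreal m * ((\<Sum>k\<in>?I. sph_square (2 powi k) (\<lambda>x. F x - cube_avg k F x)) + (\<Sum>k\<in>?I. sph_square (2 powi k) (\<lambda>x. G x - cube_avg k G x)))"
          by (simp add: sum_distrib_left sum.distrib distrib_left)
        also have "\<dots> \<le> ennreal m * (ennreal (C1 * sqnorm F) + ennreal (C1 * sqnorm G))"
          by (intro mult_left_mono add_mono C1 F G) simp
        also have "\<dots> = ennreal (m * C1 * (sqnorm F + sqnorm G))"
        proof -
          have "ennreal (C1 * sqnorm F) + ennreal (C1 * sqnorm G) = ennreal (C1 * sqnorm F + C1 * sqnorm G)"
            using C1 by (intro ennreal_plus[symmetric] mult_nonneg_nonneg) (auto simp: sqnorm_nonneg)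
          moreover have "ennreal (m * (C1 * sqnorm F + C1 * sqnorm G)) = ennreal m * ennreal (C1 * sqnorm F + C1 * sqnorm G)"
            using m by (intro ennreal_mult') simp
          moreover have "m * C1 * (sqnorm F + sqnorm G) = m * (C1 * sqnorm F + C1 * sqnorm G)" by (simp add: algebra_simps)
          ultimately show ?thesis by (simp only:)
        qed
        finally show "(\<integral>\<^sup>+x. S K x \<partial>lborel) \<le> \<dots>" .
      qed
      finally show "(\<integral>\<^sup>+x. (SUP K. S K x) \<partial>lborel) \<le> \<dots>" .
      have M2: "(\<integral>\<^sup>+x. hl_max (\<lambda>u. ennreal \<bar>h u\<bar>) x * hl_max (\<lambda>u. ennreal \<bar>h u\<bar>) x \<partial>lborel) \<le> ennreal (C2 * sqnorm h)"
        if h: "sqint h" for h :: "'a \<Rightarrow> real"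
      proof -
        have "(\<integral>\<^sup>+x. ennreal_powr (hl_max (\<lambda>u. ennreal \<bar>h u\<bar>) x) 2 \<partial>lborel) \<le> ennreal C2 * (\<integral>\<^sup>+x. ennreal (\<bar>h x\<bar> powr 2) \<partial>lborel)"
          unfolding C2_def by (rule hl_max_strong_type) (use sqint_measurable[OF h] in auto)
        also have "(\<integral>\<^sup>+x. ennreal (\<bar>h x\<bar> powr 2) \<partial>lborel) = ennreal (sqnorm h)"
          using nn_integral_square[OF h] by simp
        also have "ennreal C2 * ennreal (sqnorm h) = ennreal (C2 * sqnorm h)"
          using C2 by (rule ennreal_mult'[symmetric])
        finally show ?thesis by (simp add: ennreal_powr_2)
      qed
      have "(\<integral>\<^sup>+x. ?MF x * ?MF x \<partial>lborel) + (\<integral>\<^sup>+x. ?MG x * ?MG x \<partial>lborel) \<le> ennreal (C2 * sqnorm F) + ennreal (C2 * sqnorm G)"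
        by (intro add_mono M2 F G)
      also have "\<dots> = ennreal (C2 * sqnorm F + C2 * sqnorm G)"
        using C2 by (intro ennreal_plus[symmetric] mult_nonneg_nonneg) (auto simp: sqnorm_nonneg)
      also have "C2 * sqnorm F + C2 * sqnorm G = C2 * (sqnorm F + sqnorm G)" by (simp add: algebra_simps)
      finally show "(\<integral>\<^sup>+x. ?MF x * ?MF x \<partial>lborel) + (\<integral>\<^sup>+x. ?MG x * ?MG x \<partial>lborel) \<le> ennreal (C2 * (sqnorm F + sqnorm G))" .
    qed simp
    also have "ennreal B * ennreal (C2 * (sqnorm F + sqnorm G)) = ennreal (B * (C2 * (sqnorm F + sqnorm G)))"
      using B0 by (rule ennreal_mult'[symmetric])
    also have "ennreal (m * C1 * (sqnorm F + sqnorm G)) + ennreal (B * (C2 * (sqnorm F + sqnorm G))) =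
       ennreal (m * C1 * (sqnorm F + sqnorm G) + B * (C2 * (sqnorm F + sqnorm G)))"
      using m C1 B0 C2 sqnorm_nonneg[of F] sqnorm_nonneg[of G] by (intro ennreal_plus[symmetric] mult_nonneg_nonneg add_nonneg_nonneg) auto
    also have "m * C1 * (sqnorm F + sqnorm G) + B * (C2 * (sqnorm F + sqnorm G)) = (m * C1 + B * C2) * (sqnorm F + sqnorm G)"
      by (simp add: algebra_simps)
    finally show ?thesis .
  qed
  show ?thesis
    by (rule that[of "m * C1 + B * C2"]) (use m C1 B0 C2 main in \<open>auto intro!: add_pos_nonneg\<close>)
qed

section \<open>The bilinear maximal operator\<close>

definition sphere_mass :: "'a::euclidean_space itself \<Rightarrow> real" where
  "sphere_mass _ = DIM('a) * unit_ball_vol DIM('a)"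

lemma sphere_mass_nonneg: "0 \<le> sphere_mass TYPE('a::euclidean_space)"
  by (simp add: sphere_mass_def)

lemma sph_integrand_measurable:
  fixes f g :: "'a::euclidean_space \<Rightarrow> complex"
  assumes [measurable]: "f \<in> borel_measurable borel" "g \<in> borel_measurable borel"
  shows "sph_integrand t f g x \<in> borel_measurable borel"
  unfolding sph_integrand_def case_prod_unfold by measurable

lemma sph_avg_usph:
  fixes f g :: "'a::euclidean_space \<Rightarrow> complex"
  assumes "f \<in> borel_measurable borel" "g \<in> borel_measurable borel"
  shows "sph_avg t f g x = sphere_mass TYPE('a \<times> 'a) *\<^sub>R (\<integral>w. f (x - t *\<^sub>R fst w) * g (x - t *\<^sub>R snd w) \<partial>usph)"
  unfolding sph_avg_def sphere_mass_def integral_sphere_measure[OF sph_integrand_measurable[OF assms]]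
  by (simp add: sph_integrand_def case_prod_unfold)

lemma sph_avg_measurable [measurable]:
  fixes f g :: "'a::euclidean_space \<Rightarrow> complex"
  assumes [measurable]: "f \<in> borel_measurable borel" "g \<in> borel_measurable borel"
  shows "sph_avg t f g \<in> borel_measurable borel"
  unfolding sph_avg_usph[OF assms, abs_def] by measurable

lemma dyadic_sph_max_measurable [measurable]:
  fixes f g :: "'a::euclidean_space \<Rightarrow> complex"
  assumes [measurable]: "f \<in> borel_measurable borel" "g \<in> borel_measurable borel"
  shows "dyadic_sph_max f g \<in> borel_measurable borel"
  unfolding dyadic_sph_max_def[abs_def] by measurable

text \<open>Without integrability the Bochner integral is 0 and the bound remains true, so pointwise
  estimates of the averages need no integrability argument.\<close>

lemma norm_integral_le_nn_integral:
  fixes f :: "'b \<Rightarrow> 'c::{banach, second_countable_topology}"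
  shows "ennreal (norm (integral\<^sup>L M f)) \<le> (\<integral>\<^sup>+x. ennreal (norm (f x)) \<partial>M)"
  by (cases "integrable M f") (auto simp: not_integrable_integral_eq intro: integral_norm_bound_ennreal)

text \<open>Once the product is dominated by a sum of functions of one variable, each summand sees a
  single component, and the bounded marginal gives the same constant at every scale. The choice of
  \<open>\<Phi>\<close> and \<open>\<Gamma>\<close> is what distinguishes the triples of exponents
  with \<open>p > 1\<close>.\<close>

lemma dyadic_sph_max_le_hl_max:
  fixes f g :: "'a::euclidean_space \<Rightarrow> complex"
  assumes [measurable]: "f \<in> borel_measurable borel" "g \<in> borel_measurable borel"
    "\<Phi> \<in> borel_measurable borel" "\<Gamma> \<in> borel_measurable borel"
    and le: "\<And>u v. ennreal (norm (f u) * norm (g v)) \<le> \<Phi> u + \<Gamma> v" and dim: "DIM('a) \<ge> 2"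
  shows "dyadic_sph_max f g x \<le> ennreal (sphere_mass TYPE('a \<times> 'a) * avg_const TYPE('a)) * (hl_max \<Phi> x + hl_max \<Gamma> x)"
  unfolding dyadic_sph_max_def
proof (rule SUP_least)
  fix k :: int
  let ?t = "2 powi k :: real" and ?s = "ennreal (sphere_mass TYPE('a \<times> 'a))" and ?A = "ennreal (avg_const TYPE('a))"
  have "ennreal (norm (sph_avg ?t f g x)) = ?s * ennreal (norm (\<integral>w. f (x - ?t *\<^sub>R fst w) * g (x - ?t *\<^sub>R snd w) \<partial>usph))"
    by (subst sph_avg_usph) (use sphere_mass_nonneg[where 'a="'a \<times> 'a"] in \<open>auto simp: ennreal_mult\<close>)
  also have "\<dots> \<le> ?s * (\<integral>\<^sup>+w. ennreal (norm (f (x - ?t *\<^sub>R fst w) * g (x - ?t *\<^sub>R snd w))) \<partial>(usph :: ('a \<times> 'a) measure))"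
    by (intro mult_left_mono norm_integral_le_nn_integral) simp
  also have "\<dots> \<le> ?s * (\<integral>\<^sup>+w. \<Phi> (x - ?t *\<^sub>R fst w) + \<Gamma> (x - ?t *\<^sub>R snd w) \<partial>(usph :: ('a \<times> 'a) measure))"
    by (intro mult_left_mono nn_integral_mono) (simp_all add: norm_mult le)
  also have "(\<integral>\<^sup>+w. \<Phi> (x - ?t *\<^sub>R fst w) + \<Gamma> (x - ?t *\<^sub>R snd w) \<partial>(usph :: ('a \<times> 'a) measure)) =
      (\<integral>\<^sup>+w. \<Phi> (x - ?t *\<^sub>R fst w) \<partial>(usph :: ('a \<times> 'a) measure)) + (\<integral>\<^sup>+w. \<Gamma> (x - ?t *\<^sub>R snd w) \<partial>(usph :: ('a \<times> 'a) measure))"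
    by (rule nn_integral_add) measurable
  also have "?s * \<dots> \<le> ?s * (?A * hl_max \<Phi> x + ?A * hl_max \<Gamma> x)"
    by (intro mult_left_mono add_mono nn_integral_usph_translate_le_hl_max dim) auto
  also have "\<dots> = ennreal (sphere_mass TYPE('a \<times> 'a) * avg_const TYPE('a)) * (hl_max \<Phi> x + hl_max \<Gamma> x)"
    using avg_const_nonneg[where 'a='a] sphere_mass_nonneg[where 'a="'a \<times> 'a"]
    by (simp add: ennreal_mult distrib_left mult.assoc)
  finally show "ennreal (norm (sph_avg ?t f g x)) \<le> \<dots>" .
qed

section \<open>Powers and norms of functions with extended values\<close>

lemma ennreal_powr_mono: "0 \<le> c \<Longrightarrow> x \<le> y \<Longrightarrow> ennreal_powr x c \<le> ennreal_powr y c"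
  by (cases x; cases y) (auto simp: ennreal_powr_def top_unique intro!: ennreal_leI powr_mono2)

lemma ennreal_powr_ennreal: "0 \<le> r \<Longrightarrow> ennreal_powr (ennreal r) c = ennreal (r powr c)"
  by (simp add: ennreal_powr_def)

lemma ennreal_powr_mult_left:
  assumes "0 < K" "0 < c"
  shows "ennreal_powr (ennreal K * x) c = ennreal (K powr c) * ennreal_powr x c"
proof (cases x)
  case (real r)
  then have "ennreal K * x = ennreal (K * r)" using assms by (simp add: ennreal_mult)
  then have "ennreal_powr (ennreal K * x) c = ennreal ((K * r) powr c)" using real assms by (simp only:) (simp add: ennreal_powr_ennreal)
  then show ?thesis using real assms by (simp add: ennreal_powr_ennreal powr_mult ennreal_mult)
next
  case top
  then show ?thesis using assms by (simp add: ennreal_powr_def ennreal_mult_top)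
qed

lemma ennreal_powr_add_le:
  assumes c: "0 < c"
  shows "ennreal_powr (x + y) c \<le> ennreal (2 powr c) * (ennreal_powr x c + ennreal_powr y c)"
proof -
  have "x + y \<le> ennreal 2 * max x y"
    by (simp add: mult_2 add_mono)
  then have "ennreal_powr (x + y) c \<le> ennreal_powr (ennreal 2 * max x y) c"
    using c by (intro ennreal_powr_mono) auto
  also have "\<dots> = ennreal (2 powr c) * ennreal_powr (max x y) c"
    by (rule ennreal_powr_mult_left) (use c in auto)
  also have "ennreal_powr (max x y) c \<le> ennreal_powr x c + ennreal_powr y c"
    by (cases "x \<le> y") (auto simp: max_def add_increasing add_increasing2)
  finally show ?thesis by (simp add: mult_left_mono)
qed

lemma Lp_norm_finite_exponent:
  fixes h :: "'a::euclidean_space \<Rightarrow> ennreal"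
  assumes "0 < a"
  shows "Lp_norm (ennreal a) h = ennreal_powr (\<integral>\<^sup>+x. ennreal_powr (h x) a \<partial>lborel) (1 / a)"
  using assms by (simp add: Lp_norm_def nn_integral_completion)

text \<open>The parameter \<open>s\<close> is meant to be the product of the norms of
  \<open>f\<close> and \<open>g\<close>. Both majorants are arranged to have norm at most
  \<open>s\<close> in the exponent \<open>c\<close>, so that the sum of their maximal functions
  already has the bilinear size.\<close>

lemma Lp_norm_hl_max_le:
  fixes \<Phi> \<Gamma> :: "'a::euclidean_space \<Rightarrow> real"
  assumes [measurable]: "\<Phi> \<in> borel_measurable borel" "\<Gamma> \<in> borel_measurable borel"
    and nn: "\<And>u. 0 \<le> \<Phi> u" "\<And>u. 0 \<le> \<Gamma> u" and c: "1 < c" and K: "0 < K" and s: "0 \<le> s"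
    and P: "(\<integral>\<^sup>+u. ennreal (\<Phi> u powr c) \<partial>lborel) \<le> ennreal (s powr c)"
    and G: "(\<integral>\<^sup>+u. ennreal (\<Gamma> u powr c) \<partial>lborel) \<le> ennreal (s powr c)"
    and h: "\<And>x. h x \<le> ennreal K * (hl_max (\<lambda>u. ennreal (\<Phi> u)) x + hl_max (\<lambda>u. ennreal (\<Gamma> u)) x)"
  shows "Lp_norm (ennreal c) h \<le> ennreal ((2 * K powr c * 2 powr c * (5 ^ DIM('a) * 2 powr c * c / (c - 1))) powr (1 / c) * s)"
proof -
  let ?MP = "hl_max (\<lambda>u. ennreal (\<Phi> u))" and ?MG = "hl_max (\<lambda>u. ennreal (\<Gamma> u))"
  define B where "B = 5 ^ DIM('a) * 2 powr c * c / (c - 1)"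
  have B: "0 \<le> B" using c by (simp add: B_def)
  have "(\<integral>\<^sup>+x. ennreal_powr (h x) c \<partial>lborel) \<le> (\<integral>\<^sup>+x. ennreal (K powr c * 2 powr c) * (ennreal_powr (?MP x) c + ennreal_powr (?MG x) c) \<partial>lborel)"
  proof (rule nn_integral_mono)
    fix x
    have "ennreal_powr (h x) c \<le> ennreal_powr (ennreal K * (?MP x + ?MG x)) c"
      using c by (intro ennreal_powr_mono h) auto
    also have "\<dots> = ennreal (K powr c) * ennreal_powr (?MP x + ?MG x) c"
      by (rule ennreal_powr_mult_left) (use K c in auto)
    also have "\<dots> \<le> ennreal (K powr c) * (ennreal (2 powr c) * (ennreal_powr (?MP x) c + ennreal_powr (?MG x) c))"
      using c by (intro mult_left_mono ennreal_powr_add_le) auto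
    also have "\<dots> = ennreal (K powr c * 2 powr c) * (ennreal_powr (?MP x) c + ennreal_powr (?MG x) c)"
      by (simp add: ennreal_mult mult.assoc)
    finally show "ennreal_powr (h x) c \<le> \<dots>" .
  qed
  also have "\<dots> = ennreal (K powr c * 2 powr c) * ((\<integral>\<^sup>+x. ennreal_powr (?MP x) c \<partial>lborel) + (\<integral>\<^sup>+x. ennreal_powr (?MG x) c \<partial>lborel))"
  proof -
    have m: "(\<lambda>x. ennreal_powr (F x) c) \<in> borel_measurable borel" if [measurable]: "F \<in> borel_measurable borel" for F :: "'a \<Rightarrow> ennreal"
      unfolding ennreal_powr_def by measurable
    have [measurable]: "(\<lambda>x. ennreal_powr (?MP x) c) \<in> borel_measurable borel" "(\<lambda>x. ennreal_powr (?MG x) c) \<in> borel_measurable borel"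
      by (rule m; measurable)+
    show ?thesis by (simp add: nn_integral_cmult nn_integral_add)
  qed
  also have "\<dots> \<le> ennreal (K powr c * 2 powr c) * (ennreal B * ennreal (s powr c) + ennreal B * ennreal (s powr c))"
  proof (intro mult_left_mono add_mono)
    show "(\<integral>\<^sup>+x. ennreal_powr (?MP x) c \<partial>lborel) \<le> ennreal B * ennreal (s powr c)"
      unfolding B_def by (rule order_trans[OF hl_max_strong_type mult_left_mono[OF P]]) (use nn c in auto)
    show "(\<integral>\<^sup>+x. ennreal_powr (?MG x) c \<partial>lborel) \<le> ennreal B * ennreal (s powr c)"
      unfolding B_def by (rule order_trans[OF hl_max_strong_type mult_left_mono[OF G]]) (use nn c in auto)
  qed auto
  also have "\<dots> = ennreal ((2 * K powr c * 2 powr c * B) * s powr c)"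
  proof -
    have "ennreal B * ennreal (s powr c) = ennreal (B * s powr c)" using B by (rule ennreal_mult'[symmetric])
    moreover have "ennreal (B * s powr c) + ennreal (B * s powr c) = ennreal (B * s powr c + B * s powr c)"
      using B by (intro ennreal_plus[symmetric]) auto
    moreover have "ennreal (K powr c * 2 powr c) * ennreal (B * s powr c + B * s powr c) = ennreal (K powr c * 2 powr c * (B * s powr c + B * s powr c))"
      by (rule ennreal_mult'[symmetric]) simp
    moreover have "K powr c * 2 powr c * (B * s powr c + B * s powr c) = (2 * K powr c * 2 powr c * B) * s powr c"
      by (simp add: algebra_simps)
    ultimately show ?thesis by (simp only:)
  qed
  finally have "Lp_norm (ennreal c) h \<le> ennreal_powr (ennreal ((2 * K powr c * 2 powr c * B) * s powr c)) (1 / c)"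
    using c by (subst Lp_norm_finite_exponent) (auto intro!: ennreal_powr_mono)
  also have "\<dots> = ennreal (((2 * K powr c * 2 powr c * B) * s powr c) powr (1 / c))"
    using B by (intro ennreal_powr_ennreal) auto
  also have "((2 * K powr c * 2 powr c * B) * s powr c) powr (1 / c) = (2 * K powr c * 2 powr c * B) powr (1 / c) * s"
    using B s c by (simp add: powr_mult powr_powr)
  finally show ?thesis unfolding B_def .
qed

text \<open>Each component of the surface measure has bounded density, so a Lebesgue null set is
  missed by almost every component. Consequently the averages at every single point
  \<open>x\<close>, and not only at almost every one, depend on \<open>f\<close> and
  \<open>g\<close> through their classes alone.\<close>

lemma AE_sphere_measure_translate:
  assumes N: "N \<in> sets borel" "emeasure lborel N = 0" and t: "t \<noteq> 0" and dim: "DIM('a::euclidean_space) \<ge> 2"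
  shows "AE w in (sphere_measure :: ('a \<times> 'a) measure). x - t *\<^sub>R fst w \<notin> N \<and> x - t *\<^sub>R snd w \<notin> (N :: 'a set)"
proof -
  note [measurable] = N(1)
  have "(\<integral>\<^sup>+y. indicator N y \<partial>lborel) = ennreal (\<bar>- t\<bar> ^ DIM('a)) * (\<integral>\<^sup>+y. indicator N (x + (- t) *\<^sub>R y) \<partial>lborel)"
    by (rule nn_integral_lborel_affine) (use t in auto)
  with N have *: "0 = ennreal (\<bar>- t\<bar> ^ DIM('a)) * (\<integral>\<^sup>+y. indicator N (x - t *\<^sub>R y) \<partial>lborel)" by simp
  then have z: "(\<integral>\<^sup>+y. indicator N (x - t *\<^sub>R y) \<partial>lborel) = 0"
  proof -
    have "ennreal (\<bar>- t\<bar> ^ DIM('a)) \<noteq> 0" using t by (simp add: ennreal_eq_0_iff not_le)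
    with * show ?thesis by (metis mult_eq_0_iff)
  qed
  have "(\<integral>\<^sup>+y. indicator (ball 0 1) y * indicator N (x - t *\<^sub>R y) \<partial>lborel) \<le> (\<integral>\<^sup>+y. indicator N (x - t *\<^sub>R y) \<partial>lborel)"
    by (intro nn_integral_mono) (simp add: indicator_def)
  then have zz: "(\<integral>\<^sup>+y. indicator (ball 0 1) y * indicator N (x - t *\<^sub>R y) \<partial>lborel) = 0" using z by simp
  have m: "(\<lambda>y. indicator N (x - t *\<^sub>R y) :: ennreal) \<in> borel_measurable borel" by measurable
  have "(\<integral>\<^sup>+w. indicator N (x - t *\<^sub>R fst w) \<partial>(usph :: ('a \<times> 'a) measure)) = 0"
    using nn_integral_usph_marginals_le(1)[OF m dim] zz by simp
  moreover have "(\<integral>\<^sup>+w. indicator N (x - t *\<^sub>R snd w) \<partial>(usph :: ('a \<times> 'a) measure)) = 0"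
    using nn_integral_usph_marginals_le(2)[OF m dim] zz by simp
  moreover have m1: "(\<lambda>w. x - t *\<^sub>R fst w) \<in> borel_measurable (borel :: ('a \<times> 'a) measure)"
    and m2: "(\<lambda>w. x - t *\<^sub>R snd w) \<in> borel_measurable (borel :: ('a \<times> 'a) measure)" by measurable
  moreover have "AE w in (sphere_measure :: ('a \<times> 'a) measure). w \<notin> h -` N"
    if "h \<in> borel_measurable borel" and "(\<integral>\<^sup>+w. indicator N (h w) \<partial>usph) = 0" for h :: "'a \<times> 'a \<Rightarrow> 'a"
  proof (rule AE_sphere_measure_notin)
    show h: "h -` N \<in> sets borel" using measurable_sets_borel[OF that(1) N(1)] by simp
    have "emeasure usph (h -` N) = (\<integral>\<^sup>+w. indicator (h -` N) w \<partial>usph)"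
      by (rule nn_integral_indicator[symmetric]) (use h in simp)
    also have "\<dots> = (\<integral>\<^sup>+w. indicator N (h w) \<partial>usph)"
      by (rule nn_integral_cong) (simp add: indicator_def)
    finally show "emeasure usph (h -` N) = 0" using that(2) by simp
  qed
  ultimately have "AE w in (sphere_measure :: ('a \<times> 'a) measure). w \<notin> (\<lambda>w. x - t *\<^sub>R fst w) -` N"
    "AE w in (sphere_measure :: ('a \<times> 'a) measure). w \<notin> (\<lambda>w. x - t *\<^sub>R snd w) -` N"
    by blast+
  then show ?thesis by eventually_elim simp
qed

text \<open>In a completion every subset of the exceptional null set is measurable, and the
  preimages under \<open>f\<close> and \<open>g\<close> differ only there.\<close>

lemma measurable_completion_cong_AE:
  assumes g: "g \<in> measurable (completion M) N" and ae: "AE x in completion M. f x = g x"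
    and sp: "\<And>x. x \<in> space M \<Longrightarrow> f x \<in> space N"
  shows "f \<in> measurable (completion M) N"
proof (rule measurableI)
  show "f x \<in> space N" if "x \<in> space (completion M)" for x using sp that by simp
  fix A assume A: "A \<in> sets N"
  have ae': "AE x in M. f x = g x" using ae by (simp add: AE_completion_iff)
  have "Measurable.pred (completion M) (\<lambda>x. f x \<noteq> g x)"
    by (rule sets_completion_AE) (use ae' in simp)
  moreover have "Measurable.pred (completion M) (\<lambda>x. f x \<in> A \<and> f x \<noteq> g x)"
    by (rule sets_completion_AE) (use ae' in \<open>auto elim!: eventually_mono\<close>)
  moreover have "Measurable.pred (completion M) (\<lambda>x. g x \<in> A)"
    using measurable_sets[OF g A] by (simp add: pred_def vimage_def Int_def conj_commute)
  ultimately have "Measurable.pred (completion M) (\<lambda>x. (g x \<in> A \<and> \<not> (f x \<noteq> g x)) \<or> (f x \<in> A \<and> f x \<noteq> g x))"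
    by measurable
  then have "Measurable.pred (completion M) (\<lambda>x. f x \<in> A)"
    by (rule arg_cong[where f="Measurable.pred (completion M)", THEN iffD1, rotated]) (auto simp: fun_eq_iff)
  then show "f -` A \<inter> space (completion M) \<in> sets (completion M)"
    by (simp add: pred_def vimage_def Int_def conj_commute)
qed

text \<open>This is where the completion inside \<open>sphere_measure\<close> is used: for Lebesgue
  measurable functions the integrand is merely almost everywhere equal to a Borel function on the
  sphere.\<close>

lemma sph_avg_cong_AE:
  fixes f g f' g' :: "'a::euclidean_space \<Rightarrow> complex"
  assumes f': "f' \<in> borel_measurable borel" and g': "g' \<in> borel_measurable borel"
    and f: "AE x in lborel. f x = f' x" and g: "AE x in lborel. g x = g' x" and t: "t \<noteq> 0" and dim: "DIM('a) \<ge> 2"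
  shows "sph_avg t f g x = sph_avg t f' g' x"
    and "integrable sphere_measure (sph_integrand t f' g' x) \<Longrightarrow> integrable sphere_measure (sph_integrand t f g x)"
proof -
  obtain N1 where N1: "N1 \<in> null_sets lborel" "{x. f x \<noteq> f' x} \<subseteq> N1"
    using f unfolding eventually_ae_filter by auto
  obtain N2 where N2: "N2 \<in> null_sets lborel" "{x. g x \<noteq> g' x} \<subseteq> N2"
    using g unfolding eventually_ae_filter by auto
  have N: "N1 \<union> N2 \<in> sets borel" "emeasure lborel (N1 \<union> N2) = 0"
    using N1(1) N2(1) null_sets.Un[of N1 lborel N2] by (auto simp: null_sets_def)
  have eq: "AE w in (sphere_measure :: ('a \<times> 'a) measure). sph_integrand t f g x w = sph_integrand t f' g' x w"
    using AE_sphere_measure_translate[OF N t dim, of x]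
  proof eventually_elim
    case (elim w)
    then have "f (x - t *\<^sub>R fst w) = f' (x - t *\<^sub>R fst w)" "g (x - t *\<^sub>R snd w) = g' (x - t *\<^sub>R snd w)"
      using N1(2) N2(2) by auto
    then show ?case by (simp add: sph_integrand_def case_prod_unfold)
  qed
  have m': "sph_integrand t f' g' x \<in> borel_measurable sphere_measure"
    by (rule borel_measurable_sphere_measure[OF sph_integrand_measurable[OF f' g']])
  then have m: "sph_integrand t f g x \<in> borel_measurable sphere_measure"
    using eq unfolding sphere_measure_def by (rule measurable_completion_cong_AE) simp
  show "sph_avg t f g x = sph_avg t f' g' x"
    unfolding sph_avg_def by (rule integral_cong_AE[OF m m' eq])
  show "integrable sphere_measure (sph_integrand t f g x)" if "integrable sphere_measure (sph_integrand t f' g' x)"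
    by (rule integrable_cong_AE_imp[OF that m]) (use eq in \<open>auto elim!: eventually_mono\<close>)
qed

lemma dyadic_sph_max_cong_AE:
  fixes f g f' g' :: "'a::euclidean_space \<Rightarrow> complex"
  assumes "f' \<in> borel_measurable borel" "g' \<in> borel_measurable borel"
    "AE x in lborel. f x = f' x" "AE x in lborel. g x = g' x" "DIM('a) \<ge> 2"
  shows "dyadic_sph_max f g = dyadic_sph_max f' g'"
  unfolding dyadic_sph_max_def[abs_def] using sph_avg_cong_AE(1)[OF assms(1-4) _ assms(5)] by simp

section \<open>Borel representatives and integrability of the averages\<close>

lemma Lp_norm_cong_AE:
  fixes h h' :: "'a::euclidean_space \<Rightarrow> ennreal"
  assumes [measurable]: "h \<in> borel_measurable lebesgue" "h' \<in> borel_measurable lebesgue"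
    and ae: "AE x in lborel. h x = h' x"
  shows "Lp_norm p h = Lp_norm p h'"
proof -
  have ae': "AE x in lebesgue. h x = h' x" using ae by (rule AE_completion)
  have "esssup lebesgue h = esssup lebesgue h'"
    using ae' by (intro antisym esssup_AE_mono) (auto elim!: eventually_mono)
  moreover have "(\<integral>\<^sup>+x. ennreal_powr (h x) r \<partial>lebesgue) = (\<integral>\<^sup>+x. ennreal_powr (h' x) r \<partial>lebesgue)" for r
    using ae' by (intro nn_integral_cong_AE) (auto elim!: eventually_mono)
  ultimately show ?thesis by (simp add: Lp_norm_def)
qed

lemma exists_borel_version:
  fixes f :: "'a::euclidean_space \<Rightarrow> complex"
  assumes f: "f \<in> borel_measurable lebesgue"
  obtains f' where "f' \<in> borel_measurable borel" "AE x in lborel. f x = f' x"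
proof -
  have "(\<lambda>x. Re (f x)) \<in> borel_measurable lebesgue" "(\<lambda>x. Im (f x)) \<in> borel_measurable lebesgue"
    using f by measurable
  then obtain r i where r: "r \<in> borel_measurable lborel" "AE x in lborel. Re (f x) = r x"
    and i: "i \<in> borel_measurable lborel" "AE x in lborel. Im (f x) = i x"
    by (metis completion_ex_borel_measurable_real)
  show ?thesis
  proof
    show "(\<lambda>x. complex_of_real (r x) + \<i> * complex_of_real (i x)) \<in> borel_measurable borel"
      using r(1) i(1) by simp
    show "AE x in lborel. f x = complex_of_real (r x) + \<i> * complex_of_real (i x)"
      using r(2) i(2) by eventually_elim (simp add: complex_eq_iff)
  qed
qed

lemma Lp_norm_infinity_AE:
  fixes f :: "'a::euclidean_space \<Rightarrow> complex"
  assumes "Lp_norm \<infinity> (\<lambda>x. ennreal (norm (f x))) < \<infinity>"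
  obtains r where "0 \<le> r" "Lp_norm \<infinity> (\<lambda>x. ennreal (norm (f x))) = ennreal r" "AE x in lborel. norm (f x) \<le> r"
proof -
  let ?e = "esssup lebesgue (\<lambda>x. ennreal (norm (f x)))"
  obtain r where r: "0 \<le> r" "?e = ennreal r"
    using assms by (cases ?e) (auto simp: Lp_norm_def)
  have "AE x in lebesgue. ennreal (norm (f x)) \<le> ?e" by (rule esssup_AE)
  then have "AE x in lborel. norm (f x) \<le> r" using r by (simp add: AE_completion_iff)
  then show ?thesis using r by (intro that[of r]) (simp_all add: Lp_norm_def)
qed

lemma Lp_norm_finite_norm:
  fixes f :: "'a::euclidean_space \<Rightarrow> complex"
  assumes a: "0 < a" and fin: "Lp_norm (ennreal a) (\<lambda>x. ennreal (norm (f x))) < \<infinity>"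
  obtains r where "0 \<le> r" "Lp_norm (ennreal a) (\<lambda>x. ennreal (norm (f x))) = ennreal r"
    "(\<integral>\<^sup>+x. ennreal (norm (f x) powr a) \<partial>lborel) = ennreal (r powr a)"
proof -
  let ?I = "\<integral>\<^sup>+x. ennreal (norm (f x) powr a) \<partial>lborel"
  have eq: "Lp_norm (ennreal a) (\<lambda>x. ennreal (norm (f x))) = ennreal_powr ?I (1 / a)"
    using a by (simp add: Lp_norm_finite_exponent ennreal_powr_ennreal)
  then have "?I \<noteq> \<infinity>" using fin by (auto simp: ennreal_powr_def)
  then obtain m where m: "0 \<le> m" "?I = ennreal m" by (cases ?I) auto
  show ?thesis
  proof (rule that[of "m powr (1 / a)"])
    show "Lp_norm (ennreal a) (\<lambda>x. ennreal (norm (f x))) = ennreal (m powr (1 / a))"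
      unfolding eq m(2) by (rule ennreal_powr_ennreal[OF m(1)])
    show "?I = ennreal ((m powr (1 / a)) powr a)" using a m by (simp add: powr_powr)
  qed simp
qed

text \<open>For an exponent above 2 a function need not be square integrable, but it is so locally,
  since \<open>y\<^sup>2 \<le> 1 + y powr a\<close>. An average at one point and one scale sees a
  bounded region only, so localisation makes the square integrable theory applicable.\<close>

lemma sqint_localized:
  fixes f :: "'a::euclidean_space \<Rightarrow> complex"
  assumes [measurable]: "f \<in> borel_measurable borel" and p: "2 \<le> p" and fin: "Lp_norm p (\<lambda>x. ennreal (norm (f x))) < \<infinity>"
  shows "sqint (\<lambda>u. norm (f u) * indicator (ball x r) u)"
proof -
  let ?h = "\<lambda>u. norm (f u) * indicator (ball x r) u"
  have vol: "emeasure lborel (ball x r) < \<infinity>"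
    by (cases "0 \<le> r") (auto simp: emeasure_ball ball_empty)
  have "(\<integral>\<^sup>+u. ennreal ((?h u)\<^sup>2) \<partial>lborel) < \<infinity>"
  proof (cases p)
    case top
    then obtain b where b: "0 \<le> b" "AE x in lborel. norm (f x) \<le> b"
      using fin Lp_norm_infinity_AE[of f] by (metis infinity_ennreal_def)
    have "(\<integral>\<^sup>+u. ennreal ((?h u)\<^sup>2) \<partial>lborel) \<le> (\<integral>\<^sup>+u. ennreal (b\<^sup>2) * indicator (ball x r) u \<partial>lborel)"
    proof (rule nn_integral_mono_AE)
      show "AE u in lborel. ennreal ((?h u)\<^sup>2) \<le> ennreal (b\<^sup>2) * indicator (ball x r) u"
        using b(2) by eventually_elim (auto simp: indicator_def intro!: ennreal_leI power_mono)
    qed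
    also have "\<dots> < \<infinity>" using vol by (simp add: nn_integral_cmult_indicator ennreal_mult_less_top)
    finally show ?thesis .
  next
    case (real a)
    then have a: "2 \<le> a" using p by (simp flip: ennreal_numeral)
    have F: "(\<integral>\<^sup>+u. ennreal (norm (f u) powr a) \<partial>lborel) < \<infinity>"
      using Lp_norm_finite_norm[of a f] fin a real by (metis ennreal_less_top infinity_ennreal_def less_le_trans zero_less_numeral)
    have "(\<integral>\<^sup>+u. ennreal ((?h u)\<^sup>2) \<partial>lborel) \<le> (\<integral>\<^sup>+u. indicator (ball x r) u + ennreal (norm (f u) powr a) \<partial>lborel)"
    proof (rule nn_integral_mono)
      fix u
      have "y\<^sup>2 \<le> 1 + y powr a" if y: "0 \<le> y" for y :: real
      proof (cases "y \<le> 1")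
        case True
        then have "y\<^sup>2 \<le> 1" using y by (simp add: power_le_one)
        then show ?thesis by (simp add: add_increasing2)
      next
        case False
        then have "y\<^sup>2 = y powr 2" by (simp add: powr_numeral)
        also have "\<dots> \<le> y powr a" using False a by (intro powr_mono) auto
        finally show ?thesis by simp
      qed
      from this[of "norm (f u)"] have "ennreal ((norm (f u))\<^sup>2) \<le> 1 + ennreal (norm (f u) powr a)"
        by (simp flip: ennreal_1 ennreal_plus)
      then show "ennreal ((?h u)\<^sup>2) \<le> indicator (ball x r) u + ennreal (norm (f u) powr a)"
        by (simp add: indicator_def)
    qed
    also have "\<dots> = emeasure lborel (ball x r) + (\<integral>\<^sup>+u. ennreal (norm (f u) powr a) \<partial>lborel)"
      by (subst nn_integral_add) simp_all
    also have "\<dots> < \<infinity>" using vol F by simp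
    finally show ?thesis .
  qed
  then show ?thesis unfolding sqint_def by (auto simp: integrable_iff_bounded)
qed

lemma integrable_sph_integrand:
  fixes f g :: "'a::euclidean_space \<Rightarrow> complex"
  assumes [measurable]: "f \<in> borel_measurable borel" "g \<in> borel_measurable borel"
    and p: "2 \<le> p1" "2 \<le> p2" and t: "0 < t" and dim: "DIM('a) \<ge> 2"
    and fin: "Lp_norm p1 (\<lambda>x. ennreal (norm (f x))) < \<infinity>" "Lp_norm p2 (\<lambda>x. ennreal (norm (g x))) < \<infinity>"
  shows "integrable sphere_measure (sph_integrand t f g x)"
proof (rule integrableI_bounded)
  show "sph_integrand t f g x \<in> borel_measurable sphere_measure"
    by (intro borel_measurable_sphere_measure sph_integrand_measurable) measurable
  \<comment> \<open>The radius is \<open>2 * t\<close> and not \<open>t\<close> because the ball is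
    open while the components of a unit vector may have norm 1.\<close>
  let ?F = "\<lambda>u. norm (f u) * indicator (ball x (2 * t)) u" and ?G = "\<lambda>u. norm (g u) * indicator (ball x (2 * t)) u"
  have int: "integrable (usph :: ('a \<times> 'a) measure) (\<lambda>w. ?F (x - t *\<^sub>R fst w) * ?G (x - t *\<^sub>R snd w))"
    by (rule integrable_bilin[OF sqint_localized[OF _ p(1) fin(1)] sqint_localized[OF _ p(2) fin(2)]]) (use t dim in auto)
  have m: "(\<lambda>w. ennreal (norm (sph_integrand t f g x w))) \<in> borel_measurable borel"
    using sph_integrand_measurable[of f g t x] by measurable
  have "(\<integral>\<^sup>+w. ennreal (norm (sph_integrand t f g x w)) \<partial>(usph :: ('a \<times> 'a) measure)) =
     (\<integral>\<^sup>+w. ennreal (norm (?F (x - t *\<^sub>R fst w) * ?G (x - t *\<^sub>R snd w))) \<partial>(usph :: ('a \<times> 'a) measure))"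
  proof (rule nn_integral_cong_AE)
    show "AE w in (usph :: ('a \<times> 'a) measure). ennreal (norm (sph_integrand t f g x w)) = ennreal (norm (?F (x - t *\<^sub>R fst w) * ?G (x - t *\<^sub>R snd w)))"
      using AE_usph_fst_snd
    proof eventually_elim
      case (elim w)
      have "x - t *\<^sub>R y \<in> ball x (2 * t)" if "norm y \<le> 1" for y :: 'a
      proof -
        have "t * norm y \<le> t * 1" using that t by (intro mult_left_mono) auto
        then show ?thesis using t by (simp add: dist_norm)
      qed
      then show ?case using elim by (simp add: sph_integrand_def case_prod_unfold norm_mult)
    qed
  qed
  also have "\<dots> < \<infinity>" using int by (simp add: integrable_iff_bounded)
  finally show "(\<integral>\<^sup>+w. ennreal (norm (sph_integrand t f g x w)) \<partial>sphere_measure) < \<infinity>"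
    unfolding nn_integral_sphere_measure[OF m] by (simp add: ennreal_mult_less_top)
qed

section \<open>The bound for each triple of exponents\<close>

definition sph_max_bounded :: "'a::euclidean_space itself \<Rightarrow> ennreal \<Rightarrow> ennreal \<Rightarrow> ennreal \<Rightarrow> bool" where
  "sph_max_bounded _ p1 p2 p \<longleftrightarrow> (\<exists>C::real. \<forall>f g :: 'a \<Rightarrow> complex. f \<in> borel_measurable borel \<longrightarrow> g \<in> borel_measurable borel \<longrightarrow>
     Lp_norm p1 (\<lambda>x. ennreal (norm (f x))) < \<infinity> \<longrightarrow> Lp_norm p2 (\<lambda>x. ennreal (norm (g x))) < \<infinity> \<longrightarrow>
     Lp_norm p (dyadic_sph_max f g) \<le> ennreal C * Lp_norm p1 (\<lambda>x. ennreal (norm (f x))) * Lp_norm p2 (\<lambda>x. ennreal (norm (g x))))"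

lemma mass_avg_pos: "0 < sphere_mass TYPE('a::euclidean_space \<times> 'a) * avg_const TYPE('a)"
  using marg_const_pos[where 'a='a] by (simp add: sphere_mass_def avg_const_def DIM_positive add_pos_pos)

text \<open>These are the only admissible triples with an infinite exponent: the other exponent then
  equals \<open>p\<close>, and \<open>p \<le> 2\<close>. The bounded factor is replaced by its
  bound, so that a single maximal function remains, with 0 as the second majorant.\<close>

lemma sph_max_bounded_infinity_2:
  assumes dim: "DIM('a::euclidean_space) \<ge> 2"
  shows "sph_max_bounded TYPE('a) \<infinity> 2 2" "sph_max_bounded TYPE('a) 2 \<infinity> 2"
proof -
  define K where "K = sphere_mass TYPE('a \<times> 'a) * avg_const TYPE('a)"
  define C where "C = (2 * K powr 2 * 2 powr 2 * (5 ^ DIM('a) * 2 powr 2 * 2 / (2 - 1))) powr (1 / 2)"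
  have K: "0 < K" unfolding K_def by (rule mass_avg_pos)
  have C: "0 \<le> C" by (simp add: C_def)
  have key: "Lp_norm 2 (dyadic_sph_max f g) \<le> ennreal (C * (a * b)) \<and> Lp_norm 2 (dyadic_sph_max g f) \<le> ennreal (C * (a * b))"
    if m: "f \<in> borel_measurable borel" "g \<in> borel_measurable borel" and a: "0 \<le> a" "AE x in lborel. norm (f x) \<le> a"
      and b: "0 \<le> b" "(\<integral>\<^sup>+x. ennreal (norm (g x) powr 2) \<partial>lborel) = ennreal (b powr 2)"
    for f g :: "'a \<Rightarrow> complex" and a b
  proof -
    note [measurable] = m
    \<comment> \<open>The domination required below is pointwise for all pairs of arguments, so the
      essential bound is made a true bound by a change on a null set.\<close>
    define f' where "f' x = (if norm (f x) \<le> a then f x else 0)" for x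
    have f' [measurable]: "f' \<in> borel_measurable borel" unfolding f'_def by measurable
    have ae: "AE x in lborel. f x = f' x" using a(2) by eventually_elim (simp add: f'_def)
    have bd: "norm (f' x) \<le> a" for x using a by (simp add: f'_def)
    have eq: "dyadic_sph_max f g = dyadic_sph_max f' g" "dyadic_sph_max g f = dyadic_sph_max g f'"
      using dyadic_sph_max_cong_AE[OF f' m(2) ae _ dim, of g] dyadic_sph_max_cong_AE[OF m(2) f' _ ae dim, of g] by simp_all
    let ?\<Gamma> = "\<lambda>u. a * norm (g u)"
    have "(\<integral>\<^sup>+u. ennreal (?\<Gamma> u powr 2) \<partial>lborel) = (\<integral>\<^sup>+u. ennreal (a powr 2) * ennreal (norm (g u) powr 2) \<partial>lborel)"
      using a by (intro nn_integral_cong) (simp add: powr_mult ennreal_mult power_mult_distrib)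
    also have "\<dots> = ennreal (a powr 2) * ennreal (b powr 2)" using b(2) by (subst nn_integral_cmult) auto
    also have "\<dots> = ennreal ((a * b) powr 2)" using a b by (simp add: powr_mult ennreal_mult power_mult_distrib)
    finally have G: "(\<integral>\<^sup>+u. ennreal (?\<Gamma> u powr 2) \<partial>lborel) \<le> ennreal ((a * b) powr 2)" by simp
    have Z: "(\<integral>\<^sup>+u. ennreal ((0::real) powr 2) \<partial>(lborel :: 'a measure)) \<le> ennreal ((a * b) powr 2)" by simp
    have 1: "dyadic_sph_max f' g x \<le> ennreal K * (hl_max (\<lambda>u. ennreal 0) x + hl_max (\<lambda>u. ennreal (?\<Gamma> u)) x)" for x
      unfolding K_def using bd a by (intro dyadic_sph_max_le_hl_max dim) (auto intro!: ennreal_leI mult_right_mono)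
    have 2: "dyadic_sph_max g f' x \<le> ennreal K * (hl_max (\<lambda>u. ennreal (?\<Gamma> u)) x + hl_max (\<lambda>u. ennreal 0) x)" for x
      unfolding K_def using bd a by (intro dyadic_sph_max_le_hl_max dim) (auto intro!: ennreal_leI mult_right_mono simp: mult.commute[of "norm (g _)"])
    have "Lp_norm (ennreal 2) (dyadic_sph_max f' g) \<le> ennreal (C * (a * b))"
      unfolding C_def by (rule Lp_norm_hl_max_le[where \<Phi>="\<lambda>_. 0" and \<Gamma>="?\<Gamma>", OF _ _ _ _ _ K _ Z G 1]) (use a b in auto)
    moreover have "Lp_norm (ennreal 2) (dyadic_sph_max g f') \<le> ennreal (C * (a * b))"
      unfolding C_def by (rule Lp_norm_hl_max_le[where \<Phi>="?\<Gamma>" and \<Gamma>="\<lambda>_. 0", OF _ _ _ _ _ K _ G Z 2]) (use a b in auto)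
    ultimately show ?thesis by (simp add: eq)
  qed
  show "sph_max_bounded TYPE('a) \<infinity> 2 2" unfolding sph_max_bounded_def
  proof (rule exI[of _ C], intro allI impI)
    fix f g :: "'a \<Rightarrow> complex"
    assume m: "f \<in> borel_measurable borel" "g \<in> borel_measurable borel"
      and fin: "Lp_norm \<infinity> (\<lambda>x. ennreal (norm (f x))) < \<infinity>" "Lp_norm 2 (\<lambda>x. ennreal (norm (g x))) < \<infinity>"
    obtain a where a: "0 \<le> a" "Lp_norm \<infinity> (\<lambda>x. ennreal (norm (f x))) = ennreal a" "AE x in lborel. norm (f x) \<le> a"
      using Lp_norm_infinity_AE[OF fin(1)] by blast
    obtain b where b: "0 \<le> b" "Lp_norm (ennreal 2) (\<lambda>x. ennreal (norm (g x))) = ennreal b"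
      "(\<integral>\<^sup>+x. ennreal (norm (g x) powr 2) \<partial>lborel) = ennreal (b powr 2)"
      using Lp_norm_finite_norm[of 2 g] fin(2) by auto
    show "Lp_norm 2 (dyadic_sph_max f g) \<le> ennreal C * Lp_norm \<infinity> (\<lambda>x. ennreal (norm (f x))) * Lp_norm 2 (\<lambda>x. ennreal (norm (g x)))"
      using key[OF m a(1,3) b(1,3)] a b C by (simp add: ennreal_mult mult.assoc)
  qed
  show "sph_max_bounded TYPE('a) 2 \<infinity> 2" unfolding sph_max_bounded_def
  proof (rule exI[of _ C], intro allI impI)
    fix g f :: "'a \<Rightarrow> complex"
    assume m: "g \<in> borel_measurable borel" "f \<in> borel_measurable borel"
      and fin: "Lp_norm 2 (\<lambda>x. ennreal (norm (g x))) < \<infinity>" "Lp_norm \<infinity> (\<lambda>x. ennreal (norm (f x))) < \<infinity>"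
    obtain a where a: "0 \<le> a" "Lp_norm \<infinity> (\<lambda>x. ennreal (norm (f x))) = ennreal a" "AE x in lborel. norm (f x) \<le> a"
      using Lp_norm_infinity_AE[OF fin(2)] by blast
    obtain b where b: "0 \<le> b" "Lp_norm (ennreal 2) (\<lambda>x. ennreal (norm (g x))) = ennreal b"
      "(\<integral>\<^sup>+x. ennreal (norm (g x) powr 2) \<partial>lborel) = ennreal (b powr 2)"
      using Lp_norm_finite_norm[of 2 g] fin(1) by auto
    show "Lp_norm 2 (dyadic_sph_max g f) \<le> ennreal C * Lp_norm 2 (\<lambda>x. ennreal (norm (g x))) * Lp_norm \<infinity> (\<lambda>x. ennreal (norm (f x)))"
      using key[OF m(2,1) a(1,3) b(1,3)] a b C by (simp add: ennreal_mult mult_ac)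
  qed
qed

text \<open>Needed before functions are divided by their norms: norm zero means zero almost
  everywhere, and then all averages vanish.\<close>

lemma dyadic_sph_max_eq_0:
  fixes f g :: "'a::euclidean_space \<Rightarrow> complex"
  assumes m: "f \<in> borel_measurable borel" "g \<in> borel_measurable borel" and dim: "DIM('a) \<ge> 2"
    and z: "(AE x in lborel. f x = 0) \<or> (AE x in lborel. g x = 0)"
  shows "dyadic_sph_max f g x = 0"
proof -
  have zero: "dyadic_sph_max h (\<lambda>_. 0) x = 0" "dyadic_sph_max (\<lambda>_. 0) h x = 0" for h :: "'a \<Rightarrow> complex"
    by (simp_all add: dyadic_sph_max_def sph_avg_def sph_integrand_def case_prod_unfold)
  show ?thesis
    using z
  proof
    assume "AE x in lborel. f x = 0"
    then have "dyadic_sph_max f g = dyadic_sph_max (\<lambda>_. 0) g"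
      by (intro dyadic_sph_max_cong_AE m dim) auto
    then show ?thesis by (simp add: zero)
  next
    assume "AE x in lborel. g x = 0"
    then have "dyadic_sph_max f g = dyadic_sph_max f (\<lambda>_. 0)"
      by (intro dyadic_sph_max_cong_AE m dim) auto
    then show ?thesis by (simp add: zero)
  qed
qed

lemma AE_eq_0_of_nn_integral_powr:
  fixes f :: "'a::euclidean_space \<Rightarrow> complex"
  assumes [measurable]: "f \<in> borel_measurable borel" and "(\<integral>\<^sup>+x. ennreal (norm (f x) powr a) \<partial>lborel) = 0"
  shows "AE x in lborel. f x = 0"
proof -
  have "AE x in lborel. ennreal (norm (f x) powr a) = 0"
    using assms(2) by (subst (asm) nn_integral_0_iff_AE) auto
  then show ?thesis
  proof eventually_elim
    case (elim x)
    then have "norm (f x) powr a = 0" by (simp add: ennreal_eq_0_iff)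
    then show ?case by (simp add: powr_eq_0_iff)
  qed
qed

lemma Lp_norm_zero: "0 < a \<Longrightarrow> (\<And>x. h x = 0) \<Longrightarrow> Lp_norm (ennreal a) h = 0" for h :: "'a::euclidean_space \<Rightarrow> ennreal"
  by (simp add: Lp_norm_finite_exponent ennreal_powr_def)

text \<open>Young's inequality with the conjugate exponents \<open>a / c\<close> and
  \<open>b / c\<close>, applied to the functions divided by their norms \<open>\<alpha>\<close> and
  \<open>\<beta>\<close>. The resulting powers have norm 1 in the exponent \<open>c\<close>, and the
  factor \<open>s = \<alpha> * \<beta>\<close> in front restores the size of the product. The strong
  type bound is available because \<open>c > 1\<close>.\<close>

lemma sph_max_bounded_finite_exponents:
  assumes dim: "DIM('a::euclidean_space) \<ge> 2" and c: "1 < c" and a: "0 < a" and b: "0 < b" and abc: "1 / c = 1 / a + 1 / b"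
  shows "sph_max_bounded TYPE('a) (ennreal a) (ennreal b) (ennreal c)"
proof -
  define K where "K = sphere_mass TYPE('a \<times> 'a) * avg_const TYPE('a)"
  define C where "C = (2 * K powr c * 2 powr c * (5 ^ DIM('a) * 2 powr c * c / (c - 1))) powr (1 / c)"
  have K: "0 < K" unfolding K_def by (rule mass_avg_pos)
  have C: "0 \<le> C" by (simp add: C_def)
  show ?thesis unfolding sph_max_bounded_def
  proof (rule exI[of _ C], intro allI impI)
    fix f g :: "'a \<Rightarrow> complex"
    assume m [measurable]: "f \<in> borel_measurable borel" "g \<in> borel_measurable borel"
      and fin: "Lp_norm (ennreal a) (\<lambda>x. ennreal (norm (f x))) < \<infinity>" "Lp_norm (ennreal b) (\<lambda>x. ennreal (norm (g x))) < \<infinity>"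
    obtain \<alpha> where \<alpha>: "0 \<le> \<alpha>" "Lp_norm (ennreal a) (\<lambda>x. ennreal (norm (f x))) = ennreal \<alpha>"
      "(\<integral>\<^sup>+x. ennreal (norm (f x) powr a) \<partial>lborel) = ennreal (\<alpha> powr a)"
      using Lp_norm_finite_norm[OF a fin(1)] by blast
    obtain \<beta> where \<beta>: "0 \<le> \<beta>" "Lp_norm (ennreal b) (\<lambda>x. ennreal (norm (g x))) = ennreal \<beta>"
      "(\<integral>\<^sup>+x. ennreal (norm (g x) powr b) \<partial>lborel) = ennreal (\<beta> powr b)"
      using Lp_norm_finite_norm[OF b fin(2)] by blast
    have "Lp_norm (ennreal c) (dyadic_sph_max f g) \<le> ennreal (C * (\<alpha> * \<beta>))"
    proof (cases "\<alpha> = 0 \<or> \<beta> = 0")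
      case True
      then have "(AE x in lborel. f x = 0) \<or> (AE x in lborel. g x = 0)"
        using AE_eq_0_of_nn_integral_powr[OF m(1), of a] AE_eq_0_of_nn_integral_powr[OF m(2), of b] \<alpha>(3) \<beta>(3) by auto
      then have "Lp_norm (ennreal c) (dyadic_sph_max f g) = 0"
        using c by (intro Lp_norm_zero dyadic_sph_max_eq_0[OF m dim]) auto
      then show ?thesis by simp
    next
      case False
      then have pos: "0 < \<alpha>" "0 < \<beta>" using \<alpha> \<beta> by auto
      define s where "s = \<alpha> * \<beta>"
      have s: "0 < s" using pos by (simp add: s_def)
      let ?\<Phi> = "\<lambda>u. s * (norm (f u) / \<alpha>) powr (a / c)" and ?\<Gamma> = "\<lambda>u. s * (norm (g u) / \<beta>) powr (b / c)"
      have norm1: "(\<integral>\<^sup>+u. ennreal ((s * (norm (h u) / \<gamma>) powr (e / c)) powr c) \<partial>lborel) \<le> ennreal (s powr c)"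
        if [measurable]: "h \<in> borel_measurable borel" and g0: "0 < \<gamma>" and e: "0 < e"
          and I: "(\<integral>\<^sup>+x. ennreal (norm (h x) powr e) \<partial>lborel) = ennreal (\<gamma> powr e)" for h :: "'a \<Rightarrow> complex" and \<gamma> e
      proof -
        have "(s * (norm (h u) / \<gamma>) powr (e / c)) powr c = s powr c / \<gamma> powr e * norm (h u) powr e" for u
          using s g0 c by (simp add: powr_mult powr_powr powr_divide)
        then have "(\<integral>\<^sup>+u. ennreal ((s * (norm (h u) / \<gamma>) powr (e / c)) powr c) \<partial>lborel) =
           (\<integral>\<^sup>+u. ennreal (s powr c / \<gamma> powr e) * ennreal (norm (h u) powr e) \<partial>lborel)"
          by (simp only: ennreal_mult'[symmetric] divide_nonneg_nonneg powr_ge_zero)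
        also have "\<dots> = ennreal (s powr c / \<gamma> powr e) * ennreal (\<gamma> powr e)"
          using I by (subst nn_integral_cmult) auto
        also have "\<dots> = ennreal (s powr c / \<gamma> powr e * \<gamma> powr e)" by (rule ennreal_mult'[symmetric]) simp
        also have "s powr c / \<gamma> powr e * \<gamma> powr e = s powr c" using g0 by simp
        finally show ?thesis by simp
      qed
      have young: "norm (f u) * norm (g v) \<le> ?\<Phi> u + ?\<Gamma> v" for u v
      proof -
        let ?x = "norm (f u) / \<alpha>" and ?y = "norm (g v) / \<beta>"
        have pq: "1 < a / c" "1 < b / c" "1 / (a / c) + 1 / (b / c) = 1"
        proof -
          have "1 / a < 1 / c" "1 / b < 1 / c" using abc a b by simp_all
          then show "1 < a / c" "1 < b / c" using a b c by (simp_all add: field_simps)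
          have "1 / (a / c) + 1 / (b / c) = c * (1 / a + 1 / b)" using c by (simp add: algebra_simps)
          then show "1 / (a / c) + 1 / (b / c) = 1" using c by (simp only: abc[symmetric]) simp
        qed
        have "?x * ?y \<le> ?x powr (a / c) / (a / c) + ?y powr (b / c) / (b / c)"
          by (rule Youngs_inequality[OF pq]) (use \<alpha> \<beta> in auto)
        also have "\<dots> \<le> ?x powr (a / c) + ?y powr (b / c)"
        proof -
          have div: "z / r \<le> z" if "0 \<le> z" "1 < r" for z r :: real
            using that by (simp add: divide_le_eq mult_le_cancel_left1)
          show ?thesis by (intro add_mono div pq powr_ge_zero)
        qed
        finally have "s * (?x * ?y) \<le> s * (?x powr (a / c) + ?y powr (b / c))" using s by (intro mult_left_mono) auto
        moreover have "s * (?x * ?y) = norm (f u) * norm (g v)" using pos by (simp add: s_def)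
        ultimately show ?thesis by (simp add: distrib_left)
      qed
      have D: "dyadic_sph_max f g x \<le> ennreal K * (hl_max (\<lambda>u. ennreal (?\<Phi> u)) x + hl_max (\<lambda>u. ennreal (?\<Gamma> u)) x)" for x
        unfolding K_def
      proof (rule dyadic_sph_max_le_hl_max)
        show "ennreal (norm (f u) * norm (g v)) \<le> ennreal (?\<Phi> u) + ennreal (?\<Gamma> v)" for u v
          using young[of u v] s by (simp flip: ennreal_plus)
      qed (use dim in auto)
      have "Lp_norm (ennreal c) (dyadic_sph_max f g) \<le> ennreal (C * s)"
        unfolding C_def
        by (rule Lp_norm_hl_max_le[where \<Phi>="?\<Phi>" and \<Gamma>="?\<Gamma>", OF _ _ _ _ c K _
              norm1[OF m(1) pos(1) a \<alpha>(3)] norm1[OF m(2) pos(2) b \<beta>(3)] D]) (use s in auto)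
      then show ?thesis by (simp add: s_def)
    qed
    also have "ennreal (C * (\<alpha> * \<beta>)) = ennreal C * Lp_norm (ennreal a) (\<lambda>x. ennreal (norm (f x))) * Lp_norm (ennreal b) (\<lambda>x. ennreal (norm (g x)))"
      using C \<alpha> \<beta> by (simp add: ennreal_mult mult.assoc)
    finally show "Lp_norm (ennreal c) (dyadic_sph_max f g) \<le> \<dots>" .
  qed
qed

text \<open>Reduction to real functions, for which the cube averages were set up. Square
  integrability of the four parts makes the complex integral split.\<close>

lemma norm_sph_avg_le_bilin:
  fixes f g :: "'a::euclidean_space \<Rightarrow> complex"
  assumes m [measurable]: "f \<in> borel_measurable borel" "g \<in> borel_measurable borel"
    and sq: "sqint (\<lambda>x. Re (f x))" "sqint (\<lambda>x. Im (f x))" "sqint (\<lambda>x. Re (g x))" "sqint (\<lambda>x. Im (g x))"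
    and t: "t \<noteq> 0" and dim: "DIM('a) \<ge> 2"
  shows "norm (sph_avg t f g x) \<le> sphere_mass TYPE('a \<times> 'a) *
    (\<bar>bilin t (\<lambda>x. Re (f x)) (\<lambda>x. Re (g x)) x\<bar> + \<bar>bilin t (\<lambda>x. Im (f x)) (\<lambda>x. Im (g x)) x\<bar> +
     \<bar>bilin t (\<lambda>x. Re (f x)) (\<lambda>x. Im (g x)) x\<bar> + \<bar>bilin t (\<lambda>x. Im (f x)) (\<lambda>x. Re (g x)) x\<bar>)"
proof -
  let ?b = "\<lambda>F G. bilin t F G x"
  let ?fr = "\<lambda>x. Re (f x)" and ?fi = "\<lambda>x. Im (f x)" and ?gr = "\<lambda>x. Re (g x)" and ?gi = "\<lambda>x. Im (g x)"
  have I: "integrable (usph :: ('a \<times> 'a) measure) (\<lambda>w. complex_of_real (F (x - t *\<^sub>R fst w) * G (x - t *\<^sub>R snd w)))"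
    if "sqint F" "sqint G" for F G
    by (rule integrable_of_real[OF integrable_bilin[OF that t dim]])
  let ?z = "\<integral>w. f (x - t *\<^sub>R fst w) * g (x - t *\<^sub>R snd w) \<partial>(usph :: ('a \<times> 'a) measure)"
  have "?z = (\<integral>w. (complex_of_real (?fr (x - t *\<^sub>R fst w) * ?gr (x - t *\<^sub>R snd w)) - complex_of_real (?fi (x - t *\<^sub>R fst w) * ?gi (x - t *\<^sub>R snd w))) +
       \<i> * (complex_of_real (?fr (x - t *\<^sub>R fst w) * ?gi (x - t *\<^sub>R snd w)) + complex_of_real (?fi (x - t *\<^sub>R fst w) * ?gr (x - t *\<^sub>R snd w))) \<partial>(usph :: ('a \<times> 'a) measure))"
    by (intro Bochner_Integration.integral_cong refl) (simp add: complex_eq_iff)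
  also have "\<dots> = (complex_of_real (?b ?fr ?gr) - complex_of_real (?b ?fi ?gi)) + \<i> * (complex_of_real (?b ?fr ?gi) + complex_of_real (?b ?fi ?gr))"
    unfolding bilin_def
    by (simp only: Bochner_Integration.integral_add Bochner_Integration.integral_diff integral_mult_right_zero
        Bochner_Integration.integrable_add Bochner_Integration.integrable_diff integrable_mult_right integral_complex_of_real I[OF sq(1,3)] I[OF sq(2,4)] I[OF sq(1,4)] I[OF sq(2,3)])
  finally have z: "?z = Complex (?b ?fr ?gr - ?b ?fi ?gi) (?b ?fr ?gi + ?b ?fi ?gr)"
    by (simp add: complex_eq_iff)
  have "norm ?z \<le> \<bar>?b ?fr ?gr - ?b ?fi ?gi\<bar> + \<bar>?b ?fr ?gi + ?b ?fi ?gr\<bar>"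
    unfolding z using cmod_le[of "Complex (?b ?fr ?gr - ?b ?fi ?gi) (?b ?fr ?gi + ?b ?fi ?gr)"] by simp
  also have "\<dots> \<le> \<bar>?b ?fr ?gr\<bar> + \<bar>?b ?fi ?gi\<bar> + \<bar>?b ?fr ?gi\<bar> + \<bar>?b ?fi ?gr\<bar>" by linarith
  finally have "norm ?z \<le> \<dots>" .
  then have "sphere_mass TYPE('a \<times> 'a) * norm ?z \<le> sphere_mass TYPE('a \<times> 'a) * (\<bar>?b ?fr ?gr\<bar> + \<bar>?b ?fi ?gi\<bar> + \<bar>?b ?fr ?gi\<bar> + \<bar>?b ?fi ?gr\<bar>)"
    by (intro mult_left_mono sphere_mass_nonneg)
  then show ?thesis
    unfolding sph_avg_usph[OF m] using sphere_mass_nonneg[where 'a="'a \<times> 'a"] by simp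
qed

text \<open>The maximal estimate has a sum of squared norms on its right-hand side. Applied to real
  and imaginary parts divided by the norms of \<open>f\<close> and \<open>g\<close>, and scaled back
  by bilinearity, it yields a multiple of the product of the norms.\<close>

lemma sph_max_bounded_2_2_1:
  assumes dim: "DIM('a::euclidean_space) \<ge> 2"
  shows "sph_max_bounded TYPE('a) 2 2 1"
proof -
  obtain C1 where C1: "0 < C1" "\<And>F G :: 'a \<Rightarrow> real. sqint F \<Longrightarrow> sqint G \<Longrightarrow>
    (\<integral>\<^sup>+x. (SUP k::int. ennreal \<bar>bilin (2 powi k) F G x\<bar>) \<partial>lborel) \<le> ennreal (C1 * (sqnorm F + sqnorm G))"
    using bilin_maximal_estimate[OF dim] by metis
  define s where "s = sphere_mass TYPE('a \<times> 'a)"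
  have s: "0 \<le> s" unfolding s_def by (rule sphere_mass_nonneg)
  \<comment> \<open>Four combinations of real and imaginary parts, each bounded by
    \<open>C1 * (1 + 1)\<close> after normalisation, times the mass of the sphere.\<close>
  define C where "C = s * (4 * (2 * C1))"
  have C: "0 \<le> C" using s C1 by (simp add: C_def)
  have p1: "ennreal_powr y 1 = y" for y by (cases y) (simp_all add: ennreal_powr_def)
  show ?thesis unfolding sph_max_bounded_def
  proof (rule exI[of _ C], intro allI impI)
    fix f g :: "'a \<Rightarrow> complex"
    assume m [measurable]: "f \<in> borel_measurable borel" "g \<in> borel_measurable borel"
      and fin: "Lp_norm 2 (\<lambda>x. ennreal (norm (f x))) < \<infinity>" "Lp_norm 2 (\<lambda>x. ennreal (norm (g x))) < \<infinity>"
    obtain \<alpha> where \<alpha>: "0 \<le> \<alpha>" "Lp_norm (ennreal 2) (\<lambda>x. ennreal (norm (f x))) = ennreal \<alpha>"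
      "(\<integral>\<^sup>+x. ennreal (norm (f x) powr 2) \<partial>lborel) = ennreal (\<alpha> powr 2)"
      using Lp_norm_finite_norm[of 2 f] fin(1) by auto
    obtain \<beta> where \<beta>: "0 \<le> \<beta>" "Lp_norm (ennreal 2) (\<lambda>x. ennreal (norm (g x))) = ennreal \<beta>"
      "(\<integral>\<^sup>+x. ennreal (norm (g x) powr 2) \<partial>lborel) = ennreal (\<beta> powr 2)"
      using Lp_norm_finite_norm[of 2 g] fin(2) by auto
    have L1: "Lp_norm 1 h = (\<integral>\<^sup>+x. h x \<partial>lborel)" for h :: "'a \<Rightarrow> ennreal"
      using Lp_norm_finite_exponent[of 1 h] by (simp add: p1)
    have "Lp_norm 1 (dyadic_sph_max f g) \<le> ennreal (C * (\<alpha> * \<beta>))"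
    proof (cases "\<alpha> = 0 \<or> \<beta> = 0")
      case True
      then have "(AE x in lborel. f x = 0) \<or> (AE x in lborel. g x = 0)"
        using AE_eq_0_of_nn_integral_powr[OF m(1), of 2] AE_eq_0_of_nn_integral_powr[OF m(2), of 2] \<alpha>(3) \<beta>(3) by auto
      then show ?thesis by (simp add: L1 dyadic_sph_max_eq_0[OF m dim])
    next
      case False
      then have pos: "0 < \<alpha>" "0 < \<beta>" using \<alpha> \<beta> by auto
      have part: "sqint q \<and> sqint (\<lambda>x. 1 / \<gamma> * q x) \<and> sqnorm (\<lambda>x. 1 / \<gamma> * q x) \<le> 1"
        if [measurable]: "q \<in> borel_measurable borel" and le: "\<And>x. \<bar>q x\<bar> \<le> norm (h x)" and g0: "0 < \<gamma>"
          and I: "(\<integral>\<^sup>+x. ennreal (norm (h x) powr 2) \<partial>lborel) = ennreal (\<gamma> powr 2)" for q :: "'a \<Rightarrow> real" and h :: "'a \<Rightarrow> complex" and \<gamma>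
      proof -
        have "(\<integral>\<^sup>+x. ennreal ((q x)\<^sup>2) \<partial>lborel) \<le> (\<integral>\<^sup>+x. ennreal (norm (h x) powr 2) \<partial>lborel)"
        proof (intro nn_integral_mono ennreal_leI)
          fix x
          have "\<bar>q x\<bar>\<^sup>2 \<le> (norm (h x))\<^sup>2" by (intro power_mono le) simp
          then show "(q x)\<^sup>2 \<le> norm (h x) powr 2" by simp
        qed
        then have b: "(\<integral>\<^sup>+x. ennreal ((q x)\<^sup>2) \<partial>lborel) \<le> ennreal (\<gamma>\<^sup>2)" using I g0 by simp
        then have q: "sqint q" unfolding sqint_def by (auto simp: integrable_iff_bounded intro: le_less_trans)
        then have "ennreal (sqnorm q) \<le> ennreal (\<gamma>\<^sup>2)" using b by (simp add: nn_integral_square)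
        then have sn: "sqnorm q \<le> \<gamma>\<^sup>2" by simp
        have q': "sqint (\<lambda>x. 1 / \<gamma> * q x)"
          using sqint_square[OF q] by (simp add: sqint_def power_mult_distrib power_divide)
        have "sqnorm (\<lambda>x. 1 / \<gamma> * q x) = sqnorm q / \<gamma>\<^sup>2"
          by (simp add: sqnorm_def power_divide)
        also have "\<dots> \<le> 1" using sn g0 by simp
        finally show ?thesis using q q' by simp
      qed
      have f1: "sqint (\<lambda>x. Re (f x)) \<and> sqint (\<lambda>x. 1 / \<alpha> * Re (f x)) \<and> sqnorm (\<lambda>x. 1 / \<alpha> * Re (f x)) \<le> 1"
        and f2: "sqint (\<lambda>x. Im (f x)) \<and> sqint (\<lambda>x. 1 / \<alpha> * Im (f x)) \<and> sqnorm (\<lambda>x. 1 / \<alpha> * Im (f x)) \<le> 1"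
        by (rule part[OF _ _ pos(1) \<alpha>(3)]; simp add: abs_Re_le_cmod abs_Im_le_cmod)+
      have g1: "sqint (\<lambda>x. Re (g x)) \<and> sqint (\<lambda>x. 1 / \<beta> * Re (g x)) \<and> sqnorm (\<lambda>x. 1 / \<beta> * Re (g x)) \<le> 1"
        and g2: "sqint (\<lambda>x. Im (g x)) \<and> sqint (\<lambda>x. 1 / \<beta> * Im (g x)) \<and> sqnorm (\<lambda>x. 1 / \<beta> * Im (g x)) \<le> 1"
        by (rule part[OF _ _ pos(2) \<beta>(3)]; simp add: abs_Re_le_cmod abs_Im_le_cmod)+
      define S where "S F G x = (SUP k::int. ennreal \<bar>bilin (2 powi k) F G x\<bar>)" for F G and x :: 'a
      have Sm [measurable]: "S F G \<in> borel_measurable borel" if [measurable]: "F \<in> borel_measurable borel" "G \<in> borel_measurable borel" for F G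
        unfolding S_def[abs_def] by measurable
      have S: "(\<integral>\<^sup>+x. S F G x \<partial>lborel) \<le> ennreal (2 * C1 * (\<alpha> * \<beta>))"
        if F: "sqint F \<and> sqint (\<lambda>x. 1 / \<alpha> * F x) \<and> sqnorm (\<lambda>x. 1 / \<alpha> * F x) \<le> 1"
          and G: "sqint G \<and> sqint (\<lambda>x. 1 / \<beta> * G x) \<and> sqnorm (\<lambda>x. 1 / \<beta> * G x) \<le> 1" for F G
      proof -
        let ?F = "\<lambda>x. 1 / \<alpha> * F x" and ?G = "\<lambda>x. 1 / \<beta> * G x"
        have [measurable]: "?F \<in> borel_measurable borel" "?G \<in> borel_measurable borel"
          using sqint_measurable[of ?F] sqint_measurable[of ?G] F G by auto
        have "S F G x \<le> ennreal (\<alpha> * \<beta>) * S ?F ?G x" for x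
          unfolding S_def
        proof (rule SUP_least)
          fix k :: int
          have "bilin (2 powi k) ?F ?G x = 1 / \<alpha> * (1 / \<beta>) * bilin (2 powi k) F G x" by (rule bilin_scale)
          then have "bilin (2 powi k) F G x = \<alpha> * \<beta> * bilin (2 powi k) ?F ?G x" using pos by simp
          then have "ennreal \<bar>bilin (2 powi k) F G x\<bar> = ennreal (\<alpha> * \<beta>) * ennreal \<bar>bilin (2 powi k) ?F ?G x\<bar>"
            using pos by (simp only: abs_mult) (simp add: ennreal_mult)
          also have "\<dots> \<le> ennreal (\<alpha> * \<beta>) * (SUP k::int. ennreal \<bar>bilin (2 powi k) ?F ?G x\<bar>)"
            by (intro mult_left_mono SUP_upper) auto
          finally show "ennreal \<bar>bilin (2 powi k) F G x\<bar> \<le> \<dots>" .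
        qed
        then have "(\<integral>\<^sup>+x. S F G x \<partial>lborel) \<le> (\<integral>\<^sup>+x. ennreal (\<alpha> * \<beta>) * S ?F ?G x \<partial>lborel)"
          by (intro nn_integral_mono)
        also have "\<dots> = ennreal (\<alpha> * \<beta>) * (\<integral>\<^sup>+x. S ?F ?G x \<partial>lborel)" by (rule nn_integral_cmult) measurable
        also have "\<dots> \<le> ennreal (\<alpha> * \<beta>) * ennreal (C1 * (sqnorm ?F + sqnorm ?G))"
          unfolding S_def using F G by (intro mult_left_mono C1(2)) auto
        also have "\<dots> \<le> ennreal (\<alpha> * \<beta>) * ennreal (C1 * (1 + 1))"
          using F G C1(1) by (intro mult_left_mono ennreal_leI add_mono) auto
        also have "\<dots> = ennreal (\<alpha> * \<beta> * (C1 * (1 + 1)))"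
          using pos by (intro ennreal_mult'[symmetric]) simp
        also have "\<alpha> * \<beta> * (C1 * (1 + 1)) = 2 * C1 * (\<alpha> * \<beta>)" by simp
        finally show ?thesis .
      qed
      let ?fr = "\<lambda>x. Re (f x)" and ?fi = "\<lambda>x. Im (f x)" and ?gr = "\<lambda>x. Re (g x)" and ?gi = "\<lambda>x. Im (g x)"
      have pt: "dyadic_sph_max f g x \<le> ennreal s * (S ?fr ?gr x + S ?fi ?gi x + S ?fr ?gi x + S ?fi ?gr x)" for x
        unfolding dyadic_sph_max_def
      proof (rule SUP_least)
        fix k :: int
        let ?b = "\<lambda>F G. \<bar>bilin (2 powi k) F G x\<bar>"
        have "norm (sph_avg (2 powi k) f g x) \<le> s * (?b ?fr ?gr + ?b ?fi ?gi + ?b ?fr ?gi + ?b ?fi ?gr)"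
          unfolding s_def by (rule norm_sph_avg_le_bilin) (use f1 f2 g1 g2 dim m in auto)
        then have "ennreal (norm (sph_avg (2 powi k) f g x)) \<le> ennreal (s * (?b ?fr ?gr + ?b ?fi ?gi + ?b ?fr ?gi + ?b ?fi ?gr))"
          by (rule ennreal_leI)
        also have "\<dots> = ennreal s * (ennreal (?b ?fr ?gr) + ennreal (?b ?fi ?gi) + ennreal (?b ?fr ?gi) + ennreal (?b ?fi ?gr))"
          using s by (simp add: ennreal_mult)
        also have "\<dots> \<le> ennreal s * (S ?fr ?gr x + S ?fi ?gi x + S ?fr ?gi x + S ?fi ?gr x)"
          unfolding S_def by (intro mult_left_mono add_mono SUP_upper) auto
        finally show "ennreal (norm (sph_avg (2 powi k) f g x)) \<le> \<dots>" .
      qed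
      have "Lp_norm 1 (dyadic_sph_max f g) \<le> (\<integral>\<^sup>+x. ennreal s * (S ?fr ?gr x + S ?fi ?gi x + S ?fr ?gi x + S ?fi ?gr x) \<partial>lborel)"
        unfolding L1 by (rule nn_integral_mono) (rule pt)
      also have "\<dots> = ennreal s * ((\<integral>\<^sup>+x. S ?fr ?gr x \<partial>lborel) + (\<integral>\<^sup>+x. S ?fi ?gi x \<partial>lborel) + (\<integral>\<^sup>+x. S ?fr ?gi x \<partial>lborel) + (\<integral>\<^sup>+x. S ?fi ?gr x \<partial>lborel))"
        by (simp add: nn_integral_cmult nn_integral_add)
      also have "\<dots> \<le> ennreal s * (ennreal (2 * C1 * (\<alpha> * \<beta>)) + ennreal (2 * C1 * (\<alpha> * \<beta>)) + ennreal (2 * C1 * (\<alpha> * \<beta>)) + ennreal (2 * C1 * (\<alpha> * \<beta>)))"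
        by (intro mult_left_mono add_mono S f1 f2 g1 g2) simp
      also have "\<dots> = ennreal (s * (2 * C1 * (\<alpha> * \<beta>) + 2 * C1 * (\<alpha> * \<beta>) + 2 * C1 * (\<alpha> * \<beta>) + 2 * C1 * (\<alpha> * \<beta>)))"
      proof -
        have r: "0 \<le> 2 * C1 * (\<alpha> * \<beta>)" using C1 pos by simp
        show ?thesis
          unfolding ennreal_mult'[OF s] by (simp only: ennreal_plus r add_nonneg_nonneg)
      qed
      also have "s * (2 * C1 * (\<alpha> * \<beta>) + 2 * C1 * (\<alpha> * \<beta>) + 2 * C1 * (\<alpha> * \<beta>) + 2 * C1 * (\<alpha> * \<beta>)) = C * (\<alpha> * \<beta>)"
        by (simp add: C_def)
      finally show ?thesis .
    qed
    also have "ennreal (C * (\<alpha> * \<beta>)) = ennreal C * Lp_norm 2 (\<lambda>x. ennreal (norm (f x))) * Lp_norm 2 (\<lambda>x. ennreal (norm (g x)))"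
      using C \<alpha> \<beta> by (simp add: ennreal_mult mult.assoc)
    finally show "Lp_norm 1 (dyadic_sph_max f g) \<le> \<dots>" .
  qed
qed

lemma sph_max_bounded_hoelder:
  fixes p1 p2 p :: ennreal
  assumes dim: "DIM('a::euclidean_space) \<ge> 2"
    and p: "2 \<le> p1" "2 \<le> p2" "1 \<le> p" "p \<le> 2" and hoelder: "1 / p = 1 / p1 + 1 / p2"
  shows "sph_max_bounded TYPE('a) p1 p2 p"
proof -
  obtain c where c: "p = ennreal c" "1 \<le> c" "c \<le> 2"
    using p(3,4) by (cases p) (auto simp: top_unique simp flip: ennreal_1 ennreal_numeral)
  have inv: "1 / ennreal r = ennreal (1 / r)" if "0 < r" for r
    using divide_ennreal[of 1 r] that by simp
  have two: "p = 2" if "1 / p = 1 / 2"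
  proof -
    have "ennreal (1 / c) = ennreal (1 / 2)" using that c inv[of c] inv[of 2] by simp
    then have "c = 2" using c by (subst (asm) ennreal_inj) auto
    then show ?thesis by (simp add: c(1))
  qed
  \<comment> \<open>Applied when one of the two exponents is infinite and \<open>q\<close> is the
    other: \<open>p = q\<close> together with \<open>p \<le> 2 \<le> q\<close> leaves only the value
    2. An infinite \<open>q\<close> is excluded because \<open>1 / p\<close> is positive.\<close>
  have one: "q = 2" if q: "2 \<le> q" "1 / p = 1 / q" for q
  proof -
    have "q \<noteq> \<infinity>" using q c inv[of c] by (auto simp: ennreal_eq_0_iff)
    then obtain d where d: "q = ennreal d" "2 \<le> d"
      using q(1) by (cases q) (auto simp flip: ennreal_numeral)
    then have "1 / c = 1 / d" using q(2) c inv[of c] inv[of d] by simp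
    then have "d = 2" using c d by simp
    then show ?thesis by (simp add: d)
  qed
  show ?thesis
  proof (cases p1)
    case top
    then have "1 / p = 1 / p2" using hoelder by simp
    moreover from this have "p2 = 2" by (rule one[OF p(2)])
    moreover from calculation have "p = 2" by (intro two) simp
    ultimately show ?thesis using top sph_max_bounded_infinity_2(1)[OF dim] by simp
  next
    case (real a)
    then have a: "2 \<le> a" using p(1) by (simp flip: ennreal_numeral)
    show ?thesis
    proof (cases p2)
      case top
      then have "1 / p = 1 / p1" using hoelder by simp
      moreover from this have "p1 = 2" by (rule one[OF p(1)])
      moreover from calculation have "p = 2" by (intro two) simp
      ultimately show ?thesis using top sph_max_bounded_infinity_2(2)[OF dim] by simp
    next
      case (real b)
      then have b: "2 \<le> b" using p(2) by (simp flip: ennreal_numeral)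
      have "ennreal (1 / c) = ennreal (1 / a) + ennreal (1 / b)"
        using hoelder inv[of a] inv[of b] inv[of c] a b c \<open>p1 = ennreal a\<close> \<open>p2 = ennreal b\<close> by simp
      also have "\<dots> = ennreal (1 / a + 1 / b)" using a b by simp
      finally have abc: "1 / c = 1 / a + 1 / b" using a b c by (subst (asm) ennreal_inj) auto
      show ?thesis
      \<comment> \<open>At \<open>p = 1\<close> the reciprocals \<open>1 / a\<close> and
        \<open>1 / b\<close> are at most one half and add up to 1, so both exponents are 2 and the
        endpoint result applies.\<close>
      proof (cases "c = 1")
        case True
        have "1 / a \<le> 1 / 2" "1 / b \<le> 1 / 2" using a b by (simp_all add: frac_le)
        then have "1 / a = 1 / 2" "1 / b = 1 / 2" using abc unfolding True by linarith+
        then have "a = 2" "b = 2" using a b by (simp_all add: field_simps)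
        then show ?thesis using sph_max_bounded_2_2_1[OF dim] True c \<open>p1 = ennreal a\<close> \<open>p2 = ennreal b\<close> by simp
      next
        case False
        then show ?thesis
          using sph_max_bounded_finite_exponents[OF dim _ _ _ abc] a b c \<open>p1 = ennreal a\<close> \<open>p2 = ennreal b\<close> by simp
      qed
    qed
  qed
qed

theorem theorem6p5:
  fixes p1 p2 p :: ennreal
  assumes "CARD('n::finite) \<ge> 2"
    and "2 \<le> p1" and "2 \<le> p2"
    and "1 \<le> p" and "p \<le> 2"
    and "1 / p = 1 / p1 + 1 / p2"
  shows "\<exists>C::ennreal. C < \<infinity> \<and>
    (\<forall>f \<in> Lp_functions p1. \<forall>g \<in> Lp_functions p2 :: (real ^ 'n \<Rightarrow> complex) set.
       (AE x in lebesgue. \<forall>k::int. integrable sphere_measure (sph_integrand (2 powi k) f g x)) \<and>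
       dyadic_sph_max f g \<in> borel_measurable lebesgue \<and>
       Lp_norm p (dyadic_sph_max f g)
         \<le> C * Lp_norm p1 (\<lambda>x. ennreal (norm (f x))) * Lp_norm p2 (\<lambda>x. ennreal (norm (g x))))"
proof -
  have dim: "DIM(real ^ 'n) \<ge> 2" using assms(1) by simp
  obtain C :: real where C: "\<And>f g :: real ^ 'n \<Rightarrow> complex. f \<in> borel_measurable borel \<Longrightarrow> g \<in> borel_measurable borel \<Longrightarrow>
     Lp_norm p1 (\<lambda>x. ennreal (norm (f x))) < \<infinity> \<Longrightarrow> Lp_norm p2 (\<lambda>x. ennreal (norm (g x))) < \<infinity> \<Longrightarrow>
     Lp_norm p (dyadic_sph_max f g) \<le> ennreal C * Lp_norm p1 (\<lambda>x. ennreal (norm (f x))) * Lp_norm p2 (\<lambda>x. ennreal (norm (g x)))"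
    using sph_max_bounded_hoelder[OF dim assms(2-6)] unfolding sph_max_bounded_def by metis
  show ?thesis
  proof (intro exI[of _ "ennreal C"] conjI ballI)
    show "ennreal C < \<infinity>" by simp
    fix f g :: "real ^ 'n \<Rightarrow> complex"
    assume "f \<in> Lp_functions p1" "g \<in> Lp_functions p2"
    then have f: "f \<in> borel_measurable lebesgue" "Lp_norm p1 (\<lambda>x. ennreal (norm (f x))) < \<infinity>"
      and g: "g \<in> borel_measurable lebesgue" "Lp_norm p2 (\<lambda>x. ennreal (norm (g x))) < \<infinity>"
      by (auto simp: Lp_functions_def)
    \<comment> \<open>Lebesgue measurable functions are exchanged for Borel ones; this alters
      neither their norms nor the averages at any point.\<close>
    obtain f' where f': "f' \<in> borel_measurable borel" "AE x in lborel. f x = f' x" using exists_borel_version[OF f(1)] .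
    obtain g' where g': "g' \<in> borel_measurable borel" "AE x in lborel. g x = g' x" using exists_borel_version[OF g(1)] .
    have nf: "Lp_norm p1 (\<lambda>x. ennreal (norm (f x))) = Lp_norm p1 (\<lambda>x. ennreal (norm (f' x)))"
      using f(1) f' by (intro Lp_norm_cong_AE) (auto intro!: measurable_completion elim!: eventually_mono)
    have ng: "Lp_norm p2 (\<lambda>x. ennreal (norm (g x))) = Lp_norm p2 (\<lambda>x. ennreal (norm (g' x)))"
      using g(1) g' by (intro Lp_norm_cong_AE) (auto intro!: measurable_completion elim!: eventually_mono)
    have eq: "dyadic_sph_max f g = dyadic_sph_max f' g'"
      by (rule dyadic_sph_max_cong_AE[OF f'(1) g'(1) f'(2) g'(2) dim])
    \<comment> \<open>Shown for every \<open>x\<close> and every scale: local square integrability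
      and the bounded marginals leave no exceptional points.\<close>
    have "integrable sphere_measure (sph_integrand (2 powi k) f g x)" for k :: int and x
      by (rule sph_avg_cong_AE(2)[OF f'(1) g'(1) f'(2) g'(2) _ dim])
        (use integrable_sph_integrand[OF f'(1) g'(1) assms(2,3) _ dim] f(2) g(2) in \<open>simp_all add: nf ng\<close>)
    then show "AE x in lebesgue. \<forall>k::int. integrable sphere_measure (sph_integrand (2 powi k) f g x)"
      by simp
    show "dyadic_sph_max f g \<in> borel_measurable lebesgue"
      unfolding eq using f'(1) g'(1) by (intro measurable_completion) simp
    show "Lp_norm p (dyadic_sph_max f g) \<le> ennreal C * Lp_norm p1 (\<lambda>x. ennreal (norm (f x))) * Lp_norm p2 (\<lambda>x. ennreal (norm (g x)))"
      unfolding eq nf ng by (rule C[OF f'(1) g'(1)]) (use f(2) g(2) in \<open>simp_all add: nf ng\<close>)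
  qed
qed

end
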